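(* Let $(M,g)$ be a smooth Riemannian manifold of dimension $n>1$ with constant sectional curvature $c$, and let $k\neq 0$ be a real constant. Let $a_1:[0,\infty)\to\mathbb{R}$ be a smooth function such that, with $$b_1=\frac{a_1a_1'-c}{a_1-2ta_1'},\qquad \lambda=\frac{4c}{k}\,\frac{a_1}{a_1^2+2ct},\qquad \mu=\lambda',$$ (all denominators being nowhere zero) one has $a_1>0$, $a_1+2tb_1>0$, $\lambda>0$, $\lambda+2t\lambda'>0$ for all $t\ge0$. Let $(G,J)$ be the natural structure of diagonal type on $T^*M$ determined by $a_1,b_1,\lambda,\mu$. Then $(T^*M,G,J)$ is a Kähler Einstein manifold, and it has constant holomorphic sectional curvature $k$.
   Context: Let $(M,g)$ be an $n$-dimensional Riemannian manifold and $\pi:T^*M\to M$ its cotangent bundle. A local chart $(U,x^1,\dots,x^n)$ of $M$ induces a chart $(\pi^{-1}(U),q^1,\dots,q^n,p_1,\dots,p_n)$ of $T^*M$ with $q^i=x^i\circ\pi$ and $p=p_i\,dx^i_{\pi(p)}$. Summation convention is used. Let $\Gamma^k_{ij}$ be the Christoffel symbols of the Levi-Civita connection of $g$, $(g^{ij})$ the inverse matrix of $(g_{ij})$, $\Gamma^0_{ih}=p_k\Gamma^k_{ih}$, $g^{0i}=p_hg^{hi}$, $\partial^i=\partial/\partial p_i$ and $\delta_i=\partial/\partial q^i+\Gamma^0_{ih}\,\partial/\partial p_h$. Then $(\partial^1,\dots,\partial^n,\delta_1,\dots,\delta_n)$ is a local frame on $T^*M$. Let $t=\frac12 g^{ik}p_ip_k\in[0,\infty)$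 be the energy density; functions of $t$ are regarded as functions on $T^*M$, and a prime denotes $d/dt$. The natural structure $(G,J)$ of diagonal type determined by $a_1,b_1,\lambda,\mu$ is $$J\delta_i=a_1g_{ij}\partial^j+b_1p_ip_j\partial^j,\qquad J\partial^i=-a_2g^{ij}\delta_j-b_2g^{0i}g^{0j}\delta_j,$$ $$G(\delta_i,\delta_j)=c_1g_{ij}+d_1p_ip_j,\qquad G(\partial^i,\partial^j)=c_2g^{ij}+d_2g^{0i}g^{0j},\qquad G(\partial^i,\delta_j)=0,$$ where $a_2=\frac1{a_1}$, $b_2=-\frac{b_1}{a_1(a_1+2tb_1)}$, $c_1=\lambda a_1$, $c_2=\lambda a_2$, $d_1=\lambda b_1+\mu(a_1+2tb_1)$, $d_2=\lambda b_2+\mu(a_2+2tb_2)$. Kähler means that $J$ is an integrable almost complex structure, $G(JX,JY)=G(X,Y)$, and $\phi(X,Y)=G(X,JY)$ is closed; Einstein means that the Ricci tensor of $G$ is a constant multiple of $G$. A Kähler manifold $(T^*M,G,J)$ has constant holomorphic sectional curvature $k$ if its curvature tensor $K(X,Y)Z=\nabla_X\nabla_YZ-\nabla_Y\nabla_XZ-\nabla_{[X,Y]}Z$ (with $\nabla$ the Levi-Civita connection of $G$) satisfies $$K(X,Y)Z=\tfrac{k}{4}\big(G(Z,Y)X-G(Z,X)Y+G(Z,JY)JX-G(Z,JX)JY+2G(X,JY)JZ\big).$$ *)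

theory Defs
  imports "HOL-Analysis.Analysis"
begin

section \<open>Smoothness\<close>

text \<open>
  The domain is only ever an open set or the half-line \<open>{0..}\<close>, so derivatives within it
  are unique (one-sided at the end point \<open>0\<close>). The model spaces are finite-dimensional, so
  continuity of all iterated directional derivatives is the usual notion.
\<close>

primrec Ck_on ::
  "nat \<Rightarrow> 'a::real_normed_vector set \<Rightarrow> ('a \<Rightarrow> 'b::real_normed_vector) \<Rightarrow> bool" where
  "Ck_on 0 S f = continuous_on S f"
| "Ck_on (Suc r) S f =
     (\<exists>f'. (\<forall>x\<in>S. (f has_derivative f' x) (at x within S)) \<and> (\<forall>v. Ck_on r S (\<lambda>x. f' x v)))"

definition smooth_on ::
  "'a::real_normed_vector set \<Rightarrow> ('a \<Rightarrow> 'b::real_normed_vector) \<Rightarrow> bool" where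
  "smooth_on S f \<longleftrightarrow> (\<forall>r. Ck_on r S f)"

definition deriv_half_line :: "(real \<Rightarrow> real) \<Rightarrow> real \<Rightarrow> real" where
  "deriv_half_line f t = vector_derivative f (at t within {0..})"


section \<open>Manifolds\<close>

text \<open>
  A manifold is given by an atlas on the union of its chart domains; it carries the topology
  induced by the charts. A chart is a pair of its domain and its coordinate map, whose values
  outside the domain are irrelevant.
\<close>

type_synonym ('p, 'e) chart = "'p set \<times> ('p \<Rightarrow> 'e)"
type_synonym ('p, 'e) atlas = "('p, 'e) chart set"

definition carrier_of :: "('p, 'e) atlas \<Rightarrow> 'p set" where
  "carrier_of A = \<Union> (fst ` A)"

definition chart_inv :: "('p, 'e) chart \<Rightarrow> 'e \<Rightarrow> 'p" where
  "chart_inv \<phi> = inv_into (fst \<phi>) (snd \<phi>)"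

definition transition :: "('p, 'e) chart \<Rightarrow> ('p, 'e) chart \<Rightarrow> 'e \<Rightarrow> 'e" where
  "transition \<phi> \<psi> = snd \<psi> \<circ> chart_inv \<phi>"

definition charts_at :: "('p, 'e) atlas \<Rightarrow> 'p \<Rightarrow> ('p, 'e) chart set" where
  "charts_at A p = {\<phi> \<in> A. p \<in> fst \<phi>}"

definition smooth_atlas :: "('p, 'e::euclidean_space) atlas \<Rightarrow> bool" where
  "smooth_atlas A \<longleftrightarrow>
     (\<forall>\<phi>\<in>A. inj_on (snd \<phi>) (fst \<phi>) \<and> open (snd \<phi> ` fst \<phi>)) \<and>
     (\<forall>\<phi>\<in>A. \<forall>\<psi>\<in>A. open (snd \<phi> ` (fst \<phi> \<inter> fst \<psi>)) \<and>
        smooth_on (snd \<phi> ` (fst \<phi> \<inter> fst \<psi>)) (transition \<phi> \<psi>))"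

definition atlas_topology :: "('p, 'e::euclidean_space) atlas \<Rightarrow> 'p topology" where
  "atlas_topology A =
     topology (\<lambda>W. W \<subseteq> carrier_of A \<and> (\<forall>\<phi>\<in>A. open (snd \<phi> ` (W \<inter> fst \<phi>))))"

definition smooth_manifold :: "('p, 'e::euclidean_space) atlas \<Rightarrow> bool" where
  "smooth_manifold A \<longleftrightarrow>
     smooth_atlas A \<and> Hausdorff_space (atlas_topology A) \<and> second_countable (atlas_topology A)"

definition smooth_fun :: "('p, 'e::euclidean_space) atlas \<Rightarrow> 'p set \<Rightarrow> ('p \<Rightarrow> real) \<Rightarrow> bool" where
  "smooth_fun A W f \<longleftrightarrow> (\<forall>\<phi>\<in>A. smooth_on (snd \<phi> ` (W \<inter> fst \<phi>)) (f \<circ> chart_inv \<phi>))"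


section \<open>Tangent vectors and vector fields\<close>

text \<open>
  A tangent vector at \<open>p\<close> is the family of its component vectors in all charts around \<open>p\<close>,
  transforming under changes of charts by the Jacobian; it is \<open>0\<close> at all other charts.
\<close>

type_synonym ('p, 'e) tvec = "('p, 'e) chart \<Rightarrow> 'e"
type_synonym ('p, 'e) field = "'p \<Rightarrow> ('p, 'e) tvec"

definition tangent_space :: "('p, 'e::euclidean_space) atlas \<Rightarrow> 'p \<Rightarrow> ('p, 'e) tvec set" where
  "tangent_space A p =
     {u. (\<forall>\<phi>. \<phi> \<notin> charts_at A p \<longrightarrow> u \<phi> = 0) \<and>
         (\<forall>\<phi>\<in>charts_at A p. \<forall>\<psi>\<in>charts_at A p.
            u \<psi> = frechet_derivative (transition \<phi> \<psi>) (at (snd \<phi> p)) (u \<phi>))}"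

definition lincomb ::
  "real \<Rightarrow> ('p, 'e::euclidean_space) tvec \<Rightarrow> real \<Rightarrow> ('p, 'e) tvec \<Rightarrow> ('p, 'e) tvec" where
  "lincomb a u b v = (\<lambda>\<phi>. a *\<^sub>R u \<phi> + b *\<^sub>R v \<phi>)"

text \<open>
  The tangent vector at \<open>p\<close> with components \<open>v\<close> in the chart \<open>\<phi>\<close>; for the \<open>i\<close>-th standard
  basis vector \<open>v\<close> this is the coordinate vector of the \<open>i\<close>-th coordinate of \<open>\<phi>\<close>.
\<close>

definition coord_vec ::
  "('p, 'e::euclidean_space) atlas \<Rightarrow> ('p, 'e) chart \<Rightarrow> 'p \<Rightarrow> 'e \<Rightarrow> ('p, 'e) tvec" where
  "coord_vec A \<phi> p v =
     (\<lambda>\<psi>. if \<psi> \<in> charts_at A p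
           then frechet_derivative (transition \<phi> \<psi>) (at (snd \<phi> p)) v else 0)"

definition coord_field ::
  "('p, 'e::euclidean_space) atlas \<Rightarrow> ('p, 'e) chart \<Rightarrow> 'e \<Rightarrow> ('p, 'e) field" where
  "coord_field A \<phi> v = (\<lambda>p. coord_vec A \<phi> p v)"

definition chart_at :: "('p, 'e) atlas \<Rightarrow> 'p \<Rightarrow> ('p, 'e) chart" where
  "chart_at A p = (SOME \<phi>. \<phi> \<in> charts_at A p)"

definition dir_deriv ::
  "('p, 'e::euclidean_space) atlas \<Rightarrow> 'p \<Rightarrow> ('p, 'e) tvec \<Rightarrow> ('p \<Rightarrow> real) \<Rightarrow> real" where
  "dir_deriv A p u f =
     frechet_derivative (f \<circ> chart_inv (chart_at A p)) (at (snd (chart_at A p) p)) (u (chart_at A p))"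

text \<open>Vector fields are total functions of which only the values on \<open>W\<close> matter.\<close>

definition smooth_fields ::
  "('p, 'e::euclidean_space) atlas \<Rightarrow> 'p set \<Rightarrow> ('p, 'e) field set" where
  "smooth_fields A W =
     {X. (\<forall>p\<in>W. X p \<in> tangent_space A p) \<and>
         (\<forall>\<phi>\<in>A. smooth_on (snd \<phi> ` (W \<inter> fst \<phi>)) (\<lambda>x. X (chart_inv \<phi> x) \<phi>))}"

definition lie_bracket ::
  "('p, 'e::euclidean_space) atlas \<Rightarrow> ('p, 'e) field \<Rightarrow> ('p, 'e) field \<Rightarrow> ('p, 'e) field" where
  "lie_bracket A X Y p =
     (\<lambda>\<phi>. if \<phi> \<in> charts_at A p
       then frechet_derivative (\<lambda>x. Y (chart_inv \<phi> x) \<phi>) (at (snd \<phi> p)) (X p \<phi>)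
          - frechet_derivative (\<lambda>x. X (chart_inv \<phi> x) \<phi>) (at (snd \<phi> p)) (Y p \<phi>)
       else 0)"


section \<open>Riemannian metrics, Levi-Civita connection, curvature\<close>

type_synonym ('p, 'e) bilin = "'p \<Rightarrow> ('p, 'e) tvec \<Rightarrow> ('p, 'e) tvec \<Rightarrow> real"
type_synonym ('p, 'e) endo = "'p \<Rightarrow> ('p, 'e) tvec \<Rightarrow> ('p, 'e) tvec"
type_synonym ('p, 'e) connection = "('p, 'e) field \<Rightarrow> ('p, 'e) field \<Rightarrow> ('p, 'e) field"

definition sym_bilinear_on ::
  "('p, 'e::euclidean_space) tvec set \<Rightarrow> (('p, 'e) tvec \<Rightarrow> ('p, 'e) tvec \<Rightarrow> real) \<Rightarrow> bool" where
  "sym_bilinear_on T B \<longleftrightarrow>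
     (\<forall>u\<in>T. \<forall>v\<in>T. B u v = B v u) \<and>
     (\<forall>u\<in>T. \<forall>v\<in>T. \<forall>w\<in>T. \<forall>a b. B (lincomb a u b v) w = a * B u w + b * B v w)"

definition linear_endo_on ::
  "('p, 'e::euclidean_space) tvec set \<Rightarrow> (('p, 'e) tvec \<Rightarrow> ('p, 'e) tvec) \<Rightarrow> bool" where
  "linear_endo_on T L \<longleftrightarrow>
     (\<forall>u\<in>T. L u \<in> T) \<and>
     (\<forall>u\<in>T. \<forall>v\<in>T. \<forall>a b. L (lincomb a u b v) = lincomb a (L u) b (L v))"

definition riemannian_metric ::
  "('p, 'e::euclidean_space) atlas \<Rightarrow> ('p, 'e) bilin \<Rightarrow> bool" where
  "riemannian_metric A g \<longleftrightarrow>
     (\<forall>p\<in>carrier_of A. sym_bilinear_on (tangent_space A p) (g p) \<and>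
        (\<forall>u\<in>tangent_space A p. u \<noteq> (\<lambda>_. 0) \<longrightarrow> 0 < g p u u)) \<and>
     (\<forall>\<phi>\<in>A. \<forall>v w. smooth_fun A (fst \<phi>) (\<lambda>p. g p (coord_vec A \<phi> p v) (coord_vec A \<phi> p w)))"

definition riemannian_manifold ::
  "('p, 'e::euclidean_space) atlas \<Rightarrow> ('p, 'e) bilin \<Rightarrow> bool" where
  "riemannian_manifold A g \<longleftrightarrow> smooth_manifold A \<and> riemannian_metric A g"

text \<open>
  Connections act on fields over arbitrary open sets. Compatibility with restriction needs no
  axiom: taking for \<open>f\<close> a function that is \<open>0\<close> on \<open>W\<close> and \<open>1\<close> elsewhere shows that the value on
  \<open>W\<close> only depends on the values of the arguments on \<open>W\<close>.
\<close>

definition affine_connection ::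
  "('p, 'e::euclidean_space) atlas \<Rightarrow> ('p, 'e) connection \<Rightarrow> bool" where
  "affine_connection A D \<longleftrightarrow>
     (\<forall>W. openin (atlas_topology A) W \<longrightarrow>
       (\<forall>X\<in>smooth_fields A W. \<forall>Y\<in>smooth_fields A W.
          D X Y \<in> smooth_fields A W \<and>
          (\<forall>Z\<in>smooth_fields A W. \<forall>p\<in>W.
             D (\<lambda>q. lincomb 1 (X q) 1 (Z q)) Y p = lincomb 1 (D X Y p) 1 (D Z Y p) \<and>
             D X (\<lambda>q. lincomb 1 (Y q) 1 (Z q)) p = lincomb 1 (D X Y p) 1 (D X Z p)) \<and>
          (\<forall>f. smooth_fun A W f \<longrightarrow> (\<forall>p\<in>W.
             D (\<lambda>q \<phi>. f q *\<^sub>R X q \<phi>) Y p = (\<lambda>\<phi>. f p *\<^sub>R D X Y p \<phi>) \<and>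
             D X (\<lambda>q \<phi>. f q *\<^sub>R Y q \<phi>) p = lincomb (dir_deriv A p (X p) f) (Y p) (f p) (D X Y p)))))"

definition is_levi_civita ::
  "('p, 'e::euclidean_space) atlas \<Rightarrow> ('p, 'e) bilin \<Rightarrow> ('p, 'e) connection \<Rightarrow> bool" where
  "is_levi_civita A g D \<longleftrightarrow>
     affine_connection A D \<and>
     (\<forall>W. openin (atlas_topology A) W \<longrightarrow>
       (\<forall>X\<in>smooth_fields A W. \<forall>Y\<in>smooth_fields A W. \<forall>p\<in>W.
          lincomb 1 (D X Y p) (-1) (D Y X p) = lie_bracket A X Y p \<and>
          (\<forall>Z\<in>smooth_fields A W.
             dir_deriv A p (X p) (\<lambda>q. g q (Y q) (Z q)) =
               g p (D X Y p) (Z p) + g p (Y p) (D X Z p))))"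

text \<open>
  The axioms determine the connection on smooth fields; the choice only concerns the irrelevant
  values at other arguments.
\<close>

definition levi_civita ::
  "('p, 'e::euclidean_space) atlas \<Rightarrow> ('p, 'e) bilin \<Rightarrow> ('p, 'e) connection" where
  "levi_civita A g = (SOME D. is_levi_civita A g D)"

definition curvature ::
  "('p, 'e::euclidean_space) atlas \<Rightarrow> ('p, 'e) bilin \<Rightarrow>
    ('p, 'e) field \<Rightarrow> ('p, 'e) field \<Rightarrow> ('p, 'e) field \<Rightarrow> ('p, 'e) field" where
  "curvature A g X Y Z =
     (let D = levi_civita A g
      in (\<lambda>p \<phi>. D X (D Y Z) p \<phi> - D Y (D X Z) p \<phi> - D (lie_bracket A X Y) Z p \<phi>))"

definition constant_sectional_curvature ::
  "('p, 'e::euclidean_space) atlas \<Rightarrow> ('p, 'e) bilin \<Rightarrow> real \<Rightarrow> bool" where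
  "constant_sectional_curvature A g c \<longleftrightarrow>
     (\<forall>W. openin (atlas_topology A) W \<longrightarrow>
       (\<forall>X\<in>smooth_fields A W. \<forall>Y\<in>smooth_fields A W. \<forall>p\<in>W.
          (\<forall>a b. lincomb a (X p) b (Y p) = (\<lambda>_. 0) \<longrightarrow> a = 0 \<and> b = 0) \<longrightarrow>
          g p (curvature A g X Y Y p) (X p) /
            (g p (X p) (X p) * g p (Y p) (Y p) - (g p (X p) (Y p))\<^sup>2) = c))"

text \<open>\<open>Ric (Y, Z)\<close> is the trace of \<open>V \<mapsto> K (V, Y) Z\<close>.\<close>

definition ricci ::
  "('p, 'e::euclidean_space) atlas \<Rightarrow> ('p, 'e) bilin \<Rightarrow>
    ('p, 'e) field \<Rightarrow> ('p, 'e) field \<Rightarrow> 'p \<Rightarrow> real" where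
  "ricci A g Y Z p =
     (let \<phi> = chart_at A p
      in \<Sum>b\<in>Basis. curvature A g (coord_field A \<phi> b) Y Z p \<phi> \<bullet> b)"

definition einstein :: "('p, 'e::euclidean_space) atlas \<Rightarrow> ('p, 'e) bilin \<Rightarrow> bool" where
  "einstein A g \<longleftrightarrow>
     (\<exists>\<rho>. \<forall>W. openin (atlas_topology A) W \<longrightarrow>
       (\<forall>Y\<in>smooth_fields A W. \<forall>Z\<in>smooth_fields A W. \<forall>p\<in>W.
          ricci A g Y Z p = \<rho> * g p (Y p) (Z p)))"


section \<open>Kaehler manifolds\<close>

definition almost_complex_structure ::
  "('p, 'e::euclidean_space) atlas \<Rightarrow> ('p, 'e) endo \<Rightarrow> bool" where
  "almost_complex_structure A J \<longleftrightarrow>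
     (\<forall>p\<in>carrier_of A. linear_endo_on (tangent_space A p) (J p) \<and>
        (\<forall>u\<in>tangent_space A p. J p (J p u) = (\<lambda>\<phi>. - u \<phi>))) \<and>
     (\<forall>\<phi>\<in>A. \<forall>v. (\<lambda>p. J p (coord_vec A \<phi> p v)) \<in> smooth_fields A (fst \<phi>))"

text \<open>Integrability is the vanishing of the Nijenhuis tensor.\<close>

definition integrable_structure ::
  "('p, 'e::euclidean_space) atlas \<Rightarrow> ('p, 'e) endo \<Rightarrow> bool" where
  "integrable_structure A J \<longleftrightarrow>
     (\<forall>W. openin (atlas_topology A) W \<longrightarrow>
       (\<forall>X\<in>smooth_fields A W. \<forall>Y\<in>smooth_fields A W. \<forall>p\<in>W.
          let JX = (\<lambda>q. J q (X q)); JY = (\<lambda>q. J q (Y q))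
          in \<forall>\<phi>. lie_bracket A JX JY p \<phi> - J p (lie_bracket A JX Y p) \<phi>
                   - J p (lie_bracket A X JY p) \<phi> - lie_bracket A X Y p \<phi> = 0))"

definition closed_2form :: "('p, 'e::euclidean_space) atlas \<Rightarrow> ('p, 'e) bilin \<Rightarrow> bool" where
  "closed_2form A F \<longleftrightarrow>
     (\<forall>W. openin (atlas_topology A) W \<longrightarrow>
       (\<forall>X\<in>smooth_fields A W. \<forall>Y\<in>smooth_fields A W. \<forall>Z\<in>smooth_fields A W. \<forall>p\<in>W.
          dir_deriv A p (X p) (\<lambda>q. F q (Y q) (Z q))
          - dir_deriv A p (Y p) (\<lambda>q. F q (X q) (Z q))
          + dir_deriv A p (Z p) (\<lambda>q. F q (X q) (Y q))
          - F p (lie_bracket A X Y p) (Z p)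
          + F p (lie_bracket A X Z p) (Y p)
          - F p (lie_bracket A Y Z p) (X p) = 0))"

definition kaehler_manifold ::
  "('p, 'e::euclidean_space) atlas \<Rightarrow> ('p, 'e) bilin \<Rightarrow> ('p, 'e) endo \<Rightarrow> bool" where
  "kaehler_manifold A G J \<longleftrightarrow>
     riemannian_manifold A G \<and>
     almost_complex_structure A J \<and>
     integrable_structure A J \<and>
     (\<forall>p\<in>carrier_of A. \<forall>u\<in>tangent_space A p. \<forall>v\<in>tangent_space A p.
        G p (J p u) (J p v) = G p u v) \<and>
     closed_2form A (\<lambda>p u v. G p u (J p v))"

definition constant_holomorphic_sectional_curvature ::
  "('p, 'e::euclidean_space) atlas \<Rightarrow> ('p, 'e) bilin \<Rightarrow> ('p, 'e) endo \<Rightarrow> real \<Rightarrow> bool" where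
  "constant_holomorphic_sectional_curvature A G J k \<longleftrightarrow>
     (\<forall>W. openin (atlas_topology A) W \<longrightarrow>
       (\<forall>X\<in>smooth_fields A W. \<forall>Y\<in>smooth_fields A W. \<forall>Z\<in>smooth_fields A W. \<forall>p\<in>W.
          let x = X p; y = Y p; z = Z p
          in curvature A G X Y Z p =
             (\<lambda>\<phi>. (k / 4) *\<^sub>R
               (G p z y *\<^sub>R x \<phi> - G p z x *\<^sub>R y \<phi>
                + G p z (J p y) *\<^sub>R J p x \<phi> - G p z (J p x) *\<^sub>R J p y \<phi>
                + (2 * G p x (J p y)) *\<^sub>R J p z \<phi>))))"


section \<open>The cotangent bundle\<close>

text \<open>Covectors are made extensional so that they are determined by their values on the
  tangent space.\<close>

definition cotangent_space ::
  "('p, 'e::euclidean_space) atlas \<Rightarrow> 'p \<Rightarrow> (('p, 'e) tvec \<Rightarrow> real) set" where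
  "cotangent_space A m =
     {w \<in> extensional (tangent_space A m).
        \<forall>u\<in>tangent_space A m. \<forall>v\<in>tangent_space A m. \<forall>a b.
          w (lincomb a u b v) = a * w u + b * w v}"

type_synonym ('m, 'n) cot_point = "'m \<times> (('m, real^'n) tvec \<Rightarrow> real)"

definition cotangent_chart ::
  "('m, real^'n) atlas \<Rightarrow> ('m, real^'n) chart \<Rightarrow>
    (('m, 'n::finite) cot_point, (real^'n) \<times> (real^'n)) chart" where
  "cotangent_chart A \<phi> =
     (SIGMA m : fst \<phi>. cotangent_space A m,
      (\<lambda>(m, w). (snd \<phi> m, \<chi> i. w (coord_vec A \<phi> m (axis i 1)))))"

definition cotangent_atlas ::
  "('m, real^'n) atlas \<Rightarrow> (('m, 'n::finite) cot_point, (real^'n) \<times> (real^'n)) atlas" where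
  "cotangent_atlas A = cotangent_chart A ` A"


section \<open>Natural structures of diagonal type\<close>

definition metric_matrix ::
  "('m, real^'n) atlas \<Rightarrow> ('m, real^'n) bilin \<Rightarrow> ('m, real^'n) chart \<Rightarrow> 'm \<Rightarrow>
    real^'n::finite^'n" where
  "metric_matrix A g \<phi> m =
     (\<chi> i j. g m (coord_vec A \<phi> m (axis i 1)) (coord_vec A \<phi> m (axis j 1)))"

text \<open>\<open>christoffel A g \<phi> m k i j\<close> is the symbol with upper index \<open>k\<close> and lower indices \<open>i j\<close>.\<close>

definition christoffel ::
  "('m, real^'n) atlas \<Rightarrow> ('m, real^'n) bilin \<Rightarrow> ('m, real^'n) chart \<Rightarrow> 'm \<Rightarrow>
    'n::finite \<Rightarrow> 'n \<Rightarrow> 'n \<Rightarrow> real" where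
  "christoffel A g \<phi> m k i j =
     levi_civita A g (coord_field A \<phi> (axis i 1)) (coord_field A \<phi> (axis j 1)) m \<phi> $ k"

text \<open>
  In the chart of the cotangent bundle induced by \<open>\<phi>\<close>, \<open>e v\<close> is the tangent vector at \<open>z\<close> with
  components \<open>v\<close>, so \<open>e (ve i)\<close> is the derivative with respect to \<open>p_i\<close> and \<open>e (ho i)\<close> is
  \<open>\<delta>_i\<close>. Since \<open>e\<close> is linear, \<open>J\<close> is specified by linear combinations of components. Bilinearity
  and the values on the frame determine \<open>G\<close> and \<open>J\<close> on the tangent spaces.
\<close>

definition natural_diagonal_structure ::
  "('m, real^'n) atlas \<Rightarrow> ('m, real^'n) bilin \<Rightarrow>
    (real \<Rightarrow> real) \<Rightarrow> (real \<Rightarrow> real) \<Rightarrow> (real \<Rightarrow> real) \<Rightarrow> (real \<Rightarrow> real) \<Rightarrow>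
    (('m, 'n::finite) cot_point, (real^'n) \<times> (real^'n)) bilin \<Rightarrow>
    (('m, 'n) cot_point, (real^'n) \<times> (real^'n)) endo \<Rightarrow> bool" where
  "natural_diagonal_structure A g a1 b1 lam mu G J \<longleftrightarrow>
     (\<forall>z\<in>carrier_of (cotangent_atlas A).
        sym_bilinear_on (tangent_space (cotangent_atlas A) z) (G z) \<and>
        linear_endo_on (tangent_space (cotangent_atlas A) z) (J z)) \<and>
     (\<forall>\<phi>\<in>A. \<forall>m\<in>fst \<phi>. \<forall>w\<in>cotangent_space A m.
        let z = (m, w);
            e = coord_vec (cotangent_atlas A) (cotangent_chart A \<phi>) z;
            p = (\<lambda>i. w (coord_vec A \<phi> m (axis i 1)));
            gl = (\<lambda>i j. metric_matrix A g \<phi> m $ i $ j);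
            gu = (\<lambda>i j. matrix_inv (metric_matrix A g \<phi> m) $ i $ j);
            g0 = (\<lambda>i. \<Sum>h\<in>UNIV. p h * gu h i);
            \<Gamma>0 = (\<lambda>i h. \<Sum>k\<in>UNIV. p k * christoffel A g \<phi> m k i h);
            ve = (\<lambda>i. (0, axis i 1));
            ho = (\<lambda>i. (axis i 1, \<chi> h. \<Gamma>0 i h));
            t = 1 / 2 * (\<Sum>i\<in>UNIV. \<Sum>k\<in>UNIV. gu i k * p i * p k);
            a2 = 1 / a1 t;
            b2 = - b1 t / (a1 t * (a1 t + 2 * t * b1 t));
            c1 = lam t * a1 t;
            c2 = lam t * a2;
            d1 = lam t * b1 t + mu t * (a1 t + 2 * t * b1 t);
            d2 = lam t * b2 + mu t * (a2 + 2 * t * b2)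
        in \<forall>i j.
             J z (e (ho i)) = e (\<Sum>l\<in>UNIV. (a1 t * gl i l + b1 t * p i * p l) *\<^sub>R ve l) \<and>
             J z (e (ve i)) = e (\<Sum>l\<in>UNIV. (- a2 * gu i l - b2 * g0 i * g0 l) *\<^sub>R ho l) \<and>
             G z (e (ho i)) (e (ho j)) = c1 * gl i j + d1 * p i * p j \<and>
             G z (e (ve i)) (e (ve j)) = c2 * gu i j + d2 * g0 i * g0 j \<and>
             G z (e (ve i)) (e (ho j)) = 0)"

end

theory Submission
  imports Defs
begin

text \<open>
  Constancy of the sectional curvature \<open>c\<close> means that on the sum of the trivial line bundle and \<open>TM\<close> the
  metric connection \<open>D\<^sub>X (s, v) = (X s - c g(X, v), \<nabla>\<^sub>X v + s X)\<close> is flat. Pull its complexification, with the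
  Hermitian form \<open>h\<close> given by \<open>s s' + c g(v, v')\<close>, back to \<open>T\<^sup>*M\<close>. The section
  \<open>\<sigma> = (a\<^sub>1, i p\<^sup>\<sharp>) / sqrt (a\<^sub>1\<^sup>2 + 2 c t)\<close> has unit length, so it is a map into a bundle of projective spaces (of
  hyperbolic type for \<open>c < 0\<close>) along a flat connection. Its derivative \<open>\<Phi>\<close>, the part of \<open>D \<sigma>\<close> orthogonal to
  \<open>\<sigma>\<close> and \<open>i \<sigma>\<close>, satisfies \<open>G = (4 / k) h(\<Phi>, \<Phi>)\<close> and \<open>\<Phi> J = i \<Phi>\<close>; this is where the formulas for \<open>b\<^sub>1\<close>,
  \<open>\<lambda>\<close> and \<open>\<mu>\<close> enter. As for the Fubini--Study metric, the projection of \<open>D\<close> to the complement of \<open>\<sigma>\<close> induces a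
  connection that is torsion-free, metric and complex linear, so \<open>\<Phi>\<close> carries the Levi-Civita connection of \<open>G\<close>
  to it. Hence \<open>J\<close> is parallel, which gives the Kaehler property, and the curvature is that of a space of
  constant holomorphic sectional curvature \<open>k\<close>. Taking the trace, \<open>G\<close> is Einstein.
\<close>


section \<open>Calculus of smooth maps\<close>

text \<open>For c > 0 the model is the sphere of radius 1 / sqrt c in Euclidean space: (s, v) over a
  point x is the ambient vector s x + v, \<open>D\<close> is ordinary differentiation, h is c times
  the ambient inner product, and \<sigma> sends a covector p to the complex line through a1 x + i p.
  Source and target have the same dimension 2n, and the map is an immersion exactly where two
  factors are nonzero: a1 - 2t a1', which is a1^2 times the derivative of r / a1 in r = |p|, and
  a1^2 - 2ct, the value on a1 x + i p of the complex bilinear extension of h. The second is the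
  first times a1 + 2t b1, so both are nonzero; c is nonzero because \<lambda> is positive. Three
  obstacles shape the proof. For c < 0 the form h is indefinite, so uniqueness arguments rest on an
  explicit nondegeneracy proof instead of positivity. The function a1 has only a one-sided
  derivative at 0, a value that t takes on the whole zero section. The Levi-Civita connection is a
  choice, determined on smooth fields alone, so it is identified with an explicit connection in
  charts before any curvature is computed.\<close>

lemma Ck_on_cong:
  assumes "Ck_on r S f" "\<And>x. x \<in> S \<Longrightarrow> f x = h x"
  shows "Ck_on r S h"
proof (cases r)
  case 0
  with assms show ?thesis by (simp cong: continuous_on_cong)
next
  case (Suc q)
  with assms(1) obtain f' where f': "\<forall>x\<in>S. (f has_derivative f' x) (at x within S)"
    "\<forall>v. Ck_on q S (\<lambda>x. f' x v)" by auto
  have "(h has_derivative f' x) (at x within S)" if "x \<in> S" for x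
    by (rule has_derivative_transform[OF that _ f'(1)[rule_format, OF that]]) (simp add: assms(2))
  with f'(2) Suc show ?thesis by auto
qed

lemma Ck_on_SucD: "Ck_on (Suc r) S f \<Longrightarrow> Ck_on r S f"
proof (induction r arbitrary: f)
  case 0
  then show ?case
    by (auto simp: continuous_on_eq_continuous_within intro: has_derivative_continuous)
next
  case (Suc r)
  obtain f' where f': "\<forall>x\<in>S. (f has_derivative f' x) (at x within S)"
    "\<forall>v. Ck_on (Suc r) S (\<lambda>x. f' x v)"
    using Suc.prems unfolding Ck_on.simps(2)[of "Suc r"] by blast
  have "\<forall>v. Ck_on r S (\<lambda>x. f' x v)" by (intro allI Suc.IH f'(2)[rule_format])
  with f'(1) show ?case unfolding Ck_on.simps(2)[of r] by (intro exI[of _ f'] conjI)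
qed

lemma Ck_on_continuous_on: "Ck_on r S f \<Longrightarrow> continuous_on S f"
proof (induction r)
  case (Suc r)
  then show ?case using Ck_on_SucD by blast
qed simp

lemma Ck_on_subset: "Ck_on r S f \<Longrightarrow> T \<subseteq> S \<Longrightarrow> Ck_on r T f"
proof (induction r arbitrary: f)
  case 0
  then show ?case using continuous_on_subset by auto
next
  case (Suc r)
  then obtain f' where f': "\<forall>x\<in>S. (f has_derivative f' x) (at x within S)"
    "\<forall>v. Ck_on r S (\<lambda>x. f' x v)" by auto
  have "(f has_derivative f' x) (at x within T)" if "x \<in> T" for x
    using f'(1) Suc.prems(2) that by (metis has_derivative_subset subsetD)
  moreover have "\<forall>v. Ck_on r T (\<lambda>x. f' x v)"
    by (intro allI Suc.IH f'(2)[rule_format] Suc.prems(2))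
  ultimately show ?case unfolding Ck_on.simps(2)[of r] by blast
qed

lemma Ck_on_const [simp]: "Ck_on r S (\<lambda>x. c)"
proof (induction r arbitrary: c)
  case (Suc r)
  have "\<exists>f'. (\<forall>x\<in>S. ((\<lambda>x. c) has_derivative f' x) (at x within S)) \<and> (\<forall>v. Ck_on r S (\<lambda>x. f' x v))"
    by (rule exI[of _ "\<lambda>x v. 0"]) (auto simp: Suc)
  then show ?case by simp
qed simp

lemma Ck_on_add:
  "Ck_on r S f \<Longrightarrow> Ck_on r S h \<Longrightarrow> Ck_on r S (\<lambda>x. f x + h x)"
proof (induction r arbitrary: f h)
  case 0
  then show ?case by (simp add: continuous_on_add)
next
  case (Suc r)
  obtain f' where f': "\<forall>x\<in>S. (f has_derivative f' x) (at x within S)"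
    "\<forall>v. Ck_on r S (\<lambda>x. f' x v)" using Suc.prems(1) by auto
  obtain h' where h': "\<forall>x\<in>S. (h has_derivative h' x) (at x within S)"
    "\<forall>v. Ck_on r S (\<lambda>x. h' x v)" using Suc.prems(2) by auto
  have "\<exists>k'. (\<forall>x\<in>S. ((\<lambda>x. f x + h x) has_derivative k' x) (at x within S)) \<and>
      (\<forall>v. Ck_on r S (\<lambda>x. k' x v))"
    by (rule exI[of _ "\<lambda>x v. f' x v + h' x v"])
      (use f' h' Suc.IH in \<open>auto intro!: has_derivative_add\<close>)
  then show ?case by simp
qed

lemma Ck_on_sum: "(\<And>i. i \<in> I \<Longrightarrow> Ck_on r S (f i)) \<Longrightarrow> Ck_on r S (\<lambda>x. \<Sum>i\<in>I. f i x)"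
  by (induction I rule: infinite_finite_induct) (auto intro: Ck_on_add)

lemma Ck_on_bilinear:
  assumes "bounded_bilinear bop"
  shows "Ck_on r S f \<Longrightarrow> Ck_on r S h \<Longrightarrow> Ck_on r S (\<lambda>x. bop (f x) (h x))"
proof (induction r arbitrary: f h)
  case 0
  then show ?case by (simp add: bounded_bilinear.continuous_on[OF assms])
next
  case (Suc r)
  obtain f' where f': "\<forall>x\<in>S. (f has_derivative f' x) (at x within S)"
    "\<forall>v. Ck_on r S (\<lambda>x. f' x v)" using Suc.prems(1) by auto
  obtain h' where h': "\<forall>x\<in>S. (h has_derivative h' x) (at x within S)"
    "\<forall>v. Ck_on r S (\<lambda>x. h' x v)" using Suc.prems(2) by auto
  have "\<exists>k'. (\<forall>x\<in>S. ((\<lambda>x. bop (f x) (h x)) has_derivative k' x) (at x within S)) \<and>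
      (\<forall>v. Ck_on r S (\<lambda>x. k' x v))"
    by (rule exI[of _ "\<lambda>x v. bop (f x) (h' x v) + bop (f' x v) (h x)"])
      (use f' h' Suc.IH Suc.prems[THEN Ck_on_SucD] in
        \<open>auto intro!: bounded_bilinear.FDERIV[OF assms] Ck_on_add\<close>)
  then show ?case by simp
qed

lemma Ck_on_bounded_linear:
  assumes "bounded_linear l"
  shows "Ck_on r S f \<Longrightarrow> Ck_on r S (\<lambda>x. l (f x))"
proof (induction r arbitrary: f)
  case 0
  then show ?case
    using bounded_linear.continuous_on[OF assms] by simp
next
  case (Suc r)
  then obtain f' where f': "\<forall>x\<in>S. (f has_derivative f' x) (at x within S)"
    "\<forall>v. Ck_on r S (\<lambda>x. f' x v)" by auto
  have "\<exists>k'. (\<forall>x\<in>S. ((\<lambda>x. l (f x)) has_derivative k' x) (at x within S)) \<and>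
      (\<forall>v. Ck_on r S (\<lambda>x. k' x v))"
    by (rule exI[of _ "\<lambda>x v. l (f' x v)"])
      (use f' Suc.IH in \<open>auto intro!: bounded_linear.has_derivative[OF assms]\<close>)
  then show ?case by simp
qed

lemma Ck_on_id: "Ck_on r S (\<lambda>x. x)"
proof (cases r)
  case (Suc q)
  have "\<exists>k'. (\<forall>x\<in>S. ((\<lambda>x. x) has_derivative k' x) (at x within S)) \<and>
      (\<forall>v. Ck_on q S (\<lambda>x. k' x v))"
    by (rule exI[of _ "\<lambda>x v. v"]) (auto)
  then show ?thesis by (simp add: Suc)
qed simp

text \<open>\<open>Ck_on\<close> controls a derivative only in each fixed direction. Expanding a
  variable argument in the basis reduces every such expression to finitely many fixed directions;
  this is where finite dimension enters.\<close>

lemma linear_basis_sum: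
  fixes l :: "'a::euclidean_space \<Rightarrow> 'b::real_vector"
  assumes "linear l"
  shows "l v = (\<Sum>b\<in>Basis. (v \<bullet> b) *\<^sub>R l b)"
  by (metis (no_types, lifting) assms euclidean_representation linear_scale linear_sum sum.cong)

lemma Ck_on_compose:
  fixes F :: "'a::euclidean_space \<Rightarrow> 'b::real_normed_vector"
  assumes "Ck_on r T F" "Ck_on r S f" "f ` S \<subseteq> T"
  shows "Ck_on r S (\<lambda>x. F (f x))"
  using assms
proof (induction r arbitrary: F f)
  case 0
  then show ?case using continuous_on_compose2 by fastforce
next
  case (Suc r)
  obtain f' where f': "\<forall>x\<in>S. (f has_derivative f' x) (at x within S)"
    "\<forall>v. Ck_on r S (\<lambda>x. f' x v)" using Suc.prems by auto
  obtain F' where F': "\<forall>x\<in>T. (F has_derivative F' x) (at x within T)"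
    "\<forall>v. Ck_on r T (\<lambda>x. F' x v)" using Suc.prems by auto
  have lin: "linear (F' (f x))" if "x \<in> S" for x
    using F'(1) Suc.prems(3) that has_derivative_linear by blast
  have "\<exists>k'. (\<forall>x\<in>S. ((\<lambda>x. F (f x)) has_derivative k' x) (at x within S)) \<and>
      (\<forall>v. Ck_on r S (\<lambda>x. k' x v))"
  proof (intro exI[of _ "\<lambda>x v. F' (f x) (f' x v)"] conjI ballI allI)
    fix x assume "x \<in> S"
    \<comment> \<open>Since \<open>T\<close> may be the half-line, the derivative of
      \<open>F\<close> is taken within \<open>T\<close> and restricted to the image of
      \<open>S\<close>. Functions of the energy density are composed in this way.\<close>
    then have "(F has_derivative F' (f x)) (at (f x) within f ` S)"
      using F'(1) Suc.prems(3) has_derivative_subset[of F _ "f x" T "f ` S"] by blast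
    with f'(1) \<open>x \<in> S\<close>
    show "((\<lambda>x. F (f x)) has_derivative (\<lambda>v. F' (f x) (f' x v))) (at x within S)"
      by (intro has_derivative_in_compose[of f _ x S F]) auto
  next
    fix v
    have "Ck_on r S (\<lambda>x. \<Sum>b\<in>Basis. (f' x v \<bullet> b) *\<^sub>R F' (f x) b)"
      by (intro Ck_on_sum Ck_on_bilinear[OF bounded_bilinear_scaleR]
          Ck_on_bounded_linear[OF bounded_linear_inner_left] Suc.IH[OF F'(2)[rule_format]]
          f'(2)[rule_format] Ck_on_SucD[OF Suc.prems(2)] Suc.prems(3))
    then show "Ck_on r S (\<lambda>x. F' (f x) (f' x v))"
      by (rule Ck_on_cong) (simp add: linear_basis_sum[OF lin, symmetric])
  qed
  then show ?case by simp
qed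

section \<open>Linear systems with smoothly varying coefficients\<close>

lemma has_derivative_scaleR_zero:
  fixes F :: "'a::real_normed_vector \<Rightarrow> 'b::real_normed_vector" and c :: "'a \<Rightarrow> real"
  assumes F: "(F has_derivative F') (at x within S)" "F x = 0"
    and c: "(c \<longlongrightarrow> c x) (at x within S)"
  shows "((\<lambda>x. c x *\<^sub>R F x) has_derivative (\<lambda>h. c x *\<^sub>R F' h)) (at x within S)"
proof -
  have bl: "bounded_linear F'" using F(1) has_derivative_bounded_linear by blast
  obtain B where B: "\<And>h. norm (F' h) \<le> norm h * B"
    using bounded_linear.bounded[OF bl] by blast
  have lim: "((\<lambda>y. (F y - F x - F' (y - x)) /\<^sub>R norm (y - x)) \<longlongrightarrow> 0) (at x within S)"
    using F(1) by (simp add: has_derivative_within divide_inverse_commute algebra_simps)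
  have l2: "((\<lambda>y. c x *\<^sub>R ((F y - F x - F' (y - x)) /\<^sub>R norm (y - x))
      + (c y - c x) *\<^sub>R ((F y - F x - F' (y - x)) /\<^sub>R norm (y - x))) \<longlongrightarrow> c x *\<^sub>R 0 + (c x - c x) *\<^sub>R 0)
      (at x within S)"
    by (intro tendsto_intros lim c)
  \<comment> \<open>The increment of \<open>c\<close> times \<open>F y\<close> consists of the
    remainder of \<open>F\<close>, handled by \<open>l2\<close>, and of the linear part of
    \<open>F\<close>, which after division by the distance is bounded by \<open>B\<close>.\<close>
  have l3: "((\<lambda>y. (c y - c x) *\<^sub>R (F' (y - x) /\<^sub>R norm (y - x))) \<longlongrightarrow> 0) (at x within S)"
  proof (rule Lim_null_comparison[of _ "\<lambda>y. \<bar>c y - c x\<bar> * \<bar>B\<bar>"])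
    have "norm ((c y - c x) *\<^sub>R (F' (y - x) /\<^sub>R norm (y - x))) \<le> \<bar>c y - c x\<bar> * \<bar>B\<bar>" for y
    proof (cases "y = x")
      case False
      have "norm (F' (y - x)) / norm (y - x) \<le> \<bar>B\<bar>"
        using order_trans[OF B mult_left_mono[OF abs_ge_self[of B] norm_ge_zero]] False
        by (simp add: divide_le_eq mult.commute)
      then have "\<bar>c y - c x\<bar> * (norm (F' (y - x)) / norm (y - x)) \<le> \<bar>c y - c x\<bar> * \<bar>B\<bar>"
        by (intro mult_left_mono) auto
      then show ?thesis by (simp add: divide_inverse abs_mult mult_ac)
    qed simp
    then show "\<forall>\<^sub>F y in at x within S. norm ((c y - c x) *\<^sub>R (F' (y - x) /\<^sub>R norm (y - x)))
        \<le> \<bar>c y - c x\<bar> * \<bar>B\<bar>" by simp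
    have "((\<lambda>y. \<bar>c y - c x\<bar> * \<bar>B\<bar>) \<longlongrightarrow> \<bar>c x - c x\<bar> * \<bar>B\<bar>) (at x within S)"
      by (intro tendsto_intros c)
    then show "((\<lambda>y. \<bar>c y - c x\<bar> * \<bar>B\<bar>) \<longlongrightarrow> 0) (at x within S)" by simp
  qed
  have "((\<lambda>y. c x *\<^sub>R ((F y - F x - F' (y - x)) /\<^sub>R norm (y - x))
      + (c y - c x) *\<^sub>R ((F y - F x - F' (y - x)) /\<^sub>R norm (y - x))
      + (c y - c x) *\<^sub>R (F' (y - x) /\<^sub>R norm (y - x))) \<longlongrightarrow> 0) (at x within S)"
    using tendsto_add[OF l2 l3] by simp
  moreover have "bounded_linear (\<lambda>h. c x *\<^sub>R F' h)" using bl by (rule bounded_linear_const_scaleR)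
  ultimately show ?thesis
    by (simp add: has_derivative_within F(2) divide_inverse algebra_simps)
qed

text \<open>An injective linear map is bounded below by some \<open>m\<close>. The deviation of
  \<open>L x\<close> from \<open>L x0\<close> is at most \<open>e x\<close> in norm, and once
  \<open>e x\<close> is below \<open>m / 2\<close> its effect on the unknown is absorbed into the
  left-hand side. No inverse operator has to be estimated.\<close>

lemma continuous_linear_solve:
  fixes L :: "'x::real_normed_vector \<Rightarrow> 'e::euclidean_space \<Rightarrow> 'e"
  assumes lin: "\<And>x. x \<in> S \<Longrightarrow> linear (L x)" and inj: "\<And>x. x \<in> S \<Longrightarrow> inj (L x)"
    and L: "\<And>v. continuous_on S (\<lambda>x. L x v)" and w: "continuous_on S w"
    and y: "\<And>x. x \<in> S \<Longrightarrow> L x (y x) = w x"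
  shows "continuous_on S y"
  unfolding continuous_on_def
proof
  fix x0 assume x0: "x0 \<in> S"
  obtain m where m: "m > 0" "\<And>v. m * norm v \<le> norm (L x0 v)"
    using linear_inj_bounded_below_pos[OF lin[OF x0] inj[OF x0]] by blast
  define e where "e x = (\<Sum>b\<in>Basis. norm (L x b - L x0 b))" for x
  have "(e \<longlongrightarrow> (\<Sum>b\<in>(Basis::'e set). norm (L x0 b - L x0 b))) (at x0 within S)"
    unfolding e_def using L x0 by (intro tendsto_intros) (auto simp: continuous_on_def)
  then have e0: "(e \<longlongrightarrow> 0) (at x0 within S)" by simp
  have wl: "(w \<longlongrightarrow> w x0) (at x0 within S)" using w x0 by (auto simp: continuous_on_def)
  have e: "norm (L x v - L x0 v) \<le> e x * norm v" if "x \<in> S" for x v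
  proof -
    have "L x v - L x0 v = (\<Sum>b\<in>Basis. (v \<bullet> b) *\<^sub>R (L x b - L x0 b))"
      by (subst (1 2) euclidean_representation[of v, symmetric])
        (simp only: linear_sum[OF lin[OF that]] linear_sum[OF lin[OF x0]]
          linear_scale[OF lin[OF that]] linear_scale[OF lin[OF x0]]
          sum_subtractf[symmetric] scaleR_diff_right)
    also have "norm \<dots> \<le> (\<Sum>b\<in>Basis. norm v * norm (L x b - L x0 b))"
      by (intro sum_norm_le) (auto intro: mult_right_mono Basis_le_norm)
    also have "\<dots> = e x * norm v" by (simp add: e_def sum_distrib_left mult.commute)
    finally show ?thesis .
  qed
  have "\<forall>\<^sub>F x in at x0 within S. e x < m / 2"
    using order_tendstoD(2)[OF e0, of "m / 2"] m by auto
  then have ev: "\<forall>\<^sub>F x in at x0 within S.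
      norm (y x - y x0) \<le> 2 / m * (norm (w x - w x0) + e x * norm (y x0))"
    unfolding eventually_at_filter
  proof (rule eventually_mono, intro impI)
    fix x assume h: "x \<noteq> x0 \<longrightarrow> x \<in> S \<longrightarrow> e x < m / 2" "x \<noteq> x0" "x \<in> S"
    have "m * norm (y x - y x0) \<le> norm (L x0 (y x - y x0))" by (rule m)
    also have "L x0 (y x - y x0) = (w x - w x0) - (L x (y x) - L x0 (y x))"
      by (simp add: linear_diff[OF lin[OF x0]] y x0 h)
    also have "norm \<dots> \<le> norm (w x - w x0) + e x * norm (y x)"
      using e[OF h(3), of "y x"] norm_triangle_ineq4[of "w x - w x0" "L x (y x) - L x0 (y x)"]
      by linarith
    also have "\<dots> \<le> norm (w x - w x0) + e x * (norm (y x - y x0) + norm (y x0))"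
      by (intro add_left_mono mult_left_mono) (simp_all add: norm_triangle_sub add.commute e_def sum_nonneg)
    also have "\<dots> \<le> norm (w x - w x0) + m / 2 * norm (y x - y x0) + e x * norm (y x0)"
      using mult_right_mono[of "e x" "m / 2" "norm (y x - y x0)"] h by (simp add: algebra_simps)
    finally show "norm (y x - y x0) \<le> 2 / m * (norm (w x - w x0) + e x * norm (y x0))"
      using m(1) by (simp add: field_simps)
  qed
  have "((\<lambda>x. 2 / m * (norm (w x - w x0) + e x * norm (y x0))) \<longlongrightarrow>
      2 / m * (norm (w x0 - w x0) + 0 * norm (y x0))) (at x0 within S)"
    by (intro tendsto_intros wl e0)
  then have "((\<lambda>x. y x - y x0) \<longlongrightarrow> 0) (at x0 within S)"
    by (intro Lim_null_comparison[OF ev]) simp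
  then show "(y \<longlongrightarrow> y x0) (at x0 within S)" by (simp add: Lim_null[symmetric])
qed

text \<open>
  Differentiating \<open>L x (y x) = w x\<close> gives an equation \<open>L x (y' x v) = \<dots>\<close> of the same form, whose
  right-hand side involves \<open>y\<close> itself but no derivative of it.
\<close>

lemma Ck_on_linear_solve:
  fixes L :: "'x::real_normed_vector \<Rightarrow> 'e::euclidean_space \<Rightarrow> 'e"
  assumes lin: "\<And>x. x \<in> S \<Longrightarrow> linear (L x)" and inj: "\<And>x. x \<in> S \<Longrightarrow> inj (L x)"
    and L: "\<And>v. Ck_on r S (\<lambda>x. L x v)" and w: "Ck_on r S w"
    and y: "\<And>x. x \<in> S \<Longrightarrow> L x (y x) = w x"
  shows "Ck_on r S y"
  using L w y
proof (induction r arbitrary: w y)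
  case 0
  then show ?case using continuous_linear_solve[of S L w y] lin inj by simp
next
  case (Suc r)
  have Cy: "Ck_on r S y"
    using Suc.IH[of w y] Suc.prems Ck_on_SucD by blast
  have cy: "continuous_on S y"
    using Cy by (rule Ck_on_continuous_on)
  obtain w' where w': "\<forall>x\<in>S. (w has_derivative w' x) (at x within S)"
    "\<forall>v. Ck_on r S (\<lambda>x. w' x v)" using Suc.prems by auto
  have "\<forall>b. \<exists>L'. (\<forall>x\<in>S. ((\<lambda>x. L x b) has_derivative L' x) (at x within S)) \<and>
      (\<forall>v. Ck_on r S (\<lambda>x. L' x v))" using Suc.prems(1) by simp
  then obtain L' where L': "\<And>b x. x \<in> S \<Longrightarrow> ((\<lambda>x. L x b) has_derivative L' b x) (at x within S)"
    "\<And>b v. Ck_on r S (\<lambda>x. L' b x v)" by metis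
  define K where "K x = inv (L x)" for x
  have K: "linear (K x)" "\<And>v. L x (K x v) = v" "\<And>v. K x (L x v) = v" if "x \<in> S" for x
  proof -
    have s: "surj (L x)" using lin inj that by (simp add: linear_injective_imp_surjective)
    show "\<And>v. L x (K x v) = v" using s by (simp add: K_def surj_f_inv_f)
    show "\<And>v. K x (L x v) = v" using inj that by (simp add: K_def)
    show "linear (K x)" unfolding K_def
      using inj_linear_imp_inv_linear[OF lin inj] that by blast
  qed
  define R where "R x v = w' x v - (\<Sum>b\<in>Basis. (y x \<bullet> b) *\<^sub>R L' b x v)" for x v
  have der: "(y has_derivative (\<lambda>v. K x (R x v))) (at x within S)" if x: "x \<in> S" for x
  proof -
    \<comment> \<open>The operator is frozen at \<open>x\<close>: moving
      \<open>L z (y z) - L x (y z)\<close> to the right-hand side leaves products whose vector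
      factor vanishes at \<open>z = x\<close>, so that \<open>has_derivative_scaleR_zero\<close>
      applies and asks only continuity of \<open>y\<close>.\<close>
    have eq: "K x (w z - (\<Sum>b\<in>Basis. (y z \<bullet> b) *\<^sub>R (L z b - L x b))) = y z" if z: "z \<in> S" for z
    proof -
      have "(\<Sum>b\<in>Basis. (y z \<bullet> b) *\<^sub>R (L z b - L x b)) = L z (y z) - L x (y z)"
        by (simp only: linear_basis_sum[OF lin[OF z], of "y z"] linear_basis_sum[OF lin[OF x], of "y z"]
            sum_subtractf scaleR_diff_right)
      then show ?thesis using K[OF x] Suc.prems(3)[OF z] by simp
    qed
    have "((\<lambda>z. K x (w z - (\<Sum>b\<in>Basis. (y z \<bullet> b) *\<^sub>R (L z b - L x b)))) has_derivative
        (\<lambda>v. K x (w' x v - (\<Sum>b\<in>Basis. (y x \<bullet> b) *\<^sub>R (L' b x v - 0))))) (at x within S)"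
      using w'(1) x L'(1)[OF x] cy
      by (intro bounded_linear.has_derivative[OF linear_linear[THEN iffD2, OF K(1)[OF x]]]
          has_derivative_diff has_derivative_sum has_derivative_scaleR_zero has_derivative_const)
        (auto simp: continuous_on_def intro!: tendsto_intros)
    then show ?thesis
      by (intro has_derivative_transform[OF x _, where g = y
          and f = "\<lambda>z. K x (w z - (\<Sum>b\<in>Basis. (y z \<bullet> b) *\<^sub>R (L z b - L x b)))"])
        (simp_all add: eq R_def)
  qed
  have "Ck_on r S (\<lambda>x. K x (R x v))" for v
  proof (rule Suc.IH[of "\<lambda>x. R x v"])
    show "Ck_on r S (\<lambda>x. R x v)"
      using Ck_on_add[OF w'(2)[rule_format, of v] Ck_on_bounded_linear[OF
          bounded_linear_minus[OF bounded_linear_ident] Ck_on_sum[of Basis]], of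
          "\<lambda>b x. (y x \<bullet> b) *\<^sub>R L' b x v"]
      by (simp add: R_def Ck_on_bilinear[OF bounded_bilinear_scaleR]
          Ck_on_bounded_linear[OF bounded_linear_inner_left] Cy L'(2))
  qed (use Ck_on_SucD[OF Suc.prems(1)] K in auto)
  with der show ?case
    unfolding Ck_on.simps(2) by (intro exI[of _ "\<lambda>x v. K x (R x v)"] conjI ballI allI)
qed

section \<open>Closure properties of smooth maps\<close>

lemma smooth_on_cong: "smooth_on S f \<Longrightarrow> (\<And>x. x \<in> S \<Longrightarrow> f x = h x) \<Longrightarrow> smooth_on S h"
  unfolding smooth_on_def using Ck_on_cong by blast

lemma smooth_on_subset: "smooth_on S f \<Longrightarrow> T \<subseteq> S \<Longrightarrow> smooth_on T f"
  unfolding smooth_on_def using Ck_on_subset by blast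

lemma smooth_on_const : "smooth_on S (\<lambda>x. c)"
  unfolding smooth_on_def by simp

lemma smooth_on_id : "smooth_on S (\<lambda>x. x)"
  unfolding smooth_on_def using Ck_on_id by blast

lemma smooth_on_add :
  "smooth_on S f \<Longrightarrow> smooth_on S h \<Longrightarrow> smooth_on S (\<lambda>x. f x + h x)"
  unfolding smooth_on_def using Ck_on_add by blast

lemma smooth_on_sum :
  "(\<And>i. i \<in> I \<Longrightarrow> smooth_on S (f i)) \<Longrightarrow> smooth_on S (\<lambda>x. \<Sum>i\<in>I. f i x)"
  unfolding smooth_on_def by (intro allI Ck_on_sum) blast

lemma smooth_on_bilinear:
  "bounded_bilinear bop \<Longrightarrow> smooth_on S f \<Longrightarrow> smooth_on S h \<Longrightarrow> smooth_on S (\<lambda>x. bop (f x) (h x))"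
  unfolding smooth_on_def using Ck_on_bilinear by blast

lemma smooth_on_linear:
  fixes l :: "'a::euclidean_space \<Rightarrow> 'b::real_normed_vector"
  shows "linear l \<Longrightarrow> smooth_on S f \<Longrightarrow> smooth_on S (\<lambda>x. l (f x))"
  unfolding smooth_on_def using Ck_on_bounded_linear linear_conv_bounded_linear by blast

lemmas smooth_on_scaleR  = smooth_on_bilinear[OF bounded_bilinear_scaleR]
lemmas smooth_on_inner  = smooth_on_bilinear[OF bounded_bilinear_inner]

lemma smooth_on_mult :
  fixes f h :: "_ \<Rightarrow> real"
  shows "smooth_on S f \<Longrightarrow> smooth_on S h \<Longrightarrow> smooth_on S (\<lambda>x. f x * h x)"
  by (rule smooth_on_bilinear[OF bounded_bilinear_mult])

lemma smooth_on_minus : "smooth_on S f \<Longrightarrow> smooth_on S (\<lambda>x. - f x)"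
  unfolding smooth_on_def
  using Ck_on_bounded_linear[OF bounded_linear_minus[OF bounded_linear_ident]] by blast

lemma smooth_on_diff :
  "smooth_on S f \<Longrightarrow> smooth_on S h \<Longrightarrow> smooth_on S (\<lambda>x. f x - h x)"
  using smooth_on_add[of S f "\<lambda>x. - h x"] smooth_on_minus[of S h] by simp

lemma smooth_on_fst : "smooth_on S f \<Longrightarrow> smooth_on S (\<lambda>x. fst (f x))"
  unfolding smooth_on_def using Ck_on_bounded_linear[OF bounded_linear_fst] by blast

lemma smooth_on_snd : "smooth_on S f \<Longrightarrow> smooth_on S (\<lambda>x. snd (f x))"
  unfolding smooth_on_def using Ck_on_bounded_linear[OF bounded_linear_snd] by blast

lemma smooth_on_Pair :
  assumes "smooth_on S f" "smooth_on S h"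
  shows "smooth_on S (\<lambda>x. (f x, h x))"
proof -
  have "bounded_linear (\<lambda>x::'b. (x, 0::'c))" "bounded_linear (\<lambda>x::'c. (0::'b, x))"
    by (simp_all add: bounded_linear_Pair bounded_linear_zero bounded_linear_ident)
  then have "smooth_on S (\<lambda>x. (f x, 0::'c))" "smooth_on S (\<lambda>x. (0::'b, h x))"
    using assms unfolding smooth_on_def
    by (auto intro: Ck_on_bounded_linear[of "\<lambda>x::'b. (x, 0::'c)" _ S f]
        Ck_on_bounded_linear[of "\<lambda>x::'c. (0::'b, x)" _ S h])
  then have "smooth_on S (\<lambda>x. (f x, 0) + (0, h x))" by (rule smooth_on_add)
  then show ?thesis by simp
qed

lemma smooth_on_compose:
  fixes F :: "'a::euclidean_space \<Rightarrow> 'b::real_normed_vector"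
  shows "smooth_on T F \<Longrightarrow> smooth_on S f \<Longrightarrow> f ` S \<subseteq> T \<Longrightarrow> smooth_on S (\<lambda>x. F (f x))"
  unfolding smooth_on_def using Ck_on_compose by blast

lemma smooth_on_linear_solve:
  fixes L :: "'x::real_normed_vector \<Rightarrow> 'e::euclidean_space \<Rightarrow> 'e"
  assumes "\<And>x. x \<in> S \<Longrightarrow> linear (L x)" "\<And>x. x \<in> S \<Longrightarrow> inj (L x)"
    and "\<And>v. smooth_on S (\<lambda>x. L x v)" "smooth_on S w"
    and "\<And>x. x \<in> S \<Longrightarrow> L x (y x) = w x"
  shows "smooth_on S y"
  using assms Ck_on_linear_solve[of S L _ w y] unfolding smooth_on_def by blast

lemma smooth_on_inverse :
  fixes f :: "'a::real_normed_vector \<Rightarrow> real"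
  assumes "smooth_on S f" "\<And>x. x \<in> S \<Longrightarrow> f x \<noteq> 0"
  shows "smooth_on S (\<lambda>x. inverse (f x))"
  by (rule smooth_on_linear_solve[of S "\<lambda>x v. f x * v" "\<lambda>x. 1"])
    (use assms in \<open>auto simp: inj_on_def intro!: linearI smooth_on_mult smooth_on_const simp: algebra_simps\<close>)

lemma smooth_on_divide :
  fixes f h :: "'a::real_normed_vector \<Rightarrow> real"
  shows "smooth_on S f \<Longrightarrow> smooth_on S h \<Longrightarrow> (\<And>x. x \<in> S \<Longrightarrow> h x \<noteq> 0) \<Longrightarrow>
    smooth_on S (\<lambda>x. f x / h x)"
  unfolding divide_inverse by (intro smooth_on_mult smooth_on_inverse)

lemma smooth_on_power :
  fixes f :: "'a::real_normed_vector \<Rightarrow> real"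
  shows "smooth_on S f \<Longrightarrow> smooth_on S (\<lambda>x. f x ^ m)"
  by (induction m) (simp_all add: smooth_on_const smooth_on_mult)

text \<open>Bootstrapping: the derivative of sqrt f is f' / (2 sqrt f), and 1 / sqrt f inherits the
  regularity already known for sqrt f because it solves a linear equation with that
  coefficient.\<close>

lemma smooth_on_sqrt :
  fixes f :: "'a::real_normed_vector \<Rightarrow> real"
  assumes f: "smooth_on S f" "\<And>x. x \<in> S \<Longrightarrow> f x > 0"
  shows "smooth_on S (\<lambda>x. sqrt (f x))"
proof -
  have "Ck_on r S (\<lambda>x. sqrt (f x))" for r
  proof (induction r)
    case 0
    have "Ck_on 0 S f" using f(1) unfolding smooth_on_def by blast
    then show ?case by (simp add: continuous_on_real_sqrt)
  next
    case (Suc r)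
    obtain f' where f': "\<forall>x\<in>S. (f has_derivative f' x) (at x within S)"
      "\<forall>v. Ck_on r S (\<lambda>x. f' x v)"
      using f(1) unfolding smooth_on_def by (metis Ck_on.simps(2))
    have inv: "Ck_on r S (\<lambda>x. inverse (sqrt (f x)))"
      by (rule Ck_on_linear_solve[of S "\<lambda>x v. sqrt (f x) * v" r "\<lambda>x. 1"])
        (use f(2) Suc in \<open>force simp: inj_on_def intro!: linearI
          Ck_on_bilinear[OF bounded_bilinear_mult] simp: algebra_simps\<close>)+
    have "\<exists>k'. (\<forall>x\<in>S. ((\<lambda>x. sqrt (f x)) has_derivative k' x) (at x within S)) \<and>
        (\<forall>v. Ck_on r S (\<lambda>x. k' x v))"
    proof (intro exI[of _ "\<lambda>x v. f' x v * (inverse (sqrt (f x)) * (1/2))"] conjI ballI allI)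
      fix x assume "x \<in> S"
      then show "((\<lambda>x. sqrt (f x)) has_derivative (\<lambda>v. f' x v * (inverse (sqrt (f x)) * (1/2))))
          (at x within S)"
        using has_derivative_real_sqrt[OF f(2) f'(1)[rule_format], of x] by simp
    next
      show "Ck_on r S (\<lambda>x. f' x v * (inverse (sqrt (f x)) * (1/2)))" for v
        by (intro Ck_on_bilinear[OF bounded_bilinear_mult] inv f'(2)[rule_format] Ck_on_const)
    qed
    then show ?case by simp
  qed
  then show ?thesis by (simp add: smooth_on_def)
qed

section \<open>Derivatives on open sets\<close>

abbreviation fd :: "('a::real_normed_vector \<Rightarrow> 'b::real_normed_vector) \<Rightarrow> 'a \<Rightarrow> 'a \<Rightarrow> 'b" where
  "fd f x \<equiv> frechet_derivative f (at x)"

lemmas smooth_intros = smooth_on_const smooth_on_id smooth_on_add smooth_on_diff smooth_on_minus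
  smooth_on_sum smooth_on_scaleR smooth_on_inner smooth_on_mult smooth_on_fst smooth_on_snd
  smooth_on_Pair smooth_on_divide smooth_on_inverse smooth_on_power

lemma smooth_on_continuous_on: "smooth_on S f \<Longrightarrow> continuous_on S f"
  unfolding smooth_on_def by (metis Ck_on.simps(1))

lemma smooth_on_has_fd:
  assumes "smooth_on S f" "open S" "x \<in> S"
  shows "(f has_derivative fd f x) (at x)"
proof -
  obtain f' where "(f has_derivative f' x) (at x within S)"
    using assms unfolding smooth_on_def by (metis Ck_on.simps(2))
  then have "(f has_derivative f' x) (at x)" using assms at_within_open by metis
  then show ?thesis using frechet_derivative_at by metis
qed

lemma fd_eq: "(f has_derivative f') (at x) \<Longrightarrow> fd f x = f'"
  using frechet_derivative_at by metis

lemma smooth_on_fd :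
  assumes "smooth_on S f" "open S"
  shows "smooth_on S (\<lambda>x. fd f x v)"
  unfolding smooth_on_def
proof
  fix r
  obtain f' where f': "\<forall>x\<in>S. (f has_derivative f' x) (at x within S)" "\<forall>v. Ck_on r S (\<lambda>x. f' x v)"
    using assms unfolding smooth_on_def by (metis Ck_on.simps(2))
  have "f' x = fd f x" if "x \<in> S" for x
    using f'(1) that fd_eq at_within_open[OF that assms(2)] by metis
  then show "Ck_on r S (\<lambda>x. fd f x v)" using Ck_on_cong[OF f'(2)[rule_format, of v]] by simp
qed

lemma linear_fd: "smooth_on S f \<Longrightarrow> open S \<Longrightarrow> x \<in> S \<Longrightarrow> linear (fd f x)"
  using smooth_on_has_fd has_derivative_linear by blast

lemma fd_cong:
  assumes "open S" "x \<in> S" "\<And>z. z \<in> S \<Longrightarrow> f z = h z"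
  shows "fd f x = fd h x"
proof -
  have "(f has_derivative f') (at x) \<longleftrightarrow> (h has_derivative f') (at x)" for f'
    using has_derivative_transform_within_open[OF _ assms(1,2)] assms(3) by metis
  then show ?thesis by (simp add: frechet_derivative_def)
qed

lemma fd_const [simp]: "fd (\<lambda>x. c) x v = 0"
  by (subst fd_eq[of _ "\<lambda>_. 0"]) auto

lemma fd_id [simp]: "fd (\<lambda>x. x) x v = v"
  by (subst fd_eq[of _ "\<lambda>v. v"]) auto

lemma fd_add:
  assumes "open S" "x \<in> S" "smooth_on S f" "smooth_on S h"
  shows "fd (\<lambda>x. f x + h x) x v = fd f x v + fd h x v"
proof -
  have "((\<lambda>x. f x + h x) has_derivative (\<lambda>v. fd f x v + fd h x v)) (at x)"
    by (intro has_derivative_add smooth_on_has_fd[of S] assms)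
  then show ?thesis by (simp add: fd_eq)
qed

lemma fd_diff:
  assumes "open S" "x \<in> S" "smooth_on S f" "smooth_on S h"
  shows "fd (\<lambda>x. f x - h x) x v = fd f x v - fd h x v"
proof -
  have "((\<lambda>x. f x - h x) has_derivative (\<lambda>v. fd f x v - fd h x v)) (at x)"
    by (intro has_derivative_diff smooth_on_has_fd[of S] assms)
  then show ?thesis by (simp add: fd_eq)
qed

lemma fd_bilinear:
  assumes "bounded_bilinear bop" "open S" "x \<in> S" "smooth_on S f" "smooth_on S h"
  shows "fd (\<lambda>x. bop (f x) (h x)) x v = bop (f x) (fd h x v) + bop (fd f x v) (h x)"
proof -
  have "((\<lambda>x. bop (f x) (h x)) has_derivative (\<lambda>v. bop (f x) (fd h x v) + bop (fd f x v) (h x))) (at x)"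
    by (intro bounded_bilinear.FDERIV[OF assms(1)] smooth_on_has_fd[of S] assms)
  then show ?thesis by (simp add: fd_eq)
qed

lemmas fd_scaleR = fd_bilinear[OF bounded_bilinear_scaleR]
lemmas fd_inner = fd_bilinear[OF bounded_bilinear_inner]

lemma fd_mult:
  fixes f h :: "_ \<Rightarrow> real"
  assumes "open S" "x \<in> S" "smooth_on S f" "smooth_on S h"
  shows "fd (\<lambda>x. f x * h x) x v = f x * fd h x v + fd f x v * h x"
  using fd_bilinear[OF bounded_bilinear_mult] assms by blast

lemma fd_linear:
  fixes l :: "'a::euclidean_space \<Rightarrow> 'b::real_normed_vector"
  assumes "linear l" "open S" "x \<in> S" "smooth_on S f"
  shows "fd (\<lambda>x. l (f x)) x v = l (fd f x v)"
proof -
  have "((\<lambda>x. l (f x)) has_derivative (\<lambda>v. l (fd f x v))) (at x)"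
    by (intro bounded_linear.has_derivative[OF assms(1)[unfolded linear_conv_bounded_linear]] smooth_on_has_fd[of S] assms)
  then show ?thesis by (simp add: fd_eq)
qed

lemma fd_sum:
  assumes "open S" "x \<in> S" "\<And>i. i \<in> I \<Longrightarrow> smooth_on S (f i)"
  shows "fd (\<lambda>x. \<Sum>i\<in>I. f i x) x v = (\<Sum>i\<in>I. fd (f i) x v)"
proof -
  have "((\<lambda>x. \<Sum>i\<in>I. f i x) has_derivative (\<lambda>v. \<Sum>i\<in>I. fd (f i) x v)) (at x)"
    by (intro has_derivative_sum smooth_on_has_fd[of S] assms)
  then show ?thesis by (simp add: fd_eq)
qed

lemma fd_compose:
  assumes "open S" "x \<in> S" "smooth_on S f" "open T" "f x \<in> T" "smooth_on T F"
  shows "fd (\<lambda>x. F (f x)) x v = fd F (f x) (fd f x v)"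
proof -
  have "((\<lambda>x. F (f x)) has_derivative (\<lambda>v. fd F (f x) (fd f x v))) (at x)"
    by (rule has_derivative_compose[OF smooth_on_has_fd[OF assms(3,1,2)] smooth_on_has_fd[OF assms(6,4,5)]])
  then show ?thesis by (simp add: fd_eq)
qed

lemma smooth_on_linear_family:
  fixes L :: "'x::real_normed_vector \<Rightarrow> 'e::euclidean_space \<Rightarrow> 'f::real_normed_vector"
  assumes "\<And>x. x \<in> S \<Longrightarrow> linear (L x)" "\<And>b. smooth_on S (\<lambda>x. L x b)" "smooth_on S v"
  shows "smooth_on S (\<lambda>x. L x (v x))"
proof -
  have "smooth_on S (\<lambda>x. \<Sum>b\<in>Basis. (v x \<bullet> b) *\<^sub>R L x b)"
    by (intro smooth_intros assms)
  then show ?thesis by (rule smooth_on_cong) (metis assms(1) linear_basis_sum)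
qed

text \<open>The Leibniz rule for applying a varying linear map to a varying vector. The derivative
  of the map is expressed by freezing the vector, so that families of linear maps can remain curried
  functions instead of points of a normed space of operators.\<close>

lemma fd_linear_family:
  fixes L :: "'x::real_normed_vector \<Rightarrow> 'e::euclidean_space \<Rightarrow> 'f::real_normed_vector"
  assumes S: "open S" "x \<in> S"
    and L: "\<And>x. x \<in> S \<Longrightarrow> linear (L x)" "\<And>b. smooth_on S (\<lambda>x. L x b)" and v: "smooth_on S v"
  shows "fd (\<lambda>x. L x (v x)) x X = fd (\<lambda>z. L z (v x)) x X + L x (fd v x X)"
proof -
  have e: "fd (\<lambda>x. L x (v x)) x X =
      (\<Sum>b\<in>Basis. (v x \<bullet> b) *\<^sub>R fd (\<lambda>x. L x b) x X + (fd v x X \<bullet> b) *\<^sub>R L x b)"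
    if v: "smooth_on S v" for v
  proof -
    have "fd (\<lambda>x. L x (v x)) x X = fd (\<lambda>x. \<Sum>b\<in>Basis. (v x \<bullet> b) *\<^sub>R L x b) x X"
      by (intro fd_cong[OF S, THEN fun_cong] linear_basis_sum L(1))
    also have "\<dots> = (\<Sum>b\<in>Basis. fd (\<lambda>x. (v x \<bullet> b) *\<^sub>R L x b) x X)"
      by (intro fd_sum[OF S] smooth_intros L v)
    also have "\<dots> = (\<Sum>b\<in>Basis. (v x \<bullet> b) *\<^sub>R fd (\<lambda>x. L x b) x X + (fd v x X \<bullet> b) *\<^sub>R L x b)"
    proof (rule sum.cong[OF refl])
      fix b :: 'e
      have "smooth_on S (\<lambda>x. v x \<bullet> b)" by (intro smooth_intros v)
      moreover have "fd (\<lambda>x. v x \<bullet> b) x X = fd v x X \<bullet> b"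
        using fd_inner[OF S v smooth_on_const] by simp
      ultimately show "fd (\<lambda>x. (v x \<bullet> b) *\<^sub>R L x b) x X =
          (v x \<bullet> b) *\<^sub>R fd (\<lambda>x. L x b) x X + (fd v x X \<bullet> b) *\<^sub>R L x b"
        using fd_scaleR[OF S _ L(2)] by simp
    qed
    finally show ?thesis .
  qed
  have "fd (\<lambda>z. L z (v x)) x X = (\<Sum>b\<in>Basis. (v x \<bullet> b) *\<^sub>R fd (\<lambda>x. L x b) x X)"
    using e[OF smooth_on_const, of "v x"] by simp
  with e[OF v] show ?thesis
    by (simp only: linear_basis_sum[OF L(1)[OF S(2)], of "fd v x X"] sum.distrib)
qed

section \<open>Symmetry of second derivatives\<close>

lemma second_difference:
  fixes f :: "'a::real_normed_vector \<Rightarrow> real"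
  assumes f: "smooth_on S f" and S: "open S" and t: "t > 0"
    and B: "\<And>a b. \<lbrakk>0 \<le> a; a \<le> t; 0 \<le> b; b \<le> t\<rbrakk> \<Longrightarrow> x + a *\<^sub>R u + b *\<^sub>R v \<in> S"
  shows "\<exists>a b. 0 \<le> a \<and> a \<le> t \<and> 0 \<le> b \<and> b \<le> t \<and>
    f (x + t *\<^sub>R u + t *\<^sub>R v) - f (x + t *\<^sub>R u) - f (x + t *\<^sub>R v) + f x =
    t * t * fd (\<lambda>z. fd f z u) (x + a *\<^sub>R u + b *\<^sub>R v) v"
proof -
  \<comment> \<open>The increment in direction \<open>v\<close> as a function of the displacement
    along \<open>u\<close>. The mean value theorem is applied to it, and then once more in direction
    \<open>v\<close> to the derivative along \<open>u\<close>.\<close>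
  define h where "h a = f (x + a *\<^sub>R u + t *\<^sub>R v) - f (x + a *\<^sub>R u)" for a
  have line: "((\<lambda>a. k (p + a *\<^sub>R w)) has_real_derivative fd k (p + a *\<^sub>R w) w) (at a)"
    if k: "smooth_on S k" and "p + a *\<^sub>R w \<in> S" for p w a and k :: "'a \<Rightarrow> real"
  proof -
    have l: "linear (fd k (p + a *\<^sub>R w))" using linear_fd[OF k S] that by blast
    have "((\<lambda>a. k (p + a *\<^sub>R w)) has_derivative (\<lambda>s. fd k (p + a *\<^sub>R w) (s *\<^sub>R w))) (at a)"
      by (rule has_derivative_compose[of "\<lambda>a. p + a *\<^sub>R w" "\<lambda>s. s *\<^sub>R w"])
        (use smooth_on_has_fd[OF k S] that in \<open>auto intro!: derivative_eq_intros\<close>)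
    then show ?thesis
      unfolding has_field_derivative_def
      by (simp add: linear_scale[OF l] mult.commute[of _ "fd k (p + a *\<^sub>R w) w"])
  qed
  have "\<exists>a>0. a < t \<and> h t - h 0 = (t - 0) * (fd f (x + t *\<^sub>R v + a *\<^sub>R u) u - fd f (x + a *\<^sub>R u) u)"
  proof (rule MVT2[OF t])
    fix a assume a: "0 \<le> a" "a \<le> t"
    have "x + t *\<^sub>R v + a *\<^sub>R u \<in> S" "x + a *\<^sub>R u \<in> S"
      using B[of a t] B[of a 0] a t by (auto simp: algebra_simps)
    from DERIV_diff[OF line[OF f this(1)] line[OF f this(2)]]
    show "DERIV h a :> (fd f (x + t *\<^sub>R v + a *\<^sub>R u) u - fd f (x + a *\<^sub>R u) u)"
      unfolding h_def by (simp add: algebra_simps)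
  qed
  then obtain a where a: "a > 0" "a < t"
    "h t - h 0 = t * (fd f (x + t *\<^sub>R v + a *\<^sub>R u) u - fd f (x + a *\<^sub>R u) u)" by auto
  define k where "k b = fd f (x + a *\<^sub>R u + b *\<^sub>R v) u" for b
  have "\<exists>b>0. b < t \<and> k t - k 0 = (t - 0) * fd (\<lambda>z. fd f z u) (x + a *\<^sub>R u + b *\<^sub>R v) v"
  proof (rule MVT2[OF t])
    fix b assume b: "0 \<le> b" "b \<le> t"
    have "x + a *\<^sub>R u + b *\<^sub>R v \<in> S" using B[of a b] a b by auto
    from line[OF smooth_on_fd[OF f S] this]
    show "DERIV k b :> fd (\<lambda>z. fd f z u) (x + a *\<^sub>R u + b *\<^sub>R v) v" unfolding k_def by simp
  qed
  then obtain b where "b > 0" "b < t" "k t - k 0 = t * fd (\<lambda>z. fd f z u) (x + a *\<^sub>R u + b *\<^sub>R v) v"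
    by auto
  with a show ?thesis
    by (intro exI[of _ a] exI[of _ b]) (auto simp: h_def k_def algebra_simps)
qed

text \<open>The second difference over a parallelogram is symmetric in \<open>u\<close> and
  \<open>v\<close>, hence on arbitrarily small parallelograms the two mixed derivatives take a
  common value, at possibly different points. Continuity then excludes different values at
  \<open>x\<close>.\<close>

lemma second_derivative_symmetric_real:
  fixes f :: "'a::real_normed_vector \<Rightarrow> real"
  assumes f: "smooth_on S f" and S: "open S" "x \<in> S"
  shows "fd (\<lambda>z. fd f z u) x v = fd (\<lambda>z. fd f z v) x u"
proof (rule ccontr)
  define P where "P z = fd (\<lambda>z. fd f z u) z v" for z
  define Q where "Q z = fd (\<lambda>z. fd f z v) z u" for z
  assume "\<not> ?thesis"
  then have e: "\<bar>P x - Q x\<bar> / 2 > 0" by (simp add: P_def Q_def)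
  have "continuous_on S P" "continuous_on S Q"
    unfolding P_def Q_def by (intro smooth_on_continuous_on smooth_on_fd f S(1))+
  then have "isCont P x" "isCont Q x" using S continuous_on_eq_continuous_at by blast+
  then have "\<forall>\<^sub>F z in nhds x. \<bar>P z - P x\<bar> < \<bar>P x - Q x\<bar> / 2" "\<forall>\<^sub>F z in nhds x. \<bar>Q z - Q x\<bar> < \<bar>P x - Q x\<bar> / 2"
    using tendstoD[OF _ e, of P "P x" "nhds x"] tendstoD[OF _ e, of Q "Q x" "nhds x"]
    by (simp_all only: isCont_def tendsto_at_iff_tendsto_nhds dist_real_def)
  moreover have "\<forall>\<^sub>F z in nhds x. z \<in> S" using S by (simp add: eventually_nhds_in_open)
  ultimately have "\<forall>\<^sub>F z in nhds x. z \<in> S \<and> \<bar>P z - P x\<bar> < \<bar>P x - Q x\<bar> / 2 \<and> \<bar>Q z - Q x\<bar> < \<bar>P x - Q x\<bar> / 2"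
    by eventually_elim auto
  then obtain d where d: "d > 0"
    "\<And>z. dist z x < d \<Longrightarrow> z \<in> S \<and> \<bar>P z - P x\<bar> < \<bar>P x - Q x\<bar> / 2 \<and> \<bar>Q z - Q x\<bar> < \<bar>P x - Q x\<bar> / 2"
    by (auto simp: eventually_nhds_metric)
  \<comment> \<open>The factor 1/2 in \<open>t\<close> keeps the closed parallelogram strictly
    inside the ball of radius \<open>d\<close>; the summand 1 in \<open>N\<close> avoids dividing by
    0 when \<open>u\<close> and \<open>v\<close> vanish.\<close>
  define N where "N = norm u + norm v + 1"
  define t where "t = d / N / 2"
  have n: "N > 0" unfolding N_def by (smt (verit) norm_ge_zero)
  have t: "t > 0" using d n by (simp add: t_def)
  have near: "dist (x + a *\<^sub>R u + b *\<^sub>R v) x < d" if "0 \<le> a" "a \<le> t" "0 \<le> b" "b \<le> t" for a b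
  proof -
    have "dist (x + a *\<^sub>R u + b *\<^sub>R v) x \<le> a * norm u + b * norm v"
      using norm_triangle_ineq[of "a *\<^sub>R u" "b *\<^sub>R v"] that by (simp add: dist_norm algebra_simps)
    also have "\<dots> \<le> t * norm u + t * norm v"
      using that by (intro add_mono mult_right_mono) auto
    also have "\<dots> \<le> t * N" using t by (simp add: N_def algebra_simps)
    also have "\<dots> = d / 2" using n by (simp add: t_def)
    finally show ?thesis using d(1) by simp
  qed
  obtain a b where ab: "0 \<le> a" "a \<le> t" "0 \<le> b" "b \<le> t"
    "f (x + t *\<^sub>R u + t *\<^sub>R v) - f (x + t *\<^sub>R u) - f (x + t *\<^sub>R v) + f x = t * t * P (x + a *\<^sub>R u + b *\<^sub>R v)"
    using second_difference[OF f S(1) t, of x u v] near d(2) unfolding P_def by blast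
  have sw: "x + p *\<^sub>R v + q *\<^sub>R u = x + q *\<^sub>R u + p *\<^sub>R v" for p q by simp
  have "x + p *\<^sub>R v + q *\<^sub>R u \<in> S" if "0 \<le> p" "p \<le> t" "0 \<le> q" "q \<le> t" for p q
    unfolding sw using near[of q p] that d(2) by blast
  from second_difference[OF f S(1) t this] obtain a' b' where ab': "0 \<le> a'" "a' \<le> t" "0 \<le> b'" "b' \<le> t"
    "f (x + t *\<^sub>R v + t *\<^sub>R u) - f (x + t *\<^sub>R v) - f (x + t *\<^sub>R u) + f x = t * t * Q (x + b' *\<^sub>R u + a' *\<^sub>R v)"
    unfolding Q_def sw by blast
  have "t * t * P (x + a *\<^sub>R u + b *\<^sub>R v) = t * t * Q (x + b' *\<^sub>R u + a' *\<^sub>R v)"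
    using ab(5) ab'(5) by (simp add: algebra_simps)
  then have "P (x + a *\<^sub>R u + b *\<^sub>R v) = Q (x + b' *\<^sub>R u + a' *\<^sub>R v)" using t by simp
  moreover have "\<bar>P (x + a *\<^sub>R u + b *\<^sub>R v) - P x\<bar> < \<bar>P x - Q x\<bar> / 2"
    using d(2) near ab by blast
  moreover have "\<bar>Q (x + b' *\<^sub>R u + a' *\<^sub>R v) - Q x\<bar> < \<bar>P x - Q x\<bar> / 2"
    using d(2) near ab' by blast
  ultimately show False by (smt (verit) field_sum_of_halves)
qed

lemma second_derivative_symmetric:
  fixes f :: "'a::real_normed_vector \<Rightarrow> 'b::euclidean_space"
  assumes f: "smooth_on S f" and S: "open S" "x \<in> S"
  shows "fd (\<lambda>z. fd f z u) x v = fd (\<lambda>z. fd f z v) x u"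
proof (rule euclidean_eqI)
  fix b :: 'b
  assume "b \<in> Basis"
  have e: "fd (\<lambda>z. fd (\<lambda>x. f x \<bullet> b) z u) x v = fd (\<lambda>z. fd f z u) x v \<bullet> b" for u v
  proof -
    have l: "linear (\<lambda>x. x \<bullet> b)" by (simp add: bounded_linear.linear bounded_linear_inner_left)
    have "fd (\<lambda>z. fd (\<lambda>x. f x \<bullet> b) z u) x v = fd (\<lambda>z. fd f z u \<bullet> b) x v"
      using fd_cong[OF S, of "\<lambda>z. fd (\<lambda>x. f x \<bullet> b) z u" "\<lambda>z. fd f z u \<bullet> b"]
        fd_linear[OF l S(1) _ f] by simp
    also have "\<dots> = fd (\<lambda>z. fd f z u) x v \<bullet> b"
      by (rule fd_linear[OF l S smooth_on_fd[OF f S(1)]])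
    finally show ?thesis .
  qed
  have "smooth_on S (\<lambda>x. f x \<bullet> b)" by (intro smooth_intros f)
  from second_derivative_symmetric_real[OF this S, of u v]
  show "fd (\<lambda>z. fd f z u) x v \<bullet> b = fd (\<lambda>z. fd f z v) x u \<bullet> b" by (simp add: e)
qed


section \<open>Metrics and connections on open subsets of a Euclidean space\<close>

text \<open>A tensor with the symmetries of a curvature tensor vanishes if its sectional values do.
  Polarisation uses additivity alone, and additivity in the first slot spreads to the other slots
  through the symmetries.\<close>

lemma curvature_polarization:
  fixes R :: "'a::ab_group_add \<Rightarrow> 'a \<Rightarrow> 'a \<Rightarrow> 'a \<Rightarrow> real"
  assumes sk1: "\<And>u v w z. R u v w z = - R v u w z"
    and sk2: "\<And>u v w z. R u v w z = - R u v z w"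
    and bianchi: "\<And>u v w z. R u v w z + R v w u z + R w u v z = 0"
    and add1: "\<And>u u' v w z. R (u + u') v w z = R u v w z + R u' v w z"
    and sec: "\<And>u v. R u v v u = 0"
  shows "R u v w z = 0"
proof -
  \<comment> \<open>The usual octahedron argument: the Bianchi identities of the four cyclic shifts
    are combined and rewritten by the two skew symmetries.\<close>
  have pair: "R w u v z = R v z w u" for u v w z
    using bianchi[of u v w z] bianchi[of v w z u] bianchi[of w z u v] bianchi[of z u v w]
      sk2[of v w z u] sk2[of w z v u] sk1[of z v w u] sk1[of z u w v] sk2[of u z w v]
      sk1[of u w z v] sk2[of w u z v] sk1[of z u v w] sk2[of u v z w] sk2[of v z u w]
    by linarith
  have add4: "R u v w (z + z') = R u v w z + R u v w z'" for u v w z z'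
    using pair[of u v w "z + z'"] pair[of u v w z] pair[of u v w z'] add1[of z z' w u v]
      sk1[of w "z + z'" u v] sk1[of w z u v] sk1[of w z' u v] by simp
  have add2: "R u (v + v') w z = R u v w z + R u v' w z" for u v v' w z
    using sk1[of u "v + v'" w z] sk1[of u v w z] sk1[of u v' w z] add1[of v v' u w z] by simp
  have add3: "R u v (w + w') z = R u v w z + R u v w' z" for u v w w' z
    using sk2[of u v "w + w'" z] sk2[of u v w z] sk2[of u v w' z] add4[of u v z w w'] by simp
  have uvvz: "R u v v z = 0" for u v z
  proof -
    have "R u v v z + R z v v u = 0"
      using sec[of "u + z" v] sec[of u v] sec[of z v] by (simp add: add1 add4)
    moreover have "R z v v u = R u v v z"
      using pair[of z v v u] sk1[of v u z v] sk2[of u v z v] by linarith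
    ultimately show ?thesis by simp
  qed
  \<comment> \<open>Polarising in the repeated middle argument makes \<open>R\<close> alternating in
    its first three slots. The three terms of the Bianchi identity are then equal, so each is
    0.\<close>
  have sk3: "R u v w z = - R u w v z" for u v w z
    using uvvz[of u "v + w" z] uvvz[of u v z] uvvz[of u w z] by (simp add: add2 add3)
  show ?thesis
    using bianchi[of u v w z] sk3[of w v u z] sk1[of v w u z] sk3[of u w v z] sk1[of w u v z]
    by linarith
qed

section \<open>The Levi-Civita connection of a metric on an open set\<close>

locale local_metric =
  fixes U :: "'b::euclidean_space set" and g :: "'b \<Rightarrow> 'b \<Rightarrow> 'b \<Rightarrow> real"
  assumes open_U: "open U"
    and g_sym: "x \<in> U \<Longrightarrow> g x v w = g x w v"
    and g_linear: "x \<in> U \<Longrightarrow> linear (g x v)"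
    and g_pos: "x \<in> U \<Longrightarrow> v \<noteq> 0 \<Longrightarrow> g x v v > 0"
    and g_smooth: "smooth_on U (\<lambda>x. g x v w)"
begin

lemma g_linear_left: "x \<in> U \<Longrightarrow> linear (\<lambda>v. g x v w)"
proof -
  assume x: "x \<in> U"
  then have "(\<lambda>v. g x v w) = g x w" by (intro ext g_sym)
  with g_linear[OF x] show ?thesis by simp
qed

lemma g_eqI: "x \<in> U \<Longrightarrow> (\<And>z. g x y z = g x y' z) \<Longrightarrow> y = y'"
  using g_pos[of x "y - y'"] linear_diff[OF g_linear_left, of x y y' "y - y'"] by force

text \<open>The Euclidean inner product turns the covector \<open>g x y\<close> into a vector.
  \<open>lower\<close> and \<open>raise\<close> are the musical isomorphisms in this form; a
  covector is passed as a function of which only the values on \<open>Basis\<close> count.\<close>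

definition lower :: "'b \<Rightarrow> 'b \<Rightarrow> 'b" where
  "lower x y = (\<Sum>b\<in>Basis. g x y b *\<^sub>R b)"

definition raise :: "'b \<Rightarrow> ('b \<Rightarrow> real) \<Rightarrow> 'b" where
  "raise x l = inv (lower x) (\<Sum>b\<in>Basis. l b *\<^sub>R b)"

lemma lower_inner: "x \<in> U \<Longrightarrow> lower x y \<bullet> z = g x y z"
  unfolding lower_def inner_sum_left
  by (subst linear_basis_sum[OF g_linear]) (auto simp: mult.commute inner_commute)

lemma linear_lower: "x \<in> U \<Longrightarrow> linear (lower x)"
  by (intro linearI euclidean_eqI[where 'a = 'b])
    (auto simp: lower_inner inner_add_left linear_add[OF g_linear_left] linear_scale[OF g_linear_left])

lemma inj_lower: "x \<in> U \<Longrightarrow> inj (lower x)"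
  by (metis g_eqI injI lower_inner)

lemma lower_raise: "x \<in> U \<Longrightarrow> lower x (raise x l) = (\<Sum>b\<in>Basis. l b *\<^sub>R b)"
  unfolding raise_def
  by (rule surj_f_inv_f) (simp add: linear_injective_imp_surjective linear_lower inj_lower)

lemma g_raise: "x \<in> U \<Longrightarrow> linear l \<Longrightarrow> g x (raise x l) z = l z"
  using lower_inner[of x "raise x l" z] linear_basis_sum[of l z]
  by (simp add: lower_raise inner_sum_left inner_commute[of z] mult.commute)

lemma raise_eqI: "x \<in> U \<Longrightarrow> (\<And>z. g x y z = l z) \<Longrightarrow> raise x l = y"
proof -
  assume x: "x \<in> U" and e: "\<And>z. g x y z = l z"
  then have "linear l" using g_linear[of x y] by (metis ext)
  with x e show "raise x l = y" using g_eqI[of x "raise x l" y] g_raise by simp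
qed

lemma smooth_on_g:
  assumes "P ` V \<subseteq> U" "smooth_on V P" "smooth_on V v" "smooth_on V w"
  shows "smooth_on V (\<lambda>x. g (P x) (v x) (w x))"
proof -
  have P: "P x \<in> U" if "x \<in> V" for x using that assms(1) by blast
  have s: "smooth_on V (\<lambda>x. g (P x) v' w')" for v' w'
    by (rule smooth_on_compose[OF g_smooth assms(2,1)])
  have "smooth_on V (\<lambda>x. g (P x) (v x) w')" for w'
    using smooth_on_linear_family[of V "\<lambda>x v. g (P x) v w'" v] g_linear_left P s assms(3) by blast
  then show ?thesis
    using smooth_on_linear_family[of V "\<lambda>x w. g (P x) (v x) w" w] g_linear P assms(4) by blast
qed

text \<open>Raising an index means solving a linear system with the operator \<open>lower\<close>,
  so smoothness comes from the general result on linear systems and no formula for the inverse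
  matrix of the metric is involved.\<close>

lemma smooth_on_raise:
  assumes "P ` V \<subseteq> U" "smooth_on V P" "\<And>b. smooth_on V (\<lambda>x. l x b)"
  shows "smooth_on V (\<lambda>x. raise (P x) (l x))"
proof (rule smooth_on_linear_solve[of V "\<lambda>x. lower (P x)" "\<lambda>x. \<Sum>b\<in>Basis. l x b *\<^sub>R b"])
  have P: "P x \<in> U" if "x \<in> V" for x using that assms(1) by blast
  show "linear (lower (P x))" "inj (lower (P x))"
    "lower (P x) (raise (P x) (l x)) = (\<Sum>b\<in>Basis. l x b *\<^sub>R b)" if "x \<in> V" for x
    using P[OF that] by (simp_all add: linear_lower inj_lower lower_raise)
  show "smooth_on V (\<lambda>x. lower (P x) v)" for v
    unfolding lower_def by (intro smooth_intros smooth_on_g assms)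
  show "smooth_on V (\<lambda>x. \<Sum>b\<in>Basis. l x b *\<^sub>R b)" by (intro smooth_intros assms)
qed

definition koszul :: "'b \<Rightarrow> 'b \<Rightarrow> 'b \<Rightarrow> 'b \<Rightarrow> real" where
  "koszul x u v z = (fd (\<lambda>x. g x v z) x u + fd (\<lambda>x. g x u z) x v - fd (\<lambda>x. g x u v) x z) / 2"

text \<open>The Christoffel symbols as a bilinear map: the components are the sums of \<Gamma>^k_ij
  u^i v^j. The bracket terms of the Koszul formula are absent because \<open>u\<close> and
  \<open>v\<close> are constant fields.\<close>

definition chris :: "'b \<Rightarrow> 'b \<Rightarrow> 'b \<Rightarrow> 'b" where
  "chris x u v = raise x (koszul x u v)"

lemma linear_fd_g: "x \<in> U \<Longrightarrow> linear (fd (\<lambda>x. g x v w) x)"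
  by (rule linear_fd[OF g_smooth open_U])

lemma fd_g_sym: "x \<in> U \<Longrightarrow> fd (\<lambda>x. g x v w) x u = fd (\<lambda>x. g x w v) x u"
  by (intro fd_cong[OF open_U, THEN fun_cong] g_sym)

lemma linear_fd_g2: "x \<in> U \<Longrightarrow> linear (\<lambda>w. fd (\<lambda>x. g x v w) x u)"
proof (rule linearI)
  assume x: "x \<in> U"
  show "fd (\<lambda>x. g x v (w + w')) x u = fd (\<lambda>x. g x v w) x u + fd (\<lambda>x. g x v w') x u" for w w'
    using fd_cong[OF open_U x, of "\<lambda>x. g x v (w + w')" "\<lambda>x. g x v w + g x v w'"]
    by (simp add: fd_add[OF open_U x g_smooth g_smooth] linear_add[OF g_linear])
  show "fd (\<lambda>x. g x v (r *\<^sub>R w)) x u = r *\<^sub>R fd (\<lambda>x. g x v w) x u" for r w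
    using fd_cong[OF open_U x, of "\<lambda>x. g x v (r *\<^sub>R w)" "\<lambda>x. r * g x v w"]
    by (simp add: fd_mult[OF open_U x smooth_on_const g_smooth] linear_scale[OF g_linear])
qed

lemma linear_fd_g1: "x \<in> U \<Longrightarrow> linear (\<lambda>v. fd (\<lambda>x. g x v w) x u)"
proof -
  assume x: "x \<in> U"
  then have "(\<lambda>v. fd (\<lambda>x. g x v w) x u) = (\<lambda>v. fd (\<lambda>x. g x w v) x u)" by (intro ext fd_g_sym)
  with linear_fd_g2[OF x] show ?thesis by simp
qed

lemma koszul_linear: "x \<in> U \<Longrightarrow> linear (koszul x u v)"
  by (rule linearI) (simp_all add: koszul_def linear_add[OF linear_fd_g] linear_scale[OF linear_fd_g]
      linear_add[OF linear_fd_g2] linear_scale[OF linear_fd_g2] field_simps)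

lemma g_chris: "x \<in> U \<Longrightarrow> g x (chris x u v) z = koszul x u v z"
  unfolding chris_def by (simp add: g_raise koszul_linear)

lemma chris_sym: "x \<in> U \<Longrightarrow> chris x u v = chris x v u"
  unfolding chris_def koszul_def using fd_g_sym[of x u v] by (simp add: add.commute)

lemma chris_metric:
  "x \<in> U \<Longrightarrow> fd (\<lambda>x. g x v w) x u = g x (chris x u v) w + g x v (chris x u w)"
  using g_chris[of x u v w] g_chris[of x u w v] g_sym[of x v "chris x u w"]
    fd_g_sym[of x v w u] fd_g_sym[of x u w v] fd_g_sym[of x u v w]
  by (simp add: koszul_def field_simps)

text \<open>The uniqueness half of the fundamental theorem of Riemannian geometry at a single point:
  compatibility expresses the Koszul sum through \<open>C\<close>, and symmetry cancels all terms
  but one. It serves to recognise a connection transported from another chart.\<close>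

lemma chris_eqI:
  assumes x: "x \<in> U" and sym: "\<And>u v. C u v = C v u"
    and m: "\<And>u v w. fd (\<lambda>x. g x v w) x u = g x (C u v) w + g x v (C u w)"
  shows "C u v = chris x u v"
proof (rule g_eqI[OF x])
  show "g x (C u v) z = g x (chris x u v) z" for z
    unfolding g_chris[OF x] koszul_def m
    using sym[of v u] sym[of u z] sym[of v z] g_sym[OF x] by (simp add: field_simps)
qed

lemma linear_chris: "x \<in> U \<Longrightarrow> linear (chris x u)"
proof (rule linearI)
  assume x: "x \<in> U"
  show "chris x u (v + v') = chris x u v + chris x u v'" for v v'
    by (rule g_eqI[OF x]) (simp add: linear_add[OF g_linear_left] x g_chris koszul_def
        linear_add[OF linear_fd_g] linear_add[OF linear_fd_g1] linear_add[OF linear_fd_g2] field_simps)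
  show "chris x u (r *\<^sub>R v) = r *\<^sub>R chris x u v" for r v
    by (rule g_eqI[OF x]) (simp add: linear_scale[OF g_linear_left] x g_chris koszul_def
        linear_scale[OF linear_fd_g] linear_scale[OF linear_fd_g1] linear_scale[OF linear_fd_g2] field_simps)
qed

lemma linear_chris_left: "x \<in> U \<Longrightarrow> linear (\<lambda>u. chris x u v)"
proof -
  assume x: "x \<in> U"
  then have "(\<lambda>u. chris x u v) = chris x v" by (intro ext chris_sym)
  with linear_chris[OF x] show ?thesis by simp
qed

lemma chris_smooth: "smooth_on U (\<lambda>x. chris x u v)"
  unfolding chris_def koszul_def
  by (rule smooth_on_raise[of "\<lambda>x. x"]) (auto intro!: smooth_intros smooth_on_fd g_smooth open_U)

lemma smooth_on_chris:
  assumes "P ` V \<subseteq> U" "smooth_on V P" "smooth_on V v" "smooth_on V w"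
  shows "smooth_on V (\<lambda>x. chris (P x) (v x) (w x))"
proof -
  have P: "P x \<in> U" if "x \<in> V" for x using that assms(1) by blast
  have s: "smooth_on V (\<lambda>x. chris (P x) v' w')" for v' w'
    by (rule smooth_on_compose[OF chris_smooth assms(2,1)])
  have "smooth_on V (\<lambda>x. chris (P x) (v x) w')" for w'
    using smooth_on_linear_family[of V "\<lambda>x v. chris (P x) v w'" v] linear_chris_left P s assms(3) by blast
  then show ?thesis
    using smooth_on_linear_family[of V "\<lambda>x w. chris (P x) (v x) w" w] linear_chris P assms(4) by blast
qed

text \<open>The curvature on constant fields, whose brackets vanish.\<close>

definition riem :: "'b \<Rightarrow> 'b \<Rightarrow> 'b \<Rightarrow> 'b \<Rightarrow> 'b" where
  "riem x u v w = fd (\<lambda>x. chris x v w) x u - fd (\<lambda>x. chris x u w) x v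
     + chris x u (chris x v w) - chris x v (chris x u w)"

end

text \<open>
  A map \<open>v\<close> on \<open>V\<close> stands for a section of the pullback of the tangent bundle of \<open>U\<close> along \<open>P\<close>, and
  \<open>cov\<close> is the pullback of the Levi-Civita connection.
\<close>

locale pulled_back_metric = local_metric U g
  for U :: "'b::euclidean_space set" and g +
  fixes V :: "'a::euclidean_space set" and P :: "'a \<Rightarrow> 'b"
  assumes open_V: "open V" and P_smooth: "smooth_on V P" and P_into: "P ` V \<subseteq> U"
begin

lemma P_mem: "x \<in> V \<Longrightarrow> P x \<in> U"
  using P_into by blast

definition cov :: "('a \<Rightarrow> 'b) \<Rightarrow> 'a \<Rightarrow> 'a \<Rightarrow> 'b" where
  "cov v X x = fd v x X + chris (P x) (fd P x X) (v x)"

lemma smooth_on_cov: "smooth_on V v \<Longrightarrow> smooth_on V (cov v X)"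
  unfolding cov_def
  by (intro smooth_intros smooth_on_fd smooth_on_chris P_into P_smooth open_V)

lemma cov_metric:
  assumes x: "x \<in> V" and v: "smooth_on V v" and w: "smooth_on V w"
  shows "fd (\<lambda>x. g (P x) (v x) (w x)) x X
    = g (P x) (cov v X x) (w x) + g (P x) (v x) (cov w X x)"
proof -
  have "fd (\<lambda>x. g (P x) (v x) (w x)) x X =
      fd (\<lambda>z. g (P z) (v z) (w x)) x X + g (P x) (v x) (fd w x X)"
    by (rule fd_linear_family[OF open_V x, of "\<lambda>x. g (P x) (v x)"])
      (simp_all add: g_linear P_mem w smooth_on_g P_into P_smooth v smooth_on_const)
  also have "fd (\<lambda>z. g (P z) (v z) (w x)) x X =
      fd (\<lambda>z. g (P z) (v x) (w x)) x X + g (P x) (fd v x X) (w x)"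
    by (rule fd_linear_family[OF open_V x, of "\<lambda>z v. g (P z) v (w x)"])
      (simp_all add: g_linear_left P_mem w smooth_on_g P_into P_smooth v smooth_on_const)
  also have "fd (\<lambda>z. g (P z) (v x) (w x)) x X = fd (\<lambda>z. g z (v x) (w x)) (P x) (fd P x X)"
    by (rule fd_compose[OF open_V x P_smooth open_U P_mem[OF x] g_smooth])
  also have "\<dots> = g (P x) (chris (P x) (fd P x X) (v x)) (w x) + g (P x) (v x) (chris (P x) (fd P x X) (w x))"
    by (rule chris_metric[OF P_mem[OF x]])
  finally show ?thesis
    using P_mem[OF x] by (simp add: cov_def linear_add[OF g_linear] linear_add[OF g_linear_left])
qed

lemma cov_add:
  "x \<in> V \<Longrightarrow> smooth_on V v \<Longrightarrow> smooth_on V w \<Longrightarrow>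
    cov (\<lambda>x. v x + w x) X x = cov v X x + cov w X x"
  by (simp add: cov_def fd_add[OF open_V] linear_add[OF linear_chris] P_mem)

lemma cov_scaleR:
  "x \<in> V \<Longrightarrow> smooth_on V f \<Longrightarrow> smooth_on V v \<Longrightarrow>
    cov (\<lambda>x. f x *\<^sub>R v x) X x = fd f x X *\<^sub>R v x + f x *\<^sub>R cov v X x"
  by (simp add: cov_def fd_scaleR[OF open_V] linear_scale[OF linear_chris] P_mem scaleR_add_right)

text \<open>The curvature of a pulled-back connection is the pullback of the curvature. The
  directions \<open>X\<close> and \<open>Y\<close> are constant, so there is no bracket term, and
  the second derivatives of \<open>v\<close> and \<open>P\<close> cancel by symmetry.\<close>

lemma cov_commutator:
  assumes x: "x \<in> V" and v: "smooth_on V v"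
  shows "cov (cov v Y) X x - cov (cov v X) Y x = riem (P x) (fd P x X) (fd P x Y) (v x)"
proof -
  have e: "cov (cov v Y) X x = fd (\<lambda>z. fd v z Y) x X
      + fd (\<lambda>z. chris z (fd P x Y) (v x)) (P x) (fd P x X)
      + chris (P x) (fd (\<lambda>z. fd P z Y) x X) (v x)
      + chris (P x) (fd P x Y) (fd v x X) + chris (P x) (fd P x X) (fd v x Y)
      + chris (P x) (fd P x X) (chris (P x) (fd P x Y) (v x))" for X Y
  proof -
    have "fd (cov v Y) x X = fd (\<lambda>z. fd v z Y) x X + fd (\<lambda>x. chris (P x) (fd P x Y) (v x)) x X"
      unfolding cov_def
      by (intro fd_add[OF open_V x] smooth_on_fd smooth_on_chris P_into P_smooth open_V v smooth_on_const)
    also have "fd (\<lambda>x. chris (P x) (fd P x Y) (v x)) x X =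
        fd (\<lambda>z. chris (P z) (fd P z Y) (v x)) x X + chris (P x) (fd P x Y) (fd v x X)"
      by (rule fd_linear_family[OF open_V x, of "\<lambda>x. chris (P x) (fd P x Y)"])
        (simp_all add: linear_chris P_mem v smooth_on_chris P_into P_smooth smooth_on_const
          smooth_on_fd open_V)
    also have "fd (\<lambda>z. chris (P z) (fd P z Y) (v x)) x X =
        fd (\<lambda>z. chris (P z) (fd P x Y) (v x)) x X + chris (P x) (fd (\<lambda>z. fd P z Y) x X) (v x)"
      by (rule fd_linear_family[OF open_V x, of "\<lambda>z u. chris (P z) u (v x)"])
        (simp_all add: linear_chris_left P_mem smooth_on_chris P_into P_smooth smooth_on_const
          smooth_on_fd open_V)
    also have "fd (\<lambda>z. chris (P z) (fd P x Y) (v x)) x X =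
        fd (\<lambda>z. chris z (fd P x Y) (v x)) (P x) (fd P x X)"
      by (rule fd_compose[OF open_V x P_smooth open_U P_mem[OF x] chris_smooth])
    finally show ?thesis
      unfolding cov_def[of "cov v Y"] unfolding cov_def
      by (simp add: linear_add[OF linear_chris] P_mem x)
  qed
  show ?thesis
    using second_derivative_symmetric[OF v open_V x, of Y X]
      second_derivative_symmetric[OF P_smooth open_V x, of Y X] unfolding e riem_def by simp
qed

lemma linear_cov: "x \<in> V \<Longrightarrow> smooth_on V v \<Longrightarrow> linear (\<lambda>X. cov v X x)"
  using linear_fd[OF _ open_V, of v x] linear_fd[OF P_smooth open_V, of x] linear_chris_left[OF P_mem, of x "v x"]
  unfolding cov_def by (intro linear_compose_add) (auto dest: linear_compose simp: o_def)

end

section \<open>Symmetries of the curvature tensor and constant curvature\<close>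

context local_metric
begin

lemma pulled_back_id: "pulled_back_metric U g U (\<lambda>x. x)"
  by unfold_locales (auto simp: open_U smooth_on_id)

lemma linear_riem: "x \<in> U \<Longrightarrow> linear (riem x u v)"
proof (rule linearI)
  assume x: "x \<in> U"
  have a: "fd (\<lambda>x. chris x u (v + w)) x z = fd (\<lambda>x. chris x u v) x z + fd (\<lambda>x. chris x u w) x z" for u v w z
    using fd_cong[OF open_U x, of "\<lambda>x. chris x u (v + w)" "\<lambda>x. chris x u v + chris x u w"]
    by (simp add: fd_add[OF open_U x chris_smooth chris_smooth] linear_add[OF linear_chris])
  have b: "fd (\<lambda>x. chris x u (r *\<^sub>R v)) x z = r *\<^sub>R fd (\<lambda>x. chris x u v) x z" for u v r z
    using fd_cong[OF open_U x, of "\<lambda>x. chris x u (r *\<^sub>R v)" "\<lambda>x. r *\<^sub>R chris x u v"]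
    by (simp add: fd_scaleR[OF open_U x smooth_on_const chris_smooth] linear_scale[OF linear_chris])
  show "riem x u v (w + w') = riem x u v w + riem x u v w'" for w w'
    unfolding riem_def a by (simp add: linear_add[OF linear_chris] x algebra_simps)
  show "riem x u v (r *\<^sub>R w) = r *\<^sub>R riem x u v w" for r w
    unfolding riem_def b by (simp add: linear_scale[OF linear_chris] x algebra_simps)
qed

lemma riem_add_left: "x \<in> U \<Longrightarrow> riem x (u + u') v w = riem x u v w + riem x u' v w"
proof -
  assume x: "x \<in> U"
  have a: "fd (\<lambda>x. chris x (u + u') w) x z = fd (\<lambda>x. chris x u w) x z + fd (\<lambda>x. chris x u' w) x z" for z
    using fd_cong[OF open_U x, of "\<lambda>x. chris x (u + u') w" "\<lambda>x. chris x u w + chris x u' w"]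
    by (simp add: fd_add[OF open_U x chris_smooth chris_smooth] linear_add[OF linear_chris_left])
  show ?thesis
    unfolding riem_def a
    by (simp add: linear_add[OF linear_chris] linear_add[OF linear_chris_left] x
        linear_add[OF linear_fd[OF chris_smooth open_U x]] algebra_simps)
qed

lemma riem_skew: "riem x u v w = - riem x v u w"
  by (simp add: riem_def)

lemma riem_bianchi: "x \<in> U \<Longrightarrow> riem x u v w + riem x v w u + riem x w u v = 0"
proof -
  assume x: "x \<in> U"
  have "fd (\<lambda>x. chris x u v) x w = fd (\<lambda>x. chris x v u) x w" for u v w
    by (intro fd_cong[OF open_U x, THEN fun_cong] chris_sym)
  from this[of v w u] this[of u w v] this[of u v w] show ?thesis
    unfolding riem_def using chris_sym[OF x, of v w] chris_sym[OF x, of u w] chris_sym[OF x, of u v]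
    by simp
qed

text \<open>Differentiating g(W, Z) twice by the Leibniz rule yields mixed terms that are symmetric
  in the two directions. Since second derivatives of a function commute, the curvature terms that
  remain must cancel.\<close>

lemma riem_metric: "x \<in> U \<Longrightarrow> g x (riem x u v w) z = - g x w (riem x u v z)"
proof -
  assume x: "x \<in> U"
  interpret pulled_back_metric U g U "\<lambda>x. x" by (rule pulled_back_id)
  define W where "W = (\<lambda>_::'b. w)"
  define Z where "Z = (\<lambda>_::'b. z)"
  have [simp]: "smooth_on U W" "smooth_on U Z" by (simp_all add: W_def Z_def smooth_on_const)
  have e: "fd (\<lambda>y. fd (\<lambda>x. g x (W x) (Z x)) y v) x u =
     g x (cov (cov W v) u x) (Z x) + g x (cov W v x) (cov Z u x)
     + g x (cov W u x) (cov Z v x) + g x (W x) (cov (cov Z v) u x)" for u v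
  proof -
    have "fd (\<lambda>y. fd (\<lambda>x. g x (W x) (Z x)) y v) x u =
        fd (\<lambda>x. g x (cov W v x) (Z x) + g x (W x) (cov Z v x)) x u"
      by (intro fd_cong[OF open_U x, THEN fun_cong] cov_metric) simp_all
    also have "\<dots> = fd (\<lambda>x. g x (cov W v x) (Z x)) x u + fd (\<lambda>x. g x (W x) (cov Z v x)) x u"
      by (intro fd_add[OF open_U x] smooth_on_g[of "\<lambda>x. x"]) (simp_all add: smooth_on_id smooth_on_cov)
    finally show ?thesis by (simp add: cov_metric[OF x] smooth_on_cov)
  qed
  have "smooth_on U (\<lambda>x. g x (W x) (Z x))" by (simp add: smooth_on_g[of "\<lambda>x. x"] smooth_on_id)
  from second_derivative_symmetric_real[OF this open_U x, of v u]
  have "g x (cov (cov W v) u x - cov (cov W u) v x) (Z x) =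
      - g x (W x) (cov (cov Z v) u x - cov (cov Z u) v x)"
    unfolding e using x by (simp add: linear_diff[OF g_linear] linear_diff[OF g_linear_left])
  then show ?thesis by (simp add: cov_commutator[OF x] W_def Z_def smooth_on_const)
qed

text \<open>The difference from the model tensor of curvature \<open>c\<close> has the symmetries of
  a curvature tensor and vanishing sectional values, so polarisation applies. As \<open>sec\<close>
  speaks of independent pairs only, dependent pairs are treated separately.\<close>

lemma riem_constant_curvature:
  assumes x: "x \<in> U"
    and sec: "\<And>u v. (\<forall>a b. a *\<^sub>R u + b *\<^sub>R v = 0 \<longrightarrow> a = 0 \<and> b = 0) \<Longrightarrow>
      g x (riem x u v v) u / (g x u u * g x v v - (g x u v)\<^sup>2) = c"
  shows "riem x u v w = c *\<^sub>R (g x v w *\<^sub>R u - g x u w *\<^sub>R v)"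
proof (rule g_eqI[OF x])
  note lin = linear_add[OF g_linear[OF x]] linear_diff[OF g_linear[OF x]] linear_scale[OF g_linear[OF x]]
    linear_add[OF g_linear_left[OF x]] linear_diff[OF g_linear_left[OF x]] linear_scale[OF g_linear_left[OF x]]
  define R where "R u v w z = g x (riem x u v w) z - c * (g x v w * g x u z - g x u w * g x v z)" for u v w z
  have "R u v w z = 0" for u v w z
  proof (rule curvature_polarization[of R])
    show "R u v w z = - R v u w z" for u v w z
      using riem_skew[of x u v w] linear_neg[OF g_linear_left[OF x]] unfolding R_def by (simp add: algebra_simps)
    show "R u v w z = - R u v z w" for u v w z
      using riem_metric[OF x, of u v w z] g_sym[OF x] unfolding R_def by (simp add: algebra_simps)
    show "R u v w z + R v w u z + R w u v z = 0" for u v w z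
    proof -
      have "g x (riem x u v w) z + g x (riem x v w u) z + g x (riem x w u v) z = 0"
        using riem_bianchi[OF x, of u v w] lin linear_0[OF g_linear_left[OF x]] by metis
      then show ?thesis using g_sym[OF x, of v w] g_sym[OF x, of u w] g_sym[OF x, of u v]
        unfolding R_def by (simp add: algebra_simps)
    qed
    show "R (u + u') v w z = R u v w z + R u' v w z" for u u' v w z
      unfolding R_def riem_add_left[OF x] lin by (simp add: algebra_simps)
    show "R u v v u = 0" for u v
    proof (cases "\<forall>a b. a *\<^sub>R u + b *\<^sub>R v = 0 \<longrightarrow> a = 0 \<and> b = 0")
      case True
      \<comment> \<open>The part of \<open>v\<close> orthogonal to \<open>u\<close>, scaled by g(u,
        u). Its squared length is g(u, u) times the Gram determinant, so the denominator in
        \<open>sec\<close> is nonzero.\<close>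
      define q where "q = g x u u *\<^sub>R v - g x u v *\<^sub>R u"
      have "u \<noteq> 0" using True[rule_format, of 1 0] by auto
      then have p: "g x u u > 0" using g_pos[OF x] by blast
      have "q \<noteq> 0" using True[rule_format, of "- g x u v" "g x u u"] p unfolding q_def by auto
      then have "g x q q > 0" using g_pos[OF x] by blast
      moreover have "g x q q = g x u u * (g x u u * g x v v - (g x u v)\<^sup>2)"
        unfolding q_def lin using g_sym[OF x, of v u]
        by (simp add: algebra_simps power2_eq_square)
      ultimately have "g x u u * g x v v - (g x u v)\<^sup>2 \<noteq> 0" by auto
      with sec[OF True] show ?thesis
        using g_sym[OF x, of v u] unfolding R_def
        by (simp add: field_simps power2_eq_square)
    next
      case False
      then obtain a b where ab: "a *\<^sub>R u + b *\<^sub>R v = 0" "a \<noteq> 0 \<or> b \<noteq> 0" by blast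
      \<comment> \<open>For a dependent pair either \<open>v = 0\<close>, or \<open>u\<close> is a
        multiple of \<open>v\<close> and skew symmetry gives 0.\<close>
      have R0: "R w w y z = 0" "R y z w w = 0" for w y z
        using riem_metric[OF x, of y z w w] g_sym[OF x, of w "riem x y z w"] linear_0[OF g_linear_left[OF x]]
        unfolding R_def by (simp_all add: riem_def[of x w w] mult.commute)
      have lr: "linear (\<lambda>w. R u v w z)" for u v z
        unfolding R_def
        by (rule linearI) (simp_all add: linear_add[OF linear_riem[OF x]] linear_scale[OF linear_riem[OF x]] lin algebra_simps)
      have l4: "linear (\<lambda>z. R u v w z)" for u v w
        unfolding R_def by (rule linearI) (simp_all add: lin algebra_simps)
      show ?thesis
      proof (cases "a = 0")
        case True
        with ab have "v = 0" by simp
        then show ?thesis using linear_0[OF lr] by simp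
      next
        case False
        have "a *\<^sub>R u = - (b *\<^sub>R v)" using ab(1) by (simp add: eq_neg_iff_add_eq_0)
        then have "inverse a *\<^sub>R (a *\<^sub>R u) = inverse a *\<^sub>R - (b *\<^sub>R v)" by simp
        with False have "u = (- b / a) *\<^sub>R v" by (simp add: divide_inverse mult.commute)
        then have "R u v v u = (- b / a) * R u v v v"
          using linear_scale[OF l4, of u v v "- b / a" v] by simp
        then show ?thesis using R0 by simp
      qed
    qed
  qed
  then show "g x (riem x u v w) z = g x (c *\<^sub>R (g x v w *\<^sub>R u - g x u w *\<^sub>R v)) z" for z
    unfolding R_def lin by (simp add: algebra_simps)
qed

end


section \<open>Manifolds in charts\<close>

text \<open>Injectivity of the charts makes images commute with intersections, and this is what
  turns the defining predicate into a topology.\<close>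

lemma openin_atlas_topology:
  assumes "\<And>\<phi>. \<phi> \<in> A \<Longrightarrow> inj_on (snd \<phi>) (fst \<phi>)"
  shows "openin (atlas_topology A) W \<longleftrightarrow>
    W \<subseteq> carrier_of A \<and> (\<forall>\<phi>\<in>A. open (snd \<phi> ` (W \<inter> fst \<phi>)))"
proof -
  have "istopology (\<lambda>W. W \<subseteq> carrier_of A \<and> (\<forall>\<phi>\<in>A. open (snd \<phi> ` (W \<inter> fst \<phi>))))"
    unfolding istopology_def
  proof (intro conjI allI impI ballI)
    fix S T \<phi>
    assume S: "S \<subseteq> carrier_of A \<and> (\<forall>\<phi>\<in>A. open (snd \<phi> ` (S \<inter> fst \<phi>)))"
      and T: "T \<subseteq> carrier_of A \<and> (\<forall>\<phi>\<in>A. open (snd \<phi> ` (T \<inter> fst \<phi>)))" and p: "\<phi> \<in> A"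
    have "snd \<phi> ` (S \<inter> T \<inter> fst \<phi>) = snd \<phi> ` (S \<inter> fst \<phi>) \<inter> snd \<phi> ` (T \<inter> fst \<phi>)"
      using assms[OF p] unfolding inj_on_def by blast
    with S T p show "open (snd \<phi> ` (S \<inter> T \<inter> fst \<phi>))" by auto
  next
    fix K \<phi>
    assume K: "\<forall>S\<in>K. S \<subseteq> carrier_of A \<and> (\<forall>\<phi>\<in>A. open (snd \<phi> ` (S \<inter> fst \<phi>)))" and p: "\<phi> \<in> A"
    have "snd \<phi> ` (\<Union>K \<inter> fst \<phi>) = (\<Union>S\<in>K. snd \<phi> ` (S \<inter> fst \<phi>))" by blast
    with K p show "open (snd \<phi> ` (\<Union>K \<inter> fst \<phi>))" by auto
  qed blast+
  then show ?thesis unfolding atlas_topology_def by (simp add: topology_inverse')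
qed

section \<open>Tangent vectors and fields under changes of charts\<close>

locale charted =
  fixes A :: "('p, 'e::euclidean_space) atlas"
  assumes smooth_atlas: "smooth_atlas A"
begin

definition ov :: "('p, 'e) chart \<Rightarrow> ('p, 'e) chart \<Rightarrow> 'e set" where
  "ov \<phi> \<psi> = snd \<phi> ` (fst \<phi> \<inter> fst \<psi>)"

lemma chart_inj: "\<phi> \<in> A \<Longrightarrow> inj_on (snd \<phi>) (fst \<phi>)"
  using smooth_atlas unfolding smooth_atlas_def by blast

lemma chart_image_open: "\<phi> \<in> A \<Longrightarrow> open (snd \<phi> ` fst \<phi>)"
  using smooth_atlas unfolding smooth_atlas_def by blast

lemma ov_open: "\<phi> \<in> A \<Longrightarrow> \<psi> \<in> A \<Longrightarrow> open (ov \<phi> \<psi>)"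
  using smooth_atlas unfolding smooth_atlas_def ov_def by blast

lemma transition_smooth: "\<phi> \<in> A \<Longrightarrow> \<psi> \<in> A \<Longrightarrow> smooth_on (ov \<phi> \<psi>) (transition \<phi> \<psi>)"
  using smooth_atlas unfolding smooth_atlas_def ov_def by blast

lemma openin_iff: "openin (atlas_topology A) W \<longleftrightarrow>
    W \<subseteq> carrier_of A \<and> (\<forall>\<phi>\<in>A. open (snd \<phi> ` (W \<inter> fst \<phi>)))"
  by (rule openin_atlas_topology) (rule chart_inj)

lemma topspace_atlas: "topspace (atlas_topology A) = carrier_of A"
proof -
  have "openin (atlas_topology A) (carrier_of A)"
    unfolding openin_iff
  proof (intro conjI ballI)
    fix \<phi> assume p: "\<phi> \<in> A"
    then have "carrier_of A \<inter> fst \<phi> = fst \<phi>" by (auto simp: carrier_of_def)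
    with chart_image_open[OF p] show "open (snd \<phi> ` (carrier_of A \<inter> fst \<phi>))" by simp
  qed simp
  then show ?thesis
    by (metis openin_iff openin_subset openin_topspace subset_antisym)
qed

lemma chart_inv_snd [simp]: "\<phi> \<in> A \<Longrightarrow> p \<in> fst \<phi> \<Longrightarrow> chart_inv \<phi> (snd \<phi> p) = p"
  unfolding chart_inv_def by (rule inv_into_f_f[OF chart_inj])

lemma transition_snd: "\<phi> \<in> A \<Longrightarrow> p \<in> fst \<phi> \<Longrightarrow> transition \<phi> \<psi> (snd \<phi> p) = snd \<psi> p"
  by (simp add: transition_def)

lemma transition_ov: "\<phi> \<in> A \<Longrightarrow> x \<in> ov \<phi> \<psi> \<Longrightarrow> transition \<phi> \<psi> x \<in> ov \<psi> \<phi>"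
  by (auto simp: ov_def transition_snd)

lemma transition_compose:
  "\<lbrakk>\<phi> \<in> A; \<psi> \<in> A; x \<in> ov \<phi> \<psi>\<rbrakk> \<Longrightarrow> transition \<psi> \<theta> (transition \<phi> \<psi> x) = transition \<phi> \<theta> x"
  by (auto simp: ov_def transition_snd)

lemma transition_self: "\<phi> \<in> A \<Longrightarrow> x \<in> ov \<phi> \<phi> \<Longrightarrow> transition \<phi> \<phi> x = x"
  by (auto simp: ov_def transition_snd)

lemma snd_ov: "p \<in> fst \<phi> \<Longrightarrow> p \<in> fst \<psi> \<Longrightarrow> snd \<phi> p \<in> ov \<phi> \<psi>"
  by (simp add: ov_def)

lemma linear_fd_transition: "\<lbrakk>\<phi> \<in> A; \<psi> \<in> A; x \<in> ov \<phi> \<psi>\<rbrakk> \<Longrightarrow> linear (fd (transition \<phi> \<psi>) x)"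
  by (rule linear_fd[OF transition_smooth ov_open])

lemma fd_transition_compose:
  assumes "\<phi> \<in> A" "\<psi> \<in> A" "\<theta> \<in> A" "p \<in> fst \<phi>" "p \<in> fst \<psi>" "p \<in> fst \<theta>"
  shows "fd (transition \<psi> \<theta>) (snd \<psi> p) (fd (transition \<phi> \<psi>) (snd \<phi> p) v)
    = fd (transition \<phi> \<theta>) (snd \<phi> p) v"
proof -
  have "fd (transition \<phi> \<theta>) (snd \<phi> p) v = fd (\<lambda>x. transition \<psi> \<theta> (transition \<phi> \<psi> x)) (snd \<phi> p) v"
    by (rule fd_cong[OF ov_open[OF assms(1,2)], THEN fun_cong])
      (simp_all add: snd_ov assms transition_compose)
  also have "\<dots> = fd (transition \<psi> \<theta>) (transition \<phi> \<psi> (snd \<phi> p)) (fd (transition \<phi> \<psi>) (snd \<phi> p) v)"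
    by (rule fd_compose[OF ov_open _ transition_smooth ov_open _ transition_smooth])
      (simp_all add: snd_ov assms transition_snd)
  finally show ?thesis by (simp add: transition_snd assms)
qed

lemma fd_transition_self: "\<phi> \<in> A \<Longrightarrow> p \<in> fst \<phi> \<Longrightarrow> fd (transition \<phi> \<phi>) (snd \<phi> p) v = v"
  using fd_cong[OF ov_open, of \<phi> \<phi> "snd \<phi> p" "transition \<phi> \<phi>" "\<lambda>x. x"]
  by (simp add: snd_ov transition_self)

lemma charts_at_iff: "\<phi> \<in> charts_at A p \<longleftrightarrow> \<phi> \<in> A \<and> p \<in> fst \<phi>"
  by (simp add: charts_at_def)

lemma tangent_transform:
  "\<lbrakk>u \<in> tangent_space A p; \<phi> \<in> A; p \<in> fst \<phi>; \<psi> \<in> A; p \<in> fst \<psi>\<rbrakk> \<Longrightarrow>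
    u \<psi> = fd (transition \<phi> \<psi>) (snd \<phi> p) (u \<phi>)"
  unfolding tangent_space_def charts_at_iff mem_Collect_eq Ball_def by blast

lemma tangent_off_chart: "\<lbrakk>u \<in> tangent_space A p; \<phi> \<notin> charts_at A p\<rbrakk> \<Longrightarrow> u \<phi> = 0"
  unfolding tangent_space_def by blast

lemma tangent_eqI:
  assumes "u \<in> tangent_space A p" "v \<in> tangent_space A p" "\<phi> \<in> A" "p \<in> fst \<phi>" "u \<phi> = v \<phi>"
  shows "u = v"
proof
  fix \<psi>
  show "u \<psi> = v \<psi>"
  proof (cases "\<psi> \<in> charts_at A p")
    case True
    then show ?thesis
      using tangent_transform[OF assms(1,3,4), of \<psi>] tangent_transform[OF assms(2,3,4), of \<psi>] assms(5)
      by (simp add: charts_at_iff)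
  next
    case False
    then show ?thesis using tangent_off_chart[OF assms(1)] tangent_off_chart[OF assms(2)] by metis
  qed
qed

lemma coord_vec_apply:
  "\<lbrakk>\<psi> \<in> A; p \<in> fst \<psi>\<rbrakk> \<Longrightarrow> coord_vec A \<phi> p v \<psi> = fd (transition \<phi> \<psi>) (snd \<phi> p) v"
  by (simp add: coord_vec_def charts_at_iff)

lemma coord_vec_same [simp]: "\<phi> \<in> A \<Longrightarrow> p \<in> fst \<phi> \<Longrightarrow> coord_vec A \<phi> p v \<phi> = v"
  by (simp add: coord_vec_apply fd_transition_self)

lemma coord_vec_tangent: "\<phi> \<in> A \<Longrightarrow> p \<in> fst \<phi> \<Longrightarrow> coord_vec A \<phi> p v \<in> tangent_space A p"
  by (auto simp: tangent_space_def coord_vec_def charts_at_iff fd_transition_compose)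

lemma coord_vec_of_tangent:
  "\<lbrakk>u \<in> tangent_space A p; \<phi> \<in> A; p \<in> fst \<phi>\<rbrakk> \<Longrightarrow> coord_vec A \<phi> p (u \<phi>) = u"
  by (rule tangent_eqI[of _ p _ \<phi>]) (simp_all add: coord_vec_tangent)

lemma lincomb_tangent:
  assumes "u \<in> tangent_space A p" "v \<in> tangent_space A p"
  shows "lincomb a u b v \<in> tangent_space A p"
proof -
  have "lincomb a u b v \<psi> = fd (transition \<phi> \<psi>) (snd \<phi> p) (lincomb a u b v \<phi>)"
    if "\<phi> \<in> charts_at A p" "\<psi> \<in> charts_at A p" for \<phi> \<psi>
    using that linear_fd_transition[of \<phi> \<psi> "snd \<phi> p"] tangent_transform[OF assms(1), of \<phi> \<psi>]
      tangent_transform[OF assms(2), of \<phi> \<psi>]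
    by (simp add: charts_at_iff snd_ov lincomb_def linear_add linear_scale)
  moreover have "lincomb a u b v \<phi> = 0" if "\<phi> \<notin> charts_at A p" for \<phi>
    using tangent_off_chart[OF assms(1) that] tangent_off_chart[OF assms(2) that]
    by (simp add: lincomb_def)
  ultimately show ?thesis unfolding tangent_space_def by blast
qed

lemma coord_vec_lincomb:
  "\<phi> \<in> A \<Longrightarrow> p \<in> fst \<phi> \<Longrightarrow>
    lincomb a (coord_vec A \<phi> p v) b (coord_vec A \<phi> p w) = coord_vec A \<phi> p (a *\<^sub>R v + b *\<^sub>R w)"
  by (rule tangent_eqI[of _ p _ \<phi>]) (auto intro!: lincomb_tangent coord_vec_tangent, simp add: lincomb_def)

lemma coord_vec_change:
  "\<lbrakk>\<phi> \<in> A; p \<in> fst \<phi>; \<psi> \<in> A; p \<in> fst \<psi>\<rbrakk> \<Longrightarrow>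
    coord_vec A \<psi> p (fd (transition \<phi> \<psi>) (snd \<phi> p) v) = coord_vec A \<phi> p v"
  by (rule tangent_eqI[of _ p _ \<psi>]) (simp_all add: coord_vec_tangent coord_vec_apply)

lemma chart_at_charts:
  assumes "p \<in> carrier_of A"
  shows "chart_at A p \<in> A" "p \<in> fst (chart_at A p)"
proof -
  have "\<exists>\<phi>. \<phi> \<in> charts_at A p" using assms by (auto simp: carrier_of_def charts_at_iff)
  then have "chart_at A p \<in> charts_at A p" unfolding chart_at_def by (rule someI_ex)
  then show "chart_at A p \<in> A" "p \<in> fst (chart_at A p)" by (simp_all add: charts_at_iff)
qed

lemma open_subchart: "openin (atlas_topology A) W \<Longrightarrow> \<phi> \<in> A \<Longrightarrow> open (snd \<phi> ` (W \<inter> fst \<phi>))"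
  by (simp add: openin_iff)

lemma openin_subset_chart:
  assumes \<phi>: "\<phi> \<in> A" and W: "W \<subseteq> fst \<phi>" "open (snd \<phi> ` W)"
  shows "openin (atlas_topology A) W"
  unfolding openin_iff
proof (intro conjI ballI)
  show "W \<subseteq> carrier_of A" using W(1) \<phi> by (auto simp: carrier_of_def)
  fix \<psi> assume \<psi>: "\<psi> \<in> A"
  have "snd \<psi> ` (W \<inter> fst \<psi>) = transition \<psi> \<phi> -` (snd \<phi> ` W) \<inter> ov \<psi> \<phi>"
  proof
    show "snd \<psi> ` (W \<inter> fst \<psi>) \<subseteq> transition \<psi> \<phi> -` (snd \<phi> ` W) \<inter> ov \<psi> \<phi>"
      using W(1) \<psi> by (auto simp: ov_def transition_snd)
    show "transition \<psi> \<phi> -` (snd \<phi> ` W) \<inter> ov \<psi> \<phi> \<subseteq> snd \<psi> ` (W \<inter> fst \<psi>)"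
    proof
      fix x assume x: "x \<in> transition \<psi> \<phi> -` (snd \<phi> ` W) \<inter> ov \<psi> \<phi>"
      then obtain p where p: "p \<in> fst \<psi>" "p \<in> fst \<phi>" "x = snd \<psi> p" by (auto simp: ov_def)
      with x \<psi> have "snd \<phi> p \<in> snd \<phi> ` W" by (simp add: transition_snd)
      then have "p \<in> W" using chart_inj[OF \<phi>] p(2) W(1) by (auto simp: inj_on_def)
      with p show "x \<in> snd \<psi> ` (W \<inter> fst \<psi>)" by blast
    qed
  qed
  moreover have "open (transition \<psi> \<phi> -` (snd \<phi> ` W) \<inter> ov \<psi> \<phi>)"
    using continuous_on_open_vimage[OF ov_open[OF \<psi> \<phi>], of "transition \<psi> \<phi>"]
      smooth_on_continuous_on[OF transition_smooth[OF \<psi> \<phi>]] W(2) by blast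
  ultimately show "open (snd \<psi> ` (W \<inter> fst \<psi>))" by simp
qed

lemma openin_chart_domain: "\<phi> \<in> A \<Longrightarrow> openin (atlas_topology A) (fst \<phi>)"
  using openin_subset_chart[of \<phi> "fst \<phi>"] chart_image_open[of \<phi>] by simp

lemma smooth_on_change_chart:
  assumes \<phi>: "\<phi> \<in> A" and \<psi>: "\<psi> \<in> A" and W: "W \<subseteq> fst \<phi>"
    and f: "smooth_on (snd \<phi> ` W) (\<lambda>x. f (chart_inv \<phi> x))"
  shows "smooth_on (snd \<psi> ` (W \<inter> fst \<psi>)) (\<lambda>x. f (chart_inv \<psi> x))"
proof -
  have sub: "snd \<psi> ` (W \<inter> fst \<psi>) \<subseteq> ov \<psi> \<phi>" using W by (auto simp: ov_def)
  have "smooth_on (snd \<psi> ` (W \<inter> fst \<psi>)) (\<lambda>x. f (chart_inv \<phi> (transition \<psi> \<phi> x)))"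
    by (rule smooth_on_compose[OF f smooth_on_subset[OF transition_smooth[OF \<psi> \<phi>] sub]])
      (use W \<psi> in \<open>auto simp: transition_snd\<close>)
  then show ?thesis
    by (rule smooth_on_cong) (use W \<phi> \<psi> in \<open>auto simp: transition_snd\<close>)
qed

lemma smooth_funI:
  assumes "\<phi> \<in> A" "W \<subseteq> fst \<phi>" "smooth_on (snd \<phi> ` W) (\<lambda>x. f (chart_inv \<phi> x))"
  shows "smooth_fun A W f"
  unfolding smooth_fun_def using smooth_on_change_chart[OF assms(1) _ assms(2,3)] by (simp add: o_def)

lemma smooth_fields_tangent: "X \<in> smooth_fields A W \<Longrightarrow> p \<in> W \<Longrightarrow> X p \<in> tangent_space A p"
  by (simp add: smooth_fields_def)

lemma smooth_fields_smooth:
  "X \<in> smooth_fields A W \<Longrightarrow> \<phi> \<in> A \<Longrightarrow> smooth_on (snd \<phi> ` (W \<inter> fst \<phi>)) (\<lambda>x. X (chart_inv \<phi> x) \<phi>)"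
  by (simp add: smooth_fields_def)

lemma smooth_fields_subset: "X \<in> smooth_fields A W \<Longrightarrow> W' \<subseteq> W \<Longrightarrow> X \<in> smooth_fields A W'"
  unfolding smooth_fields_def
  by (auto elim!: smooth_on_subset intro!: image_mono)

text \<open>Smoothness needs checking only in one chart that contains the set: in any other chart
  the components arise by applying the Jacobian, which depends smoothly on the point.\<close>

lemma smooth_fieldsI:
  assumes \<phi>: "\<phi> \<in> A" and W: "W \<subseteq> fst \<phi>" and t: "\<And>p. p \<in> W \<Longrightarrow> X p \<in> tangent_space A p"
    and s: "smooth_on (snd \<phi> ` W) (\<lambda>x. X (chart_inv \<phi> x) \<phi>)"
  shows "X \<in> smooth_fields A W"
proof -
  have "smooth_on (snd \<psi> ` (W \<inter> fst \<psi>)) (\<lambda>x. X (chart_inv \<psi> x) \<psi>)" if \<psi>: "\<psi> \<in> A" for \<psi>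
  proof -
    have sub: "snd \<psi> ` (W \<inter> fst \<psi>) \<subseteq> ov \<psi> \<phi>" using W by (auto simp: ov_def)
    have "smooth_on (snd \<psi> ` (W \<inter> fst \<psi>)) (\<lambda>x. fd (transition \<phi> \<psi>) (transition \<psi> \<phi> x) (X (chart_inv \<psi> x) \<phi>))"
    proof (rule smooth_on_linear_family[of _ "\<lambda>x. fd (transition \<phi> \<psi>) (transition \<psi> \<phi> x)"
          "\<lambda>x. X (chart_inv \<psi> x) \<phi>"])
      show "smooth_on (snd \<psi> ` (W \<inter> fst \<psi>)) (\<lambda>x. X (chart_inv \<psi> x) \<phi>)"
        by (rule smooth_on_change_chart[OF \<phi> \<psi> W s])
      show "smooth_on (snd \<psi> ` (W \<inter> fst \<psi>)) (\<lambda>x. fd (transition \<phi> \<psi>) (transition \<psi> \<phi> x) b)" for b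
        by (rule smooth_on_compose[OF smooth_on_fd[OF transition_smooth[OF \<phi> \<psi>] ov_open[OF \<phi> \<psi>]]
              smooth_on_subset[OF transition_smooth[OF \<psi> \<phi>] sub]])
          (use sub transition_ov[OF \<psi>] in blast)
      show "linear (fd (transition \<phi> \<psi>) (transition \<psi> \<phi> x))" if "x \<in> snd \<psi> ` (W \<inter> fst \<psi>)" for x
        by (rule linear_fd_transition[OF \<phi> \<psi>]) (use that sub transition_ov[OF \<psi>] in blast)
    qed
    then show ?thesis
    proof (rule smooth_on_cong)
      fix x assume "x \<in> snd \<psi> ` (W \<inter> fst \<psi>)"
      then obtain p where p: "p \<in> W" "p \<in> fst \<psi>" "x = snd \<psi> p" by blast
      with W have p': "p \<in> fst \<phi>" by blast
      from tangent_transform[OF t[OF p(1)] \<phi> p' \<psi> p(2)]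
      show "fd (transition \<phi> \<psi>) (transition \<psi> \<phi> x) (X (chart_inv \<psi> x) \<phi>) = X (chart_inv \<psi> x) \<psi>"
        using p \<psi> by (simp add: transition_snd)
    qed
  qed
  with t show ?thesis by (simp add: smooth_fields_def)
qed

lemma coord_field_smooth: "\<phi> \<in> A \<Longrightarrow> coord_field A \<phi> v \<in> smooth_fields A (fst \<phi>)"
proof -
  assume \<phi>: "\<phi> \<in> A"
  have *: "smooth_on (snd \<phi> ` fst \<phi>) (\<lambda>x. coord_field A \<phi> v (chart_inv \<phi> x) \<phi>)"
    by (rule smooth_on_cong[OF smooth_on_const[of _ v]]) (use \<phi> in \<open>auto simp: coord_field_def\<close>)
  show ?thesis
    by (rule smooth_fieldsI[where X = "coord_field A \<phi> v", OF \<phi> order_refl _ *]) (simp add: coord_field_def coord_vec_tangent \<phi>)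
qed

lemma lie_bracket_apply:
  "\<phi> \<in> A \<Longrightarrow> p \<in> fst \<phi> \<Longrightarrow> lie_bracket A X Y p \<phi> =
    fd (\<lambda>x. Y (chart_inv \<phi> x) \<phi>) (snd \<phi> p) (X p \<phi>) - fd (\<lambda>x. X (chart_inv \<phi> x) \<phi>) (snd \<phi> p) (Y p \<phi>)"
  by (simp add: lie_bracket_def charts_at_iff)

lemma field_transform:
  assumes "Y \<in> smooth_fields A W" "\<phi> \<in> A" "\<psi> \<in> A" "p \<in> W" "p \<in> fst \<phi>" "p \<in> fst \<psi>"
  shows "Y (chart_inv \<psi> (transition \<phi> \<psi> (snd \<phi> p))) \<psi>
    = fd (transition \<phi> \<psi>) (snd \<phi> p) (Y (chart_inv \<phi> (snd \<phi> p)) \<phi>)"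
  using tangent_transform[OF smooth_fields_tangent[OF assms(1,4)] assms(2,5,3,6)] assms
  by (simp add: transition_snd)

end

section \<open>The Levi-Civita connection and the curvature of a Riemannian manifold\<close>

locale riemannian_atlas = charted A
  for A :: "('p, 'e::euclidean_space) atlas" +
  fixes g :: "('p, 'e) bilin"
  assumes riemannian: "riemannian_metric A g"
begin

definition gl :: "('p, 'e) chart \<Rightarrow> 'e \<Rightarrow> 'e \<Rightarrow> 'e \<Rightarrow> real" where
  "gl \<phi> x v w = g (chart_inv \<phi> x) (coord_vec A \<phi> (chart_inv \<phi> x) v) (coord_vec A \<phi> (chart_inv \<phi> x) w)"

abbreviation chr :: "('p, 'e) chart \<Rightarrow> 'e \<Rightarrow> 'e \<Rightarrow> 'e \<Rightarrow> 'e" where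
  "chr \<phi> \<equiv> local_metric.chris (gl \<phi>)"

abbreviation loc :: "('p, 'e) chart \<Rightarrow> ('p, 'e) field \<Rightarrow> 'e \<Rightarrow> 'e" where
  "loc \<phi> X \<equiv> (\<lambda>x. X (chart_inv \<phi> x) \<phi>)"

lemma g_sym_bilinear: "p \<in> carrier_of A \<Longrightarrow> sym_bilinear_on (tangent_space A p) (g p)"
  using riemannian unfolding riemannian_metric_def by blast

lemma g_tangent:
  "\<lbrakk>\<phi> \<in> A; p \<in> fst \<phi>; u \<in> tangent_space A p; v \<in> tangent_space A p\<rbrakk> \<Longrightarrow>
    g p u v = gl \<phi> (snd \<phi> p) (u \<phi>) (v \<phi>)"
  by (simp add: gl_def coord_vec_of_tangent)

lemma gl_smooth: "\<phi> \<in> A \<Longrightarrow> smooth_on (snd \<phi> ` fst \<phi>) (\<lambda>x. gl \<phi> x v w)"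
proof -
  assume \<phi>: "\<phi> \<in> A"
  then have "smooth_fun A (fst \<phi>) (\<lambda>p. g p (coord_vec A \<phi> p v) (coord_vec A \<phi> p w))"
    using riemannian unfolding riemannian_metric_def by blast
  then have "smooth_on (snd \<phi> ` (fst \<phi> \<inter> fst \<phi>)) ((\<lambda>p. g p (coord_vec A \<phi> p v) (coord_vec A \<phi> p w)) \<circ> chart_inv \<phi>)"
    using \<phi> unfolding smooth_fun_def by blast
  then show ?thesis by (simp add: gl_def o_def)
qed

lemma local_metric_gl: "\<phi> \<in> A \<Longrightarrow> local_metric (snd \<phi> ` fst \<phi>) (gl \<phi>)"
proof -
  assume \<phi>: "\<phi> \<in> A"
  have *: "(\<forall>v w. gl \<phi> x v w = gl \<phi> x w v) \<and> (\<forall>v. linear (gl \<phi> x v)) \<and> (\<forall>v. v \<noteq> 0 \<longrightarrow> gl \<phi> x v v > 0)"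
    if x: "x \<in> snd \<phi> ` fst \<phi>" for x
  proof (intro conjI allI impI)
    obtain p where p: "p \<in> fst \<phi>" "x = snd \<phi> p" using x by blast
    have pc: "p \<in> carrier_of A" using p \<phi> by (auto simp: carrier_of_def)
    note sb = g_sym_bilinear[OF pc, unfolded sym_bilinear_on_def]
    note tg = coord_vec_tangent[OF \<phi> p(1)]
    have gx: "gl \<phi> x v w = g p (coord_vec A \<phi> p v) (coord_vec A \<phi> p w)" for v w
      using p \<phi> by (simp add: gl_def)
    show sym: "gl \<phi> x v w = gl \<phi> x w v" for v w
      unfolding gx using sb tg by blast
    have comb: "gl \<phi> x (a *\<^sub>R u + b *\<^sub>R v) w = a * gl \<phi> x u w + b * gl \<phi> x v w" for a b u v w
      unfolding gx coord_vec_lincomb[OF \<phi> p(1), symmetric] using sb tg by blast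
    show "linear (gl \<phi> x v)" for v
    proof (rule linearI)
      show "gl \<phi> x v (u + w) = gl \<phi> x v u + gl \<phi> x v w" for u w
        using comb[of 1 u 1 w v] sym[of v] by simp
      show "gl \<phi> x v (r *\<^sub>R u) = r *\<^sub>R gl \<phi> x v u" for r u
        using comb[of r u 0 u v] sym[of v] by simp
    qed
    fix v :: 'e assume "v \<noteq> 0"
    then have "coord_vec A \<phi> p v \<noteq> (\<lambda>_. 0)" using coord_vec_same[OF \<phi> p(1), of v] by auto
    then show "gl \<phi> x v v > 0"
      unfolding gx using riemannian pc tg unfolding riemannian_metric_def by blast
  qed
  show ?thesis
    by (rule local_metric.intro) (use chart_image_open[OF \<phi>] gl_smooth[OF \<phi>] * in blast)+
qed

lemma gl_transform:
  assumes "\<phi> \<in> A" "\<psi> \<in> A" "x \<in> ov \<phi> \<psi>"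
  shows "gl \<phi> x v w = gl \<psi> (transition \<phi> \<psi> x) (fd (transition \<phi> \<psi>) x v) (fd (transition \<phi> \<psi>) x w)"
proof -
  obtain p where "p \<in> fst \<phi>" "p \<in> fst \<psi>" "x = snd \<phi> p" using assms(3) by (auto simp: ov_def)
  with assms show ?thesis by (simp add: gl_def transition_snd coord_vec_change)
qed

text \<open>
  The pullback to the chart \<open>\<phi>\<close> of the connection of the chart \<open>\<psi>\<close> is torsion-free by the symmetry of second
  derivatives, and metric; so it is the connection of \<open>\<phi>\<close>.
\<close>

lemma chr_transform:
  assumes \<phi>: "\<phi> \<in> A" and \<psi>: "\<psi> \<in> A" and x: "x \<in> ov \<phi> \<psi>"
  defines "T \<equiv> transition \<phi> \<psi>"
  shows "fd T x (chr \<phi> x u v) = fd (\<lambda>z. fd T z v) x u + chr \<psi> (T x) (fd T x u) (fd T x v)"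
proof -
  interpret F: local_metric "snd \<phi> ` fst \<phi>" "gl \<phi>" by (rule local_metric_gl[OF \<phi>])
  have T: "smooth_on (ov \<phi> \<psi>) T" "open (ov \<phi> \<psi>)"
    unfolding T_def by (simp_all add: transition_smooth ov_open \<phi> \<psi>)
  have xU: "x \<in> snd \<phi> ` fst \<phi>" using x by (auto simp: ov_def)
  interpret Q: pulled_back_metric "snd \<psi> ` fst \<psi>" "gl \<psi>" "ov \<phi> \<psi>" T
  proof -
    have "T ` ov \<phi> \<psi> \<subseteq> snd \<psi> ` fst \<psi>"
      using transition_ov[OF \<phi>, of _ \<psi>] unfolding T_def by (auto simp: ov_def)
    then show "pulled_back_metric (snd \<psi> ` fst \<psi>) (gl \<psi>) (ov \<phi> \<psi>) T"
      using local_metric_gl[OF \<psi>] T by (simp add: pulled_back_metric_def pulled_back_metric_axioms_def)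
  qed
  \<comment> \<open>The inverse Jacobian. \<open>C\<close> below differentiates the push-forward of
    a constant field with the connection of \<psi> and carries the result back to \<phi>.\<close>
  define S where "S = fd (transition \<psi> \<phi>) (T x)"
  obtain p where p: "p \<in> fst \<phi>" "p \<in> fst \<psi>" "x = snd \<phi> p" using x by (auto simp: ov_def)
  have TS: "fd T x (S w) = w" for w
    unfolding S_def T_def p(3) transition_snd[OF \<phi> p(1)]
    using fd_transition_compose[OF \<psi> \<phi> \<psi> p(2,1,2), of w] fd_transition_self[OF \<psi> p(2)] by simp
  define C where "C u v = S (Q.cov (\<lambda>z. fd T z v) u x)" for u v
  have fT: "smooth_on (ov \<phi> \<psi>) (\<lambda>z. fd T z v)" for v by (rule smooth_on_fd[OF T])
  have "C u v = chr \<phi> x u v"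
  proof (rule F.chris_eqI[OF xU])
    show "C u v = C v u" for u v
      unfolding C_def Q.cov_def
      using second_derivative_symmetric[OF T x, of v u] Q.chris_sym[OF Q.P_mem[OF x]] by simp
    show "fd (\<lambda>x. gl \<phi> x v w) x u = gl \<phi> x (C u v) w + gl \<phi> x v (C u w)" for u v w
    proof -
      have "fd (\<lambda>x. gl \<phi> x v w) x u = fd (\<lambda>z. gl \<psi> (T z) (fd T z v) (fd T z w)) x u"
        unfolding T_def by (intro fd_cong[OF ov_open[OF \<phi> \<psi>] x, THEN fun_cong] gl_transform \<phi> \<psi>)
      also have "\<dots> = gl \<psi> (T x) (fd T x (C u v)) (fd T x w) + gl \<psi> (T x) (fd T x v) (fd T x (C u w))"
        by (simp add: Q.cov_metric[OF x fT fT] C_def TS)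
      also have "\<dots> = gl \<phi> x (C u v) w + gl \<phi> x v (C u w)"
        unfolding T_def by (simp add: gl_transform[OF \<phi> \<psi> x])
      finally show ?thesis .
    qed
  qed
  then show ?thesis using TS[of "Q.cov (\<lambda>z. fd T z v) u x"] unfolding C_def Q.cov_def by simp
qed

text \<open>A concrete connection, to be compared with the chosen one. The value 0 at charts away
  from \<open>p\<close> follows the convention for tangent vectors.\<close>

definition nabla :: "('p, 'e) connection" where
  "nabla X Y p = (\<lambda>\<phi>. if \<phi> \<in> charts_at A p
     then fd (loc \<phi> Y) (snd \<phi> p) (X p \<phi>) + chr \<phi> (snd \<phi> p) (X p \<phi>) (Y p \<phi>) else 0)"

lemma nabla_apply:
  "\<phi> \<in> A \<Longrightarrow> p \<in> fst \<phi> \<Longrightarrow>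
    nabla X Y p \<phi> = fd (loc \<phi> Y) (snd \<phi> p) (X p \<phi>) + chr \<phi> (snd \<phi> p) (X p \<phi>) (Y p \<phi>)"
  by (simp add: nabla_def charts_at_iff)

text \<open>The derivative of the components and the Christoffel term both deviate from the
  transformation law by the second derivative of the transition map. By \<open>chr_transform\<close>
  the two deviations have opposite signs.\<close>

lemma nabla_tangent:
  assumes W: "openin (atlas_topology A) W" "p \<in> W"
    and X: "X \<in> smooth_fields A W" and Y: "Y \<in> smooth_fields A W"
  shows "nabla X Y p \<in> tangent_space A p"
proof -
  have "nabla X Y p \<psi> = fd (transition \<phi> \<psi>) (snd \<phi> p) (nabla X Y p \<phi>)"
    if \<phi>: "\<phi> \<in> A" "p \<in> fst \<phi>" and \<psi>: "\<psi> \<in> A" "p \<in> fst \<psi>" for \<phi> \<psi>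
  proof -
    define T where "T = transition \<phi> \<psi>"
    define x where "x = snd \<phi> p"
    define u where "u = X p \<phi>"
    have xo: "x \<in> ov \<phi> \<psi>" unfolding x_def using \<phi> \<psi> by (simp add: snd_ov)
    have Tx: "T x = snd \<psi> p" unfolding T_def x_def by (rule transition_snd[OF \<phi>])
    have Tu: "X p \<psi> = fd T x u" "Y p \<psi> = fd T x (Y p \<phi>)"
      unfolding T_def x_def u_def
      by (rule tangent_transform[OF smooth_fields_tangent[OF _ W(2)] \<phi> \<psi>], fact)+
    define O' where "O' = snd \<phi> ` (W \<inter> fst \<phi>) \<inter> ov \<phi> \<psi>"
    have O': "open O'" "x \<in> O'" "O' \<subseteq> ov \<phi> \<psi>" "O' \<subseteq> snd \<phi> ` (W \<inter> fst \<phi>)"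
      using open_subchart[OF W(1) \<phi>(1)] ov_open[OF \<phi>(1) \<psi>(1)] xo W(2) \<phi>
      by (auto simp: O'_def x_def)
    have O'e: "\<exists>q. q \<in> W \<and> q \<in> fst \<phi> \<and> q \<in> fst \<psi> \<and> z = snd \<phi> q" if "z \<in> O'" for z
      using that chart_inj[OF \<phi>(1)] unfolding O'_def ov_def inj_on_def by blast
    have Yx: "loc \<phi> Y x = Y p \<phi>" by (simp add: x_def \<phi>)
    have Ts: "smooth_on O' T" unfolding T_def
      by (rule smooth_on_subset[OF transition_smooth[OF \<phi>(1) \<psi>(1)] O'(3)])
    have Yl: "smooth_on O' (loc \<phi> Y)" by (rule smooth_on_subset[OF smooth_fields_smooth[OF Y \<phi>(1)] O'(4)])
    have "fd (loc \<psi> Y) (T x) (fd T x u) = fd (\<lambda>z. loc \<psi> Y (T z)) x u"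
      by (rule fd_compose[OF O'(1,2) Ts open_subchart[OF W(1) \<psi>(1)] _ smooth_fields_smooth[OF Y \<psi>(1)], symmetric])
        (use Tx W(2) \<psi> in auto)
    also have "\<dots> = fd (\<lambda>z. fd T z (loc \<phi> Y z)) x u"
    proof (rule fd_cong[OF O'(1,2), THEN fun_cong])
      fix z assume "z \<in> O'"
      then obtain q where "q \<in> W" "q \<in> fst \<phi>" "q \<in> fst \<psi>" "z = snd \<phi> q" using O'e by blast
      with field_transform[OF Y \<phi>(1) \<psi>(1)] show "loc \<psi> Y (T z) = fd T z (loc \<phi> Y z)"
        unfolding T_def by blast
    qed
    also have "\<dots> = fd (\<lambda>z. fd T z (loc \<phi> Y x)) x u + fd T x (fd (loc \<phi> Y) x u)"
      by (rule fd_linear_family[OF O'(1,2) linear_fd[OF Ts O'(1)] smooth_on_fd[OF Ts O'(1)] Yl])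
    finally have "nabla X Y p \<psi> = fd (\<lambda>z. fd T z (Y p \<phi>)) x u + fd T x (fd (loc \<phi> Y) x u)
        + chr \<psi> (T x) (fd T x u) (fd T x (Y p \<phi>))"
      by (simp only: nabla_apply[OF \<psi>] Tu Tx[symmetric] Yx)
    moreover have "fd T x (chr \<phi> x u (Y p \<phi>)) = fd (\<lambda>z. fd T z (Y p \<phi>)) x u + chr \<psi> (T x) (fd T x u) (fd T x (Y p \<phi>))"
      unfolding T_def by (rule chr_transform[OF \<phi>(1) \<psi>(1) xo])
    moreover have "linear (fd T x)" by (rule linear_fd[OF Ts O'(1,2)])
    ultimately show ?thesis
      by (simp add: nabla_apply[OF \<phi>] linear_add x_def[symmetric] T_def[symmetric] u_def[symmetric])
  qed
  then show ?thesis by (auto simp: tangent_space_def charts_at_iff) (simp add: nabla_def charts_at_iff)+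
qed

lemma nabla_smooth:
  assumes W: "openin (atlas_topology A) W"
    and X: "X \<in> smooth_fields A W" and Y: "Y \<in> smooth_fields A W"
  shows "nabla X Y \<in> smooth_fields A W"
proof -
  have "smooth_on (snd \<phi> ` (W \<inter> fst \<phi>)) (loc \<phi> (nabla X Y))" if \<phi>: "\<phi> \<in> A" for \<phi>
  proof -
    interpret local_metric "snd \<phi> ` fst \<phi>" "gl \<phi>" by (rule local_metric_gl[OF \<phi>])
    let ?V = "snd \<phi> ` (W \<inter> fst \<phi>)"
    have o: "open ?V" by (rule open_subchart[OF W \<phi>])
    note Xs = smooth_fields_smooth[OF X \<phi>] and Ys = smooth_fields_smooth[OF Y \<phi>]
    have "smooth_on ?V (\<lambda>x. fd (loc \<phi> Y) x (loc \<phi> X x))"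
      by (rule smooth_on_linear_family[OF linear_fd[OF Ys o] smooth_on_fd[OF Ys o] Xs])
    then have "smooth_on ?V (\<lambda>x. fd (loc \<phi> Y) x (loc \<phi> X x) + chris x (loc \<phi> X x) (loc \<phi> Y x))"
      by (intro smooth_intros smooth_on_chris Xs Ys) auto
    then show ?thesis
      by (rule smooth_on_cong) (use \<phi> in \<open>auto simp: nabla_apply\<close>)
  qed
  then show ?thesis
    using nabla_tangent[OF W _ X Y] by (simp add: smooth_fields_def)
qed

lemma metric_along:
  assumes W: "openin (atlas_topology A) W" and p: "p \<in> W" and \<phi>: "\<phi> \<in> A" "p \<in> fst \<phi>"
    and Y: "Y \<in> smooth_fields A W" and Z: "Z \<in> smooth_fields A W"
  shows "fd ((\<lambda>q. g q (Y q) (Z q)) \<circ> chart_inv \<phi>) (snd \<phi> p) u =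
    fd (\<lambda>x. gl \<phi> x (loc \<phi> Y x) (loc \<phi> Z x)) (snd \<phi> p) u"
proof (rule fd_cong[OF open_subchart[OF W \<phi>(1)], THEN fun_cong])
  fix z assume "z \<in> snd \<phi> ` (W \<inter> fst \<phi>)"
  then obtain q where q: "q \<in> W" "q \<in> fst \<phi>" "z = snd \<phi> q" by blast
  then show "((\<lambda>q. g q (Y q) (Z q)) \<circ> chart_inv \<phi>) z = gl \<phi> z (loc \<phi> Y z) (loc \<phi> Z z)"
    using g_tangent[OF \<phi>(1) q(2) smooth_fields_tangent[OF Y q(1)] smooth_fields_tangent[OF Z q(1)]] \<phi> by simp
qed (use p \<phi> in blast)

lemma pulled_back_sub:
  assumes "openin (atlas_topology A) W" "\<phi> \<in> A"
  shows "pulled_back_metric (snd \<phi> ` fst \<phi>) (gl \<phi>) (snd \<phi> ` (W \<inter> fst \<phi>)) (\<lambda>x. x)"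
  using local_metric_gl[OF assms(2)] open_subchart[OF assms] smooth_on_id
  by (auto simp: pulled_back_metric_def pulled_back_metric_axioms_def)

lemma nabla_metric:
  assumes W: "openin (atlas_topology A) W" "p \<in> W" and X: "X \<in> smooth_fields A W"
    and Y: "Y \<in> smooth_fields A W" and Z: "Z \<in> smooth_fields A W"
  shows "dir_deriv A p (X p) (\<lambda>q. g q (Y q) (Z q)) = g p (nabla X Y p) (Z p) + g p (Y p) (nabla X Z p)"
proof -
  have pc: "p \<in> carrier_of A" using W openin_iff by blast
  define \<phi> where "\<phi> = chart_at A p"
  have \<phi>: "\<phi> \<in> A" "p \<in> fst \<phi>" unfolding \<phi>_def by (rule chart_at_charts[OF pc])+
  interpret pulled_back_metric "snd \<phi> ` fst \<phi>" "gl \<phi>" "snd \<phi> ` (W \<inter> fst \<phi>)" "\<lambda>x. x"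
    by (rule pulled_back_sub[OF W(1) \<phi>(1)])
  have x: "snd \<phi> p \<in> snd \<phi> ` (W \<inter> fst \<phi>)" using W(2) \<phi> by blast
  show ?thesis
    unfolding dir_deriv_def \<phi>_def[symmetric]
    by (simp add: metric_along[OF W \<phi> Y Z] cov_metric[OF x smooth_fields_smooth[OF Y \<phi>(1)]
        smooth_fields_smooth[OF Z \<phi>(1)]] g_tangent[OF \<phi>] nabla_tangent[OF W] X Y Z
        smooth_fields_tangent[OF _ W(2)] nabla_apply[OF \<phi>] cov_def chart_inv_snd[OF \<phi>])
qed

lemma nabla_torsion:
  assumes "p \<in> W" "X \<in> smooth_fields A W" "Y \<in> smooth_fields A W"
  shows "lincomb 1 (nabla X Y p) (-1) (nabla Y X p) = lie_bracket A X Y p"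
proof
  fix \<phi>
  show "lincomb 1 (nabla X Y p) (-1) (nabla Y X p) \<phi> = lie_bracket A X Y p \<phi>"
  proof (cases "\<phi> \<in> charts_at A p")
    case True
    then have \<phi>: "\<phi> \<in> A" "p \<in> fst \<phi>" by (simp_all add: charts_at_iff)
    interpret local_metric "snd \<phi> ` fst \<phi>" "gl \<phi>" by (rule local_metric_gl[OF \<phi>(1)])
    show ?thesis
      using chris_sym[of "snd \<phi> p" "X p \<phi>" "Y p \<phi>"] \<phi>
      by (simp add: lincomb_def nabla_apply lie_bracket_apply)
  qed (simp add: lincomb_def nabla_def lie_bracket_def)
qed

lemma nabla_affine: "affine_connection A nabla"
  unfolding affine_connection_def
proof (intro allI impI ballI conjI)
  fix W X Y assume W: "openin (atlas_topology A) W"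
    and X: "X \<in> smooth_fields A W" and Y: "Y \<in> smooth_fields A W"
  show "nabla X Y \<in> smooth_fields A W" by (rule nabla_smooth[OF W X Y])
  fix p assume p: "p \<in> W"
  have pc: "p \<in> carrier_of A" using W p openin_iff by blast
  have lf: "linear (fd (loc \<phi> Z) (snd \<phi> p))" if "\<phi> \<in> A" "p \<in> fst \<phi>" "Z \<in> smooth_fields A W" for \<phi> Z
    using linear_fd[OF smooth_fields_smooth[OF that(3,1)] open_subchart[OF W that(1)]] p that by blast
  have lc: "linear (chr \<phi> (snd \<phi> p) u)" "linear (\<lambda>u. chr \<phi> (snd \<phi> p) u v)"
    if "\<phi> \<in> A" "p \<in> fst \<phi>" for \<phi> u v
    using local_metric.linear_chris[OF local_metric_gl[OF that(1)]]
      local_metric.linear_chris_left[OF local_metric_gl[OF that(1)]] that by blast+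
  have mem: "snd \<phi> p \<in> snd \<phi> ` (W \<inter> fst \<phi>)" if "\<phi> \<in> A" "p \<in> fst \<phi>" for \<phi>
    using p that by blast
  show "nabla (\<lambda>q. lincomb 1 (X q) 1 (Z q)) Y p = lincomb 1 (nabla X Y p) 1 (nabla Z Y p)"
    if "Z \<in> smooth_fields A W" for Z
  proof
    fix \<phi>
    show "nabla (\<lambda>q. lincomb 1 (X q) 1 (Z q)) Y p \<phi> = lincomb 1 (nabla X Y p) 1 (nabla Z Y p) \<phi>"
      using linear_add[OF lf[of \<phi> Y]] linear_add[OF lc(2)[of \<phi>]] Y
      by (auto simp: nabla_def lincomb_def charts_at_iff)
  qed
  show "nabla X (\<lambda>q. lincomb 1 (Y q) 1 (Z q)) p = lincomb 1 (nabla X Y p) 1 (nabla X Z p)"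
    if Z: "Z \<in> smooth_fields A W" for Z
  proof
    fix \<phi>
    show "nabla X (\<lambda>q. lincomb 1 (Y q) 1 (Z q)) p \<phi> = lincomb 1 (nabla X Y p) 1 (nabla X Z p) \<phi>"
    proof (cases "\<phi> \<in> charts_at A p")
      case True
      then have \<phi>: "\<phi> \<in> A" "p \<in> fst \<phi>" by (simp_all add: charts_at_iff)
      have "fd (\<lambda>x. loc \<phi> Y x + loc \<phi> Z x) (snd \<phi> p) u = fd (loc \<phi> Y) (snd \<phi> p) u + fd (loc \<phi> Z) (snd \<phi> p) u" for u
        by (rule fd_add[OF open_subchart[OF W \<phi>(1)] mem[OF \<phi>] smooth_fields_smooth[OF Y \<phi>(1)] smooth_fields_smooth[OF Z \<phi>(1)]])
      then show ?thesis using linear_add[OF lc(1)[OF \<phi>]] by (simp add: nabla_apply[OF \<phi>] lincomb_def)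
    qed (simp add: nabla_def lincomb_def)
  qed
  fix f assume f: "smooth_fun A W f"
  show "nabla (\<lambda>q \<phi>. f q *\<^sub>R X q \<phi>) Y p = (\<lambda>\<phi>. f p *\<^sub>R nabla X Y p \<phi>)"
  proof
    fix \<phi>
    show "nabla (\<lambda>q \<phi>. f q *\<^sub>R X q \<phi>) Y p \<phi> = f p *\<^sub>R nabla X Y p \<phi>"
      using linear_scale[OF lf[of \<phi> Y]] linear_scale[OF lc(2)[of \<phi>]] Y
      by (auto simp: nabla_def charts_at_iff scaleR_add_right)
  qed
  have fs: "smooth_on (snd \<phi> ` (W \<inter> fst \<phi>)) (\<lambda>x. f (chart_inv \<phi> x))" if "\<phi> \<in> A" for \<phi>
    using f that by (simp add: smooth_fun_def o_def)
  have leib: "nabla X (\<lambda>q \<phi>. f q *\<^sub>R Y q \<phi>) p \<phi> =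
      fd (\<lambda>x. f (chart_inv \<phi> x)) (snd \<phi> p) (X p \<phi>) *\<^sub>R Y p \<phi> + f p *\<^sub>R nabla X Y p \<phi>"
    if \<phi>: "\<phi> \<in> A" "p \<in> fst \<phi>" for \<phi>
    using fd_scaleR[OF open_subchart[OF W \<phi>(1)] mem[OF \<phi>] fs[OF \<phi>(1)] smooth_fields_smooth[OF Y \<phi>(1)]]
    by (simp add: nabla_apply[OF \<phi>] linear_scale[OF lc(1)[OF \<phi>]] chart_inv_snd[OF \<phi>] scaleR_add_right)
  \<comment> \<open>\<open>dir_deriv\<close> is computed in the chosen chart
    \<open>chart_at A p\<close>, whereas the Leibniz rule is checked in every chart; the derivative
    of a function must therefore be shown independent of the chart.\<close>
  have dd: "fd (\<lambda>x. f (chart_inv \<psi> x)) (snd \<psi> p) (X p \<psi>) = fd (\<lambda>x. f (chart_inv \<phi> x)) (snd \<phi> p) (X p \<phi>)"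
    if \<phi>: "\<phi> \<in> A" "p \<in> fst \<phi>" and \<psi>: "\<psi> \<in> A" "p \<in> fst \<psi>" for \<phi> \<psi>
  proof -
    define O' where "O' = snd \<phi> ` (W \<inter> fst \<phi>) \<inter> ov \<phi> \<psi>"
    have O': "open O'" "snd \<phi> p \<in> O'"
      using open_subchart[OF W \<phi>(1)] ov_open[OF \<phi>(1) \<psi>(1)] p \<phi> \<psi> by (auto simp: O'_def snd_ov)
    have "fd (\<lambda>x. f (chart_inv \<phi> x)) (snd \<phi> p) (X p \<phi>) =
        fd (\<lambda>x. f (chart_inv \<psi> (transition \<phi> \<psi> x))) (snd \<phi> p) (X p \<phi>)"
      by (rule fd_cong[OF O', THEN fun_cong])
        (use \<phi> \<psi> in \<open>auto simp: O'_def ov_def transition_snd\<close>)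
    also have "\<dots> = fd (\<lambda>x. f (chart_inv \<psi> x)) (transition \<phi> \<psi> (snd \<phi> p)) (fd (transition \<phi> \<psi>) (snd \<phi> p) (X p \<phi>))"
      by (rule fd_compose[OF O' smooth_on_subset[OF transition_smooth[OF \<phi>(1) \<psi>(1)]]
            open_subchart[OF W \<psi>(1)] _ fs[OF \<psi>(1)]])
        (use p \<phi> \<psi> in \<open>auto simp: O'_def transition_snd\<close>)
    finally show ?thesis
      using tangent_transform[OF smooth_fields_tangent[OF X p] \<phi> \<psi>] by (simp add: transition_snd \<phi>)
  qed
  show "nabla X (\<lambda>q \<phi>. f q *\<^sub>R Y q \<phi>) p = lincomb (dir_deriv A p (X p) f) (Y p) (f p) (nabla X Y p)"
  proof
    fix \<phi>
    show "nabla X (\<lambda>q \<phi>. f q *\<^sub>R Y q \<phi>) p \<phi> = lincomb (dir_deriv A p (X p) f) (Y p) (f p) (nabla X Y p) \<phi>"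
    proof (cases "\<phi> \<in> charts_at A p")
      case True
      then have \<phi>: "\<phi> \<in> A" "p \<in> fst \<phi>" by (simp_all add: charts_at_iff)
      show ?thesis
        using leib[OF \<phi>] dd[OF \<phi> chart_at_charts[OF pc]] by (simp add: lincomb_def dir_deriv_def o_def)
    next
      case False
      then show ?thesis using tangent_off_chart[OF smooth_fields_tangent[OF Y p]]
        by (simp add: lincomb_def nabla_def)
    qed
  qed
qed

lemma nabla_levi_civita: "is_levi_civita A g nabla"
  unfolding is_levi_civita_def using nabla_affine nabla_torsion nabla_metric by blast

lemma levi_civita_is: "is_levi_civita A g (levi_civita A g)"
  unfolding levi_civita_def by (rule someI[of "is_levi_civita A g", OF nabla_levi_civita])

lemma g_lincomb:
  assumes "p \<in> carrier_of A" "u \<in> tangent_space A p" "v \<in> tangent_space A p" "w \<in> tangent_space A p"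
  shows "g p (lincomb a u b v) w = a * g p u w + b * g p v w"
  using g_sym_bilinear[OF assms(1)] assms unfolding sym_bilinear_on_def by blast

lemma g_commute:
  "\<lbrakk>p \<in> carrier_of A; u \<in> tangent_space A p; v \<in> tangent_space A p\<rbrakk> \<Longrightarrow> g p u v = g p v u"
  using g_sym_bilinear unfolding sym_bilinear_on_def by blast

text \<open>\<open>D\<close> is arbitrary here and does not occur on the right-hand side. Comparing
  the chosen connection with \<open>nabla\<close> thus shows that they agree on smooth
  fields.\<close>

lemma koszul_formula:
  assumes D: "is_levi_civita A g D" and W: "openin (atlas_topology A) W" and p: "p \<in> W"
    and F: "X \<in> smooth_fields A W" "Y \<in> smooth_fields A W" "Z \<in> smooth_fields A W"
  shows "2 * g p (D X Y p) (Z p) =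
    dir_deriv A p (X p) (\<lambda>q. g q (Y q) (Z q)) + dir_deriv A p (Y p) (\<lambda>q. g q (X q) (Z q))
    - dir_deriv A p (Z p) (\<lambda>q. g q (X q) (Y q)) + g p (lie_bracket A X Y p) (Z p)
    - g p (lie_bracket A X Z p) (Y p) - g p (lie_bracket A Y Z p) (X p)"
proof -
  have pc: "p \<in> carrier_of A" using W p openin_iff by blast
  have t: "X p \<in> tangent_space A p" if "X \<in> smooth_fields A W" for X
    using that p by (rule smooth_fields_tangent)
  have tD: "D X Y p \<in> tangent_space A p" if "X \<in> smooth_fields A W" "Y \<in> smooth_fields A W" for X Y
  proof -
    have "D X Y \<in> smooth_fields A W"
      using D W that unfolding is_levi_civita_def affine_connection_def by blast
    then show ?thesis by (rule t)
  qed
  have tor: "lie_bracket A X Y p = lincomb 1 (D X Y p) (-1) (D Y X p)"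
    if "X \<in> smooth_fields A W" "Y \<in> smooth_fields A W" for X Y
  proof -
    have "lincomb 1 (D X Y p) (-1) (D Y X p) = lie_bracket A X Y p"
      using D W p that unfolding is_levi_civita_def by blast
    then show ?thesis by simp
  qed
  have met: "dir_deriv A p (X p) (\<lambda>q. g q (Y q) (Z q)) = g p (D X Y p) (Z p) + g p (Y p) (D X Z p)"
    if "X \<in> smooth_fields A W" "Y \<in> smooth_fields A W" "Z \<in> smooth_fields A W" for X Y Z
    using D W p that unfolding is_levi_civita_def by blast
  show ?thesis
    unfolding met[OF F] met[OF F(2,1,3)] met[OF F(3,1,2)] tor[OF F(1,2)] tor[OF F(1,3)] tor[OF F(2,3)]
    using g_lincomb[OF pc tD[OF F(1,2)] tD[OF F(2,1)] t[OF F(3)], of 1 "-1"]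
      g_lincomb[OF pc tD[OF F(1,3)] tD[OF F(3,1)] t[OF F(2)], of 1 "-1"]
      g_lincomb[OF pc tD[OF F(2,3)] tD[OF F(3,2)] t[OF F(1)], of 1 "-1"]
      g_commute[OF pc t[OF F(2)] tD[OF F(1,3)]] g_commute[OF pc t[OF F(1)] tD[OF F(2,3)]]
      g_commute[OF pc t[OF F(1)] tD[OF F(3,2)]] by linarith
qed

lemma levi_civita_eq:
  assumes W: "openin (atlas_topology A) W" and p: "p \<in> W"
    and X: "X \<in> smooth_fields A W" and Y: "Y \<in> smooth_fields A W"
  shows "levi_civita A g X Y p = nabla X Y p"
proof -
  have pc: "p \<in> carrier_of A" using W p openin_iff by blast
  obtain \<phi> where \<phi>: "\<phi> \<in> A" "p \<in> fst \<phi>" using pc by (auto simp: carrier_of_def)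
  let ?D = "levi_civita A g"
  have "?D X Y \<in> smooth_fields A W"
    using levi_civita_is W X Y unfolding is_levi_civita_def affine_connection_def by blast
  then have t: "?D X Y p \<in> tangent_space A p" "nabla X Y p \<in> tangent_space A p"
    using smooth_fields_tangent p nabla_tangent[OF W p X Y] by blast+
  \<comment> \<open>The coordinate fields used for testing live only on the chart domain. Shrinking
    \<open>W\<close> leaves \<open>levi_civita A g X Y p\<close> itself unchanged, because the open
    set is not an argument of a connection.\<close>
  let ?W = "W \<inter> fst \<phi>"
  have W': "openin (atlas_topology A) ?W" "p \<in> ?W"
    using W openin_chart_domain[OF \<phi>(1)] p \<phi> by auto
  have X': "X \<in> smooth_fields A ?W" "Y \<in> smooth_fields A ?W"
    using smooth_fields_subset X Y by blast+
  have "?D X Y p \<phi> = nabla X Y p \<phi>"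
  proof (rule local_metric.g_eqI[OF local_metric_gl[OF \<phi>(1)]])
    show "snd \<phi> p \<in> snd \<phi> ` fst \<phi>" using \<phi> by blast
    fix v
    have Z: "coord_field A \<phi> v \<in> smooth_fields A ?W"
      using coord_field_smooth[OF \<phi>(1)] smooth_fields_subset by blast
    from koszul_formula[OF levi_civita_is W' X' Z] koszul_formula[OF nabla_levi_civita W' X' Z]
    have "g p (?D X Y p) (coord_field A \<phi> v p) = g p (nabla X Y p) (coord_field A \<phi> v p)" by simp
    then show "gl \<phi> (snd \<phi> p) (?D X Y p \<phi>) v = gl \<phi> (snd \<phi> p) (nabla X Y p \<phi>) v"
      using g_tangent[OF \<phi> t(1) coord_vec_tangent[OF \<phi>], of v] g_tangent[OF \<phi> t(2) coord_vec_tangent[OF \<phi>], of v] \<phi>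
      by (simp add: coord_field_def)
  qed
  then show ?thesis by (rule tangent_eqI[OF t \<phi>])
qed

text \<open>Torsion-freeness writes the bracket as a difference of covariant derivatives, which
  spares a separate transformation law for brackets.\<close>

lemma lie_bracket_smooth:
  assumes W: "openin (atlas_topology A) W"
    and X: "X \<in> smooth_fields A W" and Y: "Y \<in> smooth_fields A W"
  shows "lie_bracket A X Y \<in> smooth_fields A W"
proof -
  note n = nabla_smooth[OF W X Y] nabla_smooth[OF W Y X]
  have e: "lie_bracket A X Y p = lincomb 1 (nabla X Y p) (-1) (nabla Y X p)" if "p \<in> W" for p
    using nabla_torsion[OF that X Y] by simp
  have "smooth_on (snd \<phi> ` (W \<inter> fst \<phi>)) (loc \<phi> (lie_bracket A X Y))" if \<phi>: "\<phi> \<in> A" for \<phi>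
  proof (rule smooth_on_cong)
    show "smooth_on (snd \<phi> ` (W \<inter> fst \<phi>)) (\<lambda>x. loc \<phi> (nabla X Y) x - loc \<phi> (nabla Y X) x)"
      by (intro smooth_intros smooth_fields_smooth[OF _ \<phi>] n)
  qed (use \<phi> in \<open>auto simp: e lincomb_def\<close>)
  then show ?thesis
    using lincomb_tangent smooth_fields_tangent[OF n(1)] smooth_fields_tangent[OF n(2)]
    by (simp add: smooth_fields_def e)
qed

text \<open>This is the tensoriality of curvature: the derivatives of the components of
  \<open>X\<close> and \<open>Y\<close> produce exactly the covariant derivative along the bracket.
  What remains is the commutator for constant directions, namely \<open>riem\<close>.\<close>

lemma curvature_apply:
  assumes W: "openin (atlas_topology A) W" and p: "p \<in> W" and \<phi>: "\<phi> \<in> A" "p \<in> fst \<phi>"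
    and X: "X \<in> smooth_fields A W" and Y: "Y \<in> smooth_fields A W" and Z: "Z \<in> smooth_fields A W"
  shows "curvature A g X Y Z p \<phi> = local_metric.riem (gl \<phi>) (snd \<phi> p) (X p \<phi>) (Y p \<phi>) (Z p \<phi>)"
proof -
  let ?V = "snd \<phi> ` (W \<inter> fst \<phi>)" and ?x = "snd \<phi> p"
  interpret pulled_back_metric "snd \<phi> ` fst \<phi>" "gl \<phi>" ?V "\<lambda>x. x"
    by (rule pulled_back_sub[OF W \<phi>(1)])
  have x: "?x \<in> ?V" using p \<phi> by blast
  note Zs = smooth_fields_smooth[OF Z \<phi>(1)]
  have LC: "levi_civita A g X Y q = nabla X Y q"
    if "q \<in> W" "X \<in> smooth_fields A W" "Y \<in> smooth_fields A W" for q X Y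
    using levi_civita_eq[OF W that] .
  have nc: "loc \<phi> (nabla X Y) z = cov (loc \<phi> Y) (loc \<phi> X z) z" if "z \<in> ?V" for X Y z
    using that \<phi> by (auto simp: nabla_apply cov_def)
  have second: "levi_civita A g X (levi_civita A g Y Z) p \<phi> =
      cov (cov (loc \<phi> Z) (Y p \<phi>)) (X p \<phi>) ?x + cov (loc \<phi> Z) (fd (loc \<phi> Y) ?x (X p \<phi>)) ?x"
    if X: "X \<in> smooth_fields A W" and Y: "Y \<in> smooth_fields A W" for X Y
  proof -
    have DYZ: "levi_civita A g Y Z \<in> smooth_fields A W"
      using levi_civita_is W Y Z unfolding is_levi_civita_def affine_connection_def by blast
    have ev: "loc \<phi> (levi_civita A g Y Z) z = cov (loc \<phi> Z) (loc \<phi> Y z) z" if "z \<in> ?V" for z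
      using that \<phi> nc[OF that, of Y Z] LC[OF _ Y Z] by auto
    have "levi_civita A g X (levi_civita A g Y Z) p \<phi> = cov (loc \<phi> (levi_civita A g Y Z)) (X p \<phi>) ?x"
      using LC[OF p X DYZ] nc[OF x, of X "levi_civita A g Y Z"] \<phi> by simp
    also have "\<dots> = fd (\<lambda>z. cov (loc \<phi> Z) (loc \<phi> Y z) z) ?x (X p \<phi>) + chris ?x (X p \<phi>) (cov (loc \<phi> Z) (Y p \<phi>) ?x)"
      using fd_cong[OF open_V x, of "loc \<phi> (levi_civita A g Y Z)"] ev ev[OF x] \<phi> by (simp add: cov_def)
    also have "fd (\<lambda>z. cov (loc \<phi> Z) (loc \<phi> Y z) z) ?x (X p \<phi>) =
        fd (\<lambda>z. cov (loc \<phi> Z) (loc \<phi> Y ?x) z) ?x (X p \<phi>) + cov (loc \<phi> Z) (fd (loc \<phi> Y) ?x (X p \<phi>)) ?x"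
      by (rule fd_linear_family[OF open_V x linear_cov smooth_on_cov smooth_fields_smooth[OF Y \<phi>(1)]])
        (simp_all add: Zs)
    finally show ?thesis using \<phi> by (simp add: cov_def[of "cov (loc \<phi> Z) (Y p \<phi>)"])
  qed
  have lin: "linear (\<lambda>X. cov (loc \<phi> Z) X ?x)" by (rule linear_cov[OF x Zs])
  have "levi_civita A g (lie_bracket A X Y) Z p \<phi> = cov (loc \<phi> Z) (lie_bracket A X Y p \<phi>) ?x"
    using LC[OF p lie_bracket_smooth[OF W X Y] Z] nc[OF x, of "lie_bracket A X Y" Z] \<phi> by simp
  also have "\<dots> = cov (loc \<phi> Z) (fd (loc \<phi> Y) ?x (X p \<phi>)) ?x - cov (loc \<phi> Z) (fd (loc \<phi> X) ?x (Y p \<phi>)) ?x"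
    unfolding lie_bracket_apply[OF \<phi>] by (rule linear_diff[OF lin])
  finally show ?thesis
    unfolding curvature_def Let_def second[OF X Y] second[OF Y X]
    using cov_commutator[OF x Zs, of "Y p \<phi>" "X p \<phi>"] \<phi> by simp
qed

lemma curvature_tangent:
  assumes W: "openin (atlas_topology A) W" and p: "p \<in> W"
    and X: "X \<in> smooth_fields A W" and Y: "Y \<in> smooth_fields A W" and Z: "Z \<in> smooth_fields A W"
  shows "curvature A g X Y Z p \<in> tangent_space A p"
proof -
  have D: "levi_civita A g X Y \<in> smooth_fields A W"
    if "X \<in> smooth_fields A W" "Y \<in> smooth_fields A W" for X Y
    using levi_civita_is W that unfolding is_levi_civita_def affine_connection_def by blast
  note t = smooth_fields_tangent[OF D p]
  have "curvature A g X Y Z p = lincomb 1 (lincomb 1 (levi_civita A g X (levi_civita A g Y Z) p)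
      (-1) (levi_civita A g Y (levi_civita A g X Z) p)) (-1) (levi_civita A g (lie_bracket A X Y) Z p)"
    by (simp add: curvature_def Let_def lincomb_def fun_eq_iff)
  also have "\<dots> \<in> tangent_space A p"
    by (intro lincomb_tangent t D X Y Z lie_bracket_smooth[OF W])
  finally show ?thesis .
qed

text \<open>The hypothesis is formulated with fields; coordinate fields realise any pair of vectors
  at a given point.\<close>

lemma constant_sectional_curvature_riem:
  assumes "constant_sectional_curvature A g c" "\<phi> \<in> A" "x \<in> snd \<phi> ` fst \<phi>"
  shows "local_metric.riem (gl \<phi>) x u v w = c *\<^sub>R (gl \<phi> x v w *\<^sub>R u - gl \<phi> x u w *\<^sub>R v)"
proof (rule local_metric.riem_constant_curvature[OF local_metric_gl[OF assms(2)] assms(3)])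
  fix u v :: 'e
  assume ind: "\<forall>a b. a *\<^sub>R u + b *\<^sub>R v = 0 \<longrightarrow> a = 0 \<and> b = 0"
  obtain p where p: "p \<in> fst \<phi>" "x = snd \<phi> p" using assms(3) by blast
  note \<phi> = assms(2) p(1)
  let ?X = "coord_field A \<phi> u" and ?Y = "coord_field A \<phi> v"
  have W: "openin (atlas_topology A) (fst \<phi>)" by (rule openin_chart_domain[OF \<phi>(1)])
  have XY: "?X \<in> smooth_fields A (fst \<phi>)" "?Y \<in> smooth_fields A (fst \<phi>)"
    using coord_field_smooth[OF \<phi>(1)] by blast+
  have tX: "?X p \<in> tangent_space A p" "?Y p \<in> tangent_space A p"
    using XY \<phi>(2) smooth_fields_tangent by blast+
  have ap: "?X p \<phi> = u" "?Y p \<phi> = v" by (simp_all add: coord_field_def \<phi>)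
  have "\<forall>a b. lincomb a (?X p) b (?Y p) = (\<lambda>_. 0) \<longrightarrow> a = 0 \<and> b = 0"
  proof (intro allI impI)
    fix a b assume "lincomb a (?X p) b (?Y p) = (\<lambda>_. 0)"
    then have "lincomb a (?X p) b (?Y p) \<phi> = 0" by simp
    then show "a = 0 \<and> b = 0" using ind by (simp add: lincomb_def ap)
  qed
  then have c: "g p (curvature A g ?X ?Y ?Y p) (?X p) /
      (g p (?X p) (?X p) * g p (?Y p) (?Y p) - (g p (?X p) (?Y p))\<^sup>2) = c"
    using assms(1) W XY p(1) unfolding constant_sectional_curvature_def by blast
  have "curvature A g ?X ?Y ?Y p \<in> tangent_space A p"
    by (rule curvature_tangent[OF W p(1) XY XY(2)])
  with c show "gl \<phi> x (local_metric.riem (gl \<phi>) x u v v) u /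
      (gl \<phi> x u u * gl \<phi> x v v - (gl \<phi> x u v)\<^sup>2) = c"
    by (simp add: g_tangent[OF \<phi>] tX curvature_apply[OF W p(1) \<phi> XY XY(2)] ap p(2))
qed

end


section \<open>The Fubini--Study construction over a flat connection\<close>

text \<open>
  A section \<open>\<sigma>\<close> of unit length of a bundle with a flat Hermitian connection \<open>D\<close> is viewed as a map
  into the projectivised bundle. Its derivative \<open>\<Phi>\<close> is the projection of \<open>D \<sigma>\<close> to the complex
  orthogonal complement of \<open>\<sigma>\<close>, and \<open>hat\<close> is the connection induced on maps \<open>\<sigma> \<rightarrow> \<sigma>\<^sup>\<bottom>\<close>.
\<close>

locale flat_hermitian =
  fixes V :: "'a::euclidean_space set"
    and h :: "'a \<Rightarrow> 'f::euclidean_space \<Rightarrow> 'f \<Rightarrow> real"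
    and I :: "'f \<Rightarrow> 'f"
    and D :: "'a \<Rightarrow> ('a \<Rightarrow> 'f) \<Rightarrow> 'a \<Rightarrow> 'f"
    and \<sigma> :: "'a \<Rightarrow> 'f"
  assumes open_V: "open V"
    and h_sym: "x \<in> V \<Longrightarrow> h x v w = h x w v"
    and h_linear: "x \<in> V \<Longrightarrow> linear (h x v)"
    and h_smooth: "smooth_on V s \<Longrightarrow> smooth_on V t \<Longrightarrow> smooth_on V (\<lambda>x. h x (s x) (t x))"
    and I_linear: "linear I" and I_I: "I (I v) = - v" and h_I: "x \<in> V \<Longrightarrow> h x (I v) (I w) = h x v w"
    and D_smooth: "smooth_on V s \<Longrightarrow> smooth_on V (D X s)"
    and D_linear: "x \<in> V \<Longrightarrow> smooth_on V s \<Longrightarrow> linear (\<lambda>X. D X s x)"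
    and D_add: "x \<in> V \<Longrightarrow> smooth_on V s \<Longrightarrow> smooth_on V t \<Longrightarrow> D X (\<lambda>x. s x + t x) x = D X s x + D X t x"
    and D_scaleR: "x \<in> V \<Longrightarrow> smooth_on V f \<Longrightarrow> smooth_on V s \<Longrightarrow>
      D X (\<lambda>x. f x *\<^sub>R s x) x = fd f x X *\<^sub>R s x + f x *\<^sub>R D X s x"
    and D_cong: "x \<in> V \<Longrightarrow> (\<And>x. x \<in> V \<Longrightarrow> s x = t x) \<Longrightarrow> D X s x = D X t x"
    and D_I: "x \<in> V \<Longrightarrow> smooth_on V s \<Longrightarrow> D X (\<lambda>x. I (s x)) x = I (D X s x)"
    and D_metric: "x \<in> V \<Longrightarrow> smooth_on V s \<Longrightarrow> smooth_on V t \<Longrightarrow>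
      fd (\<lambda>x. h x (s x) (t x)) x X = h x (D X s x) (t x) + h x (s x) (D X t x)"
    and D_flat: "x \<in> V \<Longrightarrow> smooth_on V s \<Longrightarrow> D X (D Y s) x = D Y (D X s) x"
    and \<sigma>_smooth: "smooth_on V \<sigma>"
    and \<sigma>_unit: "x \<in> V \<Longrightarrow> h x (\<sigma> x) (\<sigma> x) = 1"
begin

text \<open>The connection form of the complex line spanned by \<sigma>. Because \<sigma> has unit
  length, the component of its derivative along that line is purely imaginary, and this one real
  coefficient describes it.\<close>

definition \<beta> :: "'a \<Rightarrow> 'a \<Rightarrow> real" where
  "\<beta> X x = h x (D X \<sigma> x) (I (\<sigma> x))"

definition \<Phi> :: "'a \<Rightarrow> 'a \<Rightarrow> 'f" where
  "\<Phi> X x = D X \<sigma> x - \<beta> X x *\<^sub>R I (\<sigma> x)"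

text \<open>For \<open>s\<close> orthogonal to \<sigma> and \<open>I \<sigma>\<close>, the two
  middle terms are minus the components of \<open>D X s\<close> along \<sigma> and
  \<open>I \<sigma>\<close>, by \<open>D_perp\<close>; they perform the projection to the
  complement. The last term is the contribution of the dual of the line in Hom(\<sigma>,
  \<sigma>^perp).\<close>

definition hat :: "'a \<Rightarrow> ('a \<Rightarrow> 'f) \<Rightarrow> 'a \<Rightarrow> 'f" where
  "hat X s x = D X s x + h x (s x) (\<Phi> X x) *\<^sub>R \<sigma> x + h x (s x) (I (\<Phi> X x)) *\<^sub>R I (\<sigma> x)
     - \<beta> X x *\<^sub>R I (s x)"

definition perp :: "('a \<Rightarrow> 'f) \<Rightarrow> bool" where
  "perp s \<longleftrightarrow> (\<forall>x\<in>V. h x (s x) (\<sigma> x) = 0 \<and> h x (s x) (I (\<sigma> x)) = 0)"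

lemma h_linear_left: "x \<in> V \<Longrightarrow> linear (\<lambda>v. h x v w)"
proof -
  assume x: "x \<in> V"
  then have "(\<lambda>v. h x v w) = h x w" by (intro ext h_sym)
  with h_linear[OF x] show ?thesis by simp
qed

lemma h_I_left: "x \<in> V \<Longrightarrow> h x (I v) w = - h x v (I w)"
  using h_I[of x v "I w"] linear_neg[OF h_linear, of x "I v" w] by (simp add: I_I)

lemmas h_simps = linear_add[OF h_linear] linear_diff[OF h_linear] linear_scale[OF h_linear]
  linear_neg[OF h_linear] linear_add[OF h_linear_left] linear_diff[OF h_linear_left]
  linear_scale[OF h_linear_left] linear_neg[OF h_linear_left] h_I_left I_I
  linear_add[OF I_linear] linear_diff[OF I_linear] linear_scale[OF I_linear] linear_neg[OF I_linear]

lemma h_self_I: "x \<in> V \<Longrightarrow> h x v (I v) = 0"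
  using h_I_left[of x v v] h_sym[of x v "I v"] by simp

lemma \<sigma>_D: "x \<in> V \<Longrightarrow> h x (D X \<sigma> x) (\<sigma> x) = 0"
proof -
  assume x: "x \<in> V"
  have "fd (\<lambda>x. h x (\<sigma> x) (\<sigma> x)) x X = fd (\<lambda>x. 1) x X"
    by (rule fd_cong[OF open_V x, THEN fun_cong]) (rule \<sigma>_unit)
  then show ?thesis
    using h_sym[OF x, of "\<sigma> x"] by (simp add: D_metric[OF x \<sigma>_smooth \<sigma>_smooth])
qed

lemma I_smooth: "smooth_on V s \<Longrightarrow> smooth_on V (\<lambda>x. I (s x))"
  by (rule smooth_on_linear[OF I_linear])

lemma \<beta>_smooth: "smooth_on V (\<beta> X)"
  unfolding \<beta>_def by (intro h_smooth D_smooth I_smooth \<sigma>_smooth)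

lemma \<Phi>_smooth: "smooth_on V (\<Phi> X)"
  unfolding \<Phi>_def by (intro smooth_intros D_smooth \<beta>_smooth I_smooth \<sigma>_smooth)

lemma hat_smooth: "smooth_on V s \<Longrightarrow> smooth_on V (hat X s)"
  unfolding hat_def
  by (intro smooth_intros D_smooth \<beta>_smooth I_smooth \<sigma>_smooth h_smooth \<Phi>_smooth)

lemma D\<sigma>: "D X \<sigma> x = \<Phi> X x + \<beta> X x *\<^sub>R I (\<sigma> x)"
  by (simp add: \<Phi>_def)

lemma \<sigma>_I\<sigma>: "x \<in> V \<Longrightarrow> h x (\<sigma> x) (I (\<sigma> x)) = 0"
  by (rule h_self_I)

lemma \<Phi>_perp: "x \<in> V \<Longrightarrow> h x (\<Phi> X x) (\<sigma> x) = 0" "x \<in> V \<Longrightarrow> h x (\<Phi> X x) (I (\<sigma> x)) = 0"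
  by (simp_all add: \<Phi>_def h_simps \<sigma>_D \<sigma>_I\<sigma> \<sigma>_unit \<beta>_def)

lemma perp_\<Phi>: "perp (\<Phi> X)"
  by (simp add: perp_def \<Phi>_perp)

lemma linear_\<Phi>: "x \<in> V \<Longrightarrow> linear (\<lambda>X. \<Phi> X x)"
  by (rule linearI) (simp_all add: \<Phi>_def \<beta>_def linear_add[OF D_linear[OF _ \<sigma>_smooth]]
      linear_scale[OF D_linear[OF _ \<sigma>_smooth]] h_simps algebra_simps)

lemma D_perp:
  assumes x: "x \<in> V" and s: "smooth_on V s" "perp s"
  shows "h x (D X s x) (\<sigma> x) = - h x (s x) (\<Phi> X x)"
    and "h x (D X s x) (I (\<sigma> x)) = - h x (s x) (I (\<Phi> X x))"
proof -
  have "fd (\<lambda>x. h x (s x) (\<sigma> x)) x X = fd (\<lambda>x. 0) x X"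
    by (rule fd_cong[OF open_V x, THEN fun_cong]) (use s(2) in \<open>simp add: perp_def\<close>)
  then show "h x (D X s x) (\<sigma> x) = - h x (s x) (\<Phi> X x)"
    using s(2) x by (simp add: D_metric[OF x s(1) \<sigma>_smooth] D\<sigma> h_simps perp_def)
  have "fd (\<lambda>x. h x (s x) (I (\<sigma> x))) x X = fd (\<lambda>x. 0) x X"
    by (rule fd_cong[OF open_V x, THEN fun_cong]) (use s(2) in \<open>simp add: perp_def\<close>)
  then show "h x (D X s x) (I (\<sigma> x)) = - h x (s x) (I (\<Phi> X x))"
    using s(2) x by (simp add: D_metric[OF x s(1) I_smooth[OF \<sigma>_smooth]] D_I[OF x \<sigma>_smooth] D\<sigma> h_simps perp_def)
qed

lemma perp_hat:
  assumes s: "smooth_on V s" "perp s"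
  shows "perp (hat X s)"
  unfolding perp_def
proof (intro ballI conjI)
  fix x assume x: "x \<in> V"
  have p: "h x (s x) (\<sigma> x) = 0" "h x (s x) (I (\<sigma> x)) = 0" using s(2) x by (simp_all add: perp_def)
  show "h x (hat X s x) (\<sigma> x) = 0"
    using x by (simp add: hat_def h_simps D_perp[OF x s] p \<sigma>_unit \<sigma>_I\<sigma>)
  show "h x (hat X s x) (I (\<sigma> x)) = 0"
    using x by (simp add: hat_def h_simps D_perp[OF x s] p \<sigma>_unit \<sigma>_I\<sigma>)
qed

lemma hat_metric:
  assumes x: "x \<in> V" and s: "smooth_on V s" "perp s" and t: "smooth_on V t" "perp t"
  shows "fd (\<lambda>x. h x (s x) (t x)) x X = h x (hat X s x) (t x) + h x (s x) (hat X t x)"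
proof -
  have "h x (\<sigma> x) (t x) = 0" "h x (\<sigma> x) (I (t x)) = 0"
    using t(2) x h_sym[OF x, of "\<sigma> x" "t x"] h_sym[OF x, of "\<sigma> x" "I (t x)"]
    by (simp_all add: perp_def h_I_left)
  moreover have "h x (s x) (\<sigma> x) = 0" "h x (s x) (I (\<sigma> x)) = 0" using s(2) x by (simp_all add: perp_def)
  ultimately show ?thesis
    using x by (simp add: D_metric[OF x s(1) t(1)] hat_def h_simps)
qed

text \<open>The curvature of the line spanned by \<sigma>. Flatness cancels the second derivatives
  of \<sigma>, and the products of first derivatives that survive are skew, whence the factor
  2.\<close>

lemma d\<beta>:
  assumes x: "x \<in> V"
  shows "fd (\<beta> Y) x X - fd (\<beta> X) x Y = 2 * h x (\<Phi> Y x) (I (\<Phi> X x))"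
proof -
  have e: "fd (\<beta> Y) x X = h x (D X (D Y \<sigma>) x) (I (\<sigma> x)) + h x (D Y \<sigma> x) (I (D X \<sigma> x))" for X Y
    unfolding \<beta>_def by (simp add: D_metric[OF x D_smooth[OF \<sigma>_smooth] I_smooth[OF \<sigma>_smooth]] D_I[OF x \<sigma>_smooth])
  have "h x (\<Phi> X x) (I (\<Phi> Y x)) = - h x (\<Phi> Y x) (I (\<Phi> X x))"
    using h_sym[OF x, of "\<Phi> X x" "I (\<Phi> Y x)"] by (simp add: h_I_left x)
  then show ?thesis
    unfolding e D_flat[OF x \<sigma>_smooth, of X Y] D\<sigma>
    using x by (simp add: h_simps \<Phi>_perp \<sigma>_I\<sigma> h_sym[OF x, of "\<sigma> x" "\<Phi> _ x"] h_sym[OF x, of "\<sigma> x" "I (\<Phi> _ x)"])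
qed

lemma D_\<Phi>:
  assumes x: "x \<in> V"
  shows "D X (\<Phi> Y) x = D X (D Y \<sigma>) x - fd (\<beta> Y) x X *\<^sub>R I (\<sigma> x) - \<beta> Y x *\<^sub>R I (D X \<sigma> x)"
proof -
  have s: "smooth_on V (\<lambda>x. - \<beta> Y x)" by (intro smooth_intros \<beta>_smooth)
  have "fd (\<lambda>x. - \<beta> Y x) x X = - fd (\<beta> Y) x X"
    using fd_scaleR[OF open_V x smooth_on_const \<beta>_smooth, of "-1" Y X] by simp
  moreover have "D X (\<Phi> Y) x = D X (\<lambda>x. D Y \<sigma> x + (- \<beta> Y x) *\<^sub>R I (\<sigma> x)) x"
    by (rule D_cong[OF x]) (simp add: \<Phi>_def)
  moreover have "\<dots> = D X (D Y \<sigma>) x + (fd (\<lambda>x. - \<beta> Y x) x X *\<^sub>R I (\<sigma> x) + - \<beta> Y x *\<^sub>R I (D X \<sigma> x))"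
    by (simp only: D_add[OF x D_smooth[OF \<sigma>_smooth] smooth_on_scaleR[OF s I_smooth[OF \<sigma>_smooth]]]
        D_scaleR[OF x s I_smooth[OF \<sigma>_smooth]] D_I[OF x \<sigma>_smooth])
  ultimately show ?thesis by simp
qed

text \<open>This makes the induced connection torsion-free. Second derivatives of \<sigma> commute
  by flatness, and the remaining multiple of \<open>I \<sigma>\<close> is the difference between
  d\<beta> and twice the fundamental form, which is zero.\<close>

lemma hat_\<Phi>_sym:
  assumes x: "x \<in> V"
  shows "hat X (\<Phi> Y) x = hat Y (\<Phi> X) x"
proof -
  have sk: "h x (\<Phi> X x) (I (\<Phi> Y x)) = - h x (\<Phi> Y x) (I (\<Phi> X x))"
    using h_sym[OF x, of "\<Phi> X x" "I (\<Phi> Y x)"] by (simp add: h_I_left x)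
  have "hat X (\<Phi> Y) x - hat Y (\<Phi> X) x =
      (h x (\<Phi> Y x) (I (\<Phi> X x)) + h x (\<Phi> Y x) (I (\<Phi> X x)) - (fd (\<beta> Y) x X - fd (\<beta> X) x Y)) *\<^sub>R I (\<sigma> x)"
    unfolding hat_def D_\<Phi>[OF x] D\<sigma> sk D_flat[OF x \<sigma>_smooth, of X Y] h_sym[OF x, of "\<Phi> Y x" "\<Phi> X x"]
    by (simp add: h_simps algebra_simps, simp only: mult_2 scaleR_add_left)
  then show ?thesis by (simp add: d\<beta>[OF x])
qed

lemma hat_I: "x \<in> V \<Longrightarrow> smooth_on V s \<Longrightarrow> hat X (\<lambda>x. I (s x)) x = I (hat X s x)"
  by (simp add: hat_def D_I h_simps)

lemma hat_cong: "x \<in> V \<Longrightarrow> (\<And>x. x \<in> V \<Longrightarrow> s x = t x) \<Longrightarrow> hat X s x = hat X t x"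
  unfolding hat_def using D_cong[of x s t X] by simp

lemma hat_add:
  "x \<in> V \<Longrightarrow> smooth_on V s \<Longrightarrow> smooth_on V t \<Longrightarrow> hat X (\<lambda>x. s x + t x) x = hat X s x + hat X t x"
  by (simp add: hat_def D_add h_simps algebra_simps)

lemma hat_scaleR:
  "x \<in> V \<Longrightarrow> smooth_on V f \<Longrightarrow> smooth_on V s \<Longrightarrow>
    hat X (\<lambda>x. f x *\<^sub>R s x) x = fd f x X *\<^sub>R s x + f x *\<^sub>R hat X s x"
  by (simp add: hat_def D_scaleR h_simps algebra_simps)

lemma hat_zero: "x \<in> V \<Longrightarrow> hat X (\<lambda>x. 0) x = 0"
  using hat_scaleR[where f = "\<lambda>_. 0" and s = "\<lambda>_. 0" and x = x and X = X] by (simp add: smooth_on_const)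

lemma hat_sum:
  assumes "x \<in> V" "\<And>i. i \<in> K \<Longrightarrow> smooth_on V (s i)"
  shows "hat X (\<lambda>x. \<Sum>i\<in>K. s i x) x = (\<Sum>i\<in>K. hat X (s i) x)"
  using assms(2)
proof (induction K rule: infinite_finite_induct)
  case (insert i K)
  have "hat X (\<lambda>x. s i x + (\<Sum>i\<in>K. s i x)) x = hat X (s i) x + hat X (\<lambda>x. \<Sum>i\<in>K. s i x) x"
    by (rule hat_add[OF assms(1)]) (use insert.prems in \<open>auto intro: smooth_on_sum\<close>)
  then show ?case using insert by simp
qed (simp_all add: hat_zero assms(1))

text \<open>A Gauss equation: the ambient connection is flat, so the curvature of its projection is
  quadratic in \<Phi>, which plays the role of a second fundamental form. The term with the factor 2
  is the curvature of the line, through d\<beta>.\<close>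

lemma hat_curvature:
  assumes x: "x \<in> V" and s: "smooth_on V s" "perp s"
  shows "hat X (hat Y s) x - hat Y (hat X s) x =
    h x (s x) (\<Phi> Y x) *\<^sub>R \<Phi> X x - h x (s x) (\<Phi> X x) *\<^sub>R \<Phi> Y x
    + h x (s x) (I (\<Phi> Y x)) *\<^sub>R I (\<Phi> X x) - h x (s x) (I (\<Phi> X x)) *\<^sub>R I (\<Phi> Y x)
    + (2 * h x (\<Phi> X x) (I (\<Phi> Y x))) *\<^sub>R I (s x)"
    (is "?L = ?R")
proof -
  note sm = s(1) D_smooth I_smooth \<beta>_smooth \<Phi>_smooth \<sigma>_smooth h_smooth
  have e: "\<exists>p q. hat X (hat Y s) x = D X (D Y s) x
      + h x (s x) (\<Phi> Y x) *\<^sub>R \<Phi> X x + h x (s x) (I (\<Phi> Y x)) *\<^sub>R I (\<Phi> X x)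
      - fd (\<beta> Y) x X *\<^sub>R I (s x) - \<beta> Y x *\<^sub>R I (D X s x) - \<beta> X x *\<^sub>R I (D Y s x)
      - (\<beta> X x * \<beta> Y x) *\<^sub>R s x + p *\<^sub>R \<sigma> x + q *\<^sub>R I (\<sigma> x)" for X Y
  proof -
    define a where "a x = h x (s x) (\<Phi> Y x)" for x
    define b where "b x = h x (s x) (I (\<Phi> Y x))" for x
    have ab: "smooth_on V a" "smooth_on V b" unfolding a_def b_def by (intro sm)+
    have mb: "smooth_on V (\<lambda>x. - \<beta> Y x)" by (intro smooth_intros sm)
    have fmb: "fd (\<lambda>x. - \<beta> Y x) x X = - fd (\<beta> Y) x X"
      using fd_scaleR[OF open_V x smooth_on_const \<beta>_smooth, of "-1" Y X] by simp
    have "D X (hat Y s) x = D X (\<lambda>x. D Y s x + (a x *\<^sub>R \<sigma> x + (b x *\<^sub>R I (\<sigma> x) + (- \<beta> Y x) *\<^sub>R I (s x)))) x"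
      by (rule D_cong[OF x]) (simp add: hat_def a_def b_def)
    also have "\<dots> = D X (D Y s) x + ((fd a x X *\<^sub>R \<sigma> x + a x *\<^sub>R D X \<sigma> x) +
        ((fd b x X *\<^sub>R I (\<sigma> x) + b x *\<^sub>R I (D X \<sigma> x)) + (fd (\<lambda>x. - \<beta> Y x) x X *\<^sub>R I (s x) + - \<beta> Y x *\<^sub>R I (D X s x))))"
    proof -
      have c: "smooth_on V (\<lambda>x. - \<beta> Y x *\<^sub>R I (s x))" "smooth_on V (\<lambda>x. b x *\<^sub>R I (\<sigma> x))"
        "smooth_on V (\<lambda>x. a x *\<^sub>R \<sigma> x)" by (intro smooth_on_scaleR sm ab mb)+
      show ?thesis
        by (simp only: D_add[OF x D_smooth[OF s(1)] smooth_on_add[OF c(3) smooth_on_add[OF c(2,1)]]]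
            D_add[OF x c(3) smooth_on_add[OF c(2,1)]] D_add[OF x c(2,1)]
            D_scaleR[OF x ab(1) \<sigma>_smooth] D_scaleR[OF x ab(2) I_smooth[OF \<sigma>_smooth]]
            D_scaleR[OF x mb I_smooth[OF s(1)]] D_I[OF x \<sigma>_smooth] D_I[OF x s(1)])
    qed
    finally have "hat X (hat Y s) x = D X (D Y s) x + a x *\<^sub>R \<Phi> X x + b x *\<^sub>R I (\<Phi> X x)
      - fd (\<beta> Y) x X *\<^sub>R I (s x) - \<beta> Y x *\<^sub>R I (D X s x) - \<beta> X x *\<^sub>R I (D Y s x)
      - (\<beta> X x * \<beta> Y x) *\<^sub>R s x
      + (fd a x X - \<beta> X x * b x + h x (hat Y s x) (\<Phi> X x) + \<beta> X x * b x) *\<^sub>R \<sigma> x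
      + (\<beta> X x * a x + fd b x X + h x (hat Y s x) (I (\<Phi> X x)) - \<beta> X x * a x) *\<^sub>R I (\<sigma> x)"
      unfolding hat_def[of X "hat Y s"]
      by (simp add: hat_def[of Y s] fmb D\<sigma> a_def b_def h_simps algebra_simps x)
    then show ?thesis unfolding a_def b_def by blast
  qed
  \<comment> \<open>The two sides agree modulo \<open>\<sigma>\<close> and \<open>I \<sigma>\<close>, to which both are orthogonal.\<close>
  obtain p q where 1: "hat X (hat Y s) x = D X (D Y s) x
      + h x (s x) (\<Phi> Y x) *\<^sub>R \<Phi> X x + h x (s x) (I (\<Phi> Y x)) *\<^sub>R I (\<Phi> X x)
      - fd (\<beta> Y) x X *\<^sub>R I (s x) - \<beta> Y x *\<^sub>R I (D X s x) - \<beta> X x *\<^sub>R I (D Y s x)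
      - (\<beta> X x * \<beta> Y x) *\<^sub>R s x + p *\<^sub>R \<sigma> x + q *\<^sub>R I (\<sigma> x)" using e by blast
  obtain p' q' where 2: "hat Y (hat X s) x = D Y (D X s) x
      + h x (s x) (\<Phi> X x) *\<^sub>R \<Phi> Y x + h x (s x) (I (\<Phi> X x)) *\<^sub>R I (\<Phi> Y x)
      - fd (\<beta> X) x Y *\<^sub>R I (s x) - \<beta> X x *\<^sub>R I (D Y s x) - \<beta> Y x *\<^sub>R I (D X s x)
      - (\<beta> Y x * \<beta> X x) *\<^sub>R s x + p' *\<^sub>R \<sigma> x + q' *\<^sub>R I (\<sigma> x)" using e by blast
  have sk: "h x (\<Phi> X x) (I (\<Phi> Y x)) = - h x (\<Phi> Y x) (I (\<Phi> X x))"
    using h_sym[OF x, of "\<Phi> X x" "I (\<Phi> Y x)"] by (simp add: h_I_left x)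
  have fdb: "fd (\<beta> Y) x X = fd (\<beta> X) x Y + 2 * h x (\<Phi> Y x) (I (\<Phi> X x))"
    using d\<beta>[OF x, of Y X] by simp
  have diff: "?L - ?R = (p - p') *\<^sub>R \<sigma> x + (q - q') *\<^sub>R I (\<sigma> x)"
    unfolding 1 2 sk fdb D_flat[OF x s(1), of X Y] by (simp add: algebra_simps)
  have ps: "h x (s x) (\<sigma> x) = 0" "h x (s x) (I (\<sigma> x)) = 0" using s(2) x by (simp_all add: perp_def)
  have ph: "h x (hat X (hat Y s) x) (\<sigma> x) = 0" "h x (hat X (hat Y s) x) (I (\<sigma> x)) = 0" for X Y
    using perp_hat[OF hat_smooth[OF s(1)] perp_hat[OF s]] x by (simp_all add: perp_def)
  have "h x (?L - ?R) (\<sigma> x) = 0" "h x (?L - ?R) (I (\<sigma> x)) = 0"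
    using x by (simp_all add: h_simps ph ps \<Phi>_perp)
  then have "p - p' = 0" "q - q' = 0"
    using x unfolding diff by (simp_all add: h_simps \<sigma>_unit \<sigma>_I\<sigma>)
  then show ?thesis using diff by simp
qed

end

section \<open>The metric induced by the Fubini-Study construction\<close>

locale fubini_study = flat_hermitian V h I D \<sigma> + local_metric V G
  for V :: "'a::euclidean_space set" and h :: "'a \<Rightarrow> 'f::euclidean_space \<Rightarrow> 'f \<Rightarrow> real"
    and I D \<sigma> G +
  fixes J :: "'a \<Rightarrow> 'a \<Rightarrow> 'a" and \<kappa> :: real
  assumes \<kappa>: "\<kappa> \<noteq> 0"
    and G_eq: "x \<in> V \<Longrightarrow> G x X Y = \<kappa> * h x (\<Phi> X x) (\<Phi> Y x)"
    and J_eq: "x \<in> V \<Longrightarrow> \<Phi> (J x X) x = I (\<Phi> X x)"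
    and J_smooth: "smooth_on V (\<lambda>x. J x X)"
    and nondegenerate: "x \<in> V \<Longrightarrow> (\<And>X. h x d (\<Phi> X x) = 0) \<Longrightarrow> h x d (\<sigma> x) = 0 \<Longrightarrow>
      h x d (I (\<sigma> x)) = 0 \<Longrightarrow> d = 0"
begin

lemma \<Phi>_inj: "x \<in> V \<Longrightarrow> \<Phi> X x = \<Phi> Y x \<Longrightarrow> X = Y"
proof (rule ccontr)
  assume x: "x \<in> V" and e: "\<Phi> X x = \<Phi> Y x" and "X \<noteq> Y"
  then have "G x (X - Y) (X - Y) > 0" using g_pos by simp
  moreover have "\<Phi> (X - Y) x = 0" using linear_diff[OF linear_\<Phi>[OF x]] e by simp
  ultimately show False using G_eq[OF x] linear_0[OF h_linear[OF x]] by simp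
qed

lemma fd_G:
  assumes x: "x \<in> V"
  shows "fd (\<lambda>x. G x Y Z) x X = \<kappa> * (h x (hat X (\<Phi> Y) x) (\<Phi> Z x) + h x (hat X (\<Phi> Z) x) (\<Phi> Y x))"
proof -
  have "fd (\<lambda>x. G x Y Z) x X = fd (\<lambda>x. \<kappa> * h x (\<Phi> Y x) (\<Phi> Z x)) x X"
    by (rule fd_cong[OF open_V x, THEN fun_cong]) (rule G_eq)
  also have "\<dots> = \<kappa> * fd (\<lambda>x. h x (\<Phi> Y x) (\<Phi> Z x)) x X"
    by (simp add: fd_mult[OF open_V x smooth_on_const h_smooth[OF \<Phi>_smooth \<Phi>_smooth]])
  finally show ?thesis
    using h_sym[OF x, of "\<Phi> Y x"] by (simp add: hat_metric[OF x \<Phi>_smooth perp_\<Phi> \<Phi>_smooth perp_\<Phi>])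
qed

text \<open>Symmetry and compatibility turn the Koszul expression of \<open>G\<close> into \<kappa>
  h(hat X (\<Phi> Y), \<Phi> Z). The two sides therefore have equal products with every \<Phi> Z,
  and both are orthogonal to \<sigma> and \<open>I \<sigma>\<close>. As h may be indefinite,
  equality is drawn from \<open>nondegenerate\<close>.\<close>

lemma \<Phi>_chris:
  assumes x: "x \<in> V"
  shows "\<Phi> (chris x X Y) x = hat X (\<Phi> Y) x"
proof -
  have "\<kappa> * h x (\<Phi> (chris x X Y) x) (\<Phi> Z x) = \<kappa> * h x (hat X (\<Phi> Y) x) (\<Phi> Z x)" for Z
  proof -
    have "\<kappa> * h x (\<Phi> (chris x X Y) x) (\<Phi> Z x) = koszul x X Y Z"
      using g_chris[OF x] G_eq[OF x] by simp
    also have "\<dots> = \<kappa> * h x (hat X (\<Phi> Y) x) (\<Phi> Z x)"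
      unfolding koszul_def fd_G[OF x]
      using hat_\<Phi>_sym[OF x, of Y X] hat_\<Phi>_sym[OF x, of Y Z] hat_\<Phi>_sym[OF x, of X Z]
      by (simp add: algebra_simps)
    finally show ?thesis .
  qed
  then have 1: "h x (\<Phi> (chris x X Y) x - hat X (\<Phi> Y) x) (\<Phi> Z x) = 0" for Z
    using \<kappa> x by (simp add: h_simps)
  have p: "h x (hat X (\<Phi> Y) x) (\<sigma> x) = 0" "h x (hat X (\<Phi> Y) x) (I (\<sigma> x)) = 0"
    using perp_hat[OF \<Phi>_smooth perp_\<Phi>] x by (simp_all add: perp_def)
  have "\<Phi> (chris x X Y) x - hat X (\<Phi> Y) x = 0"
    by (rule nondegenerate[OF x 1]) (use x in \<open>simp_all add: h_simps \<Phi>_perp p\<close>)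
  then show ?thesis by simp
qed

sublocale pulled_back_metric V G V "\<lambda>x. x"
  by unfold_locales (auto simp: open_V smooth_on_id)

lemma \<Phi>_cov:
  assumes x: "x \<in> V" and v: "smooth_on V v"
  shows "\<Phi> (cov v X x) x = hat X (\<lambda>x. \<Phi> (v x) x) x"
proof -
  have vb: "smooth_on V (\<lambda>x. v x \<bullet> b)" for b by (intro smooth_intros v)
  have fvb: "fd (\<lambda>x. v x \<bullet> b) x X = fd v x X \<bullet> b" for b
    using fd_inner[OF open_V x v smooth_on_const, of b X] by simp
  have "hat X (\<lambda>x. \<Phi> (v x) x) x = hat X (\<lambda>x. \<Sum>b\<in>Basis. (v x \<bullet> b) *\<^sub>R \<Phi> b x) x"
    by (rule hat_cong[OF x]) (rule linear_basis_sum[OF linear_\<Phi>])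
  also have "\<dots> = (\<Sum>b\<in>Basis. (fd v x X \<bullet> b) *\<^sub>R \<Phi> b x) + (\<Sum>b\<in>Basis. (v x \<bullet> b) *\<^sub>R \<Phi> (chris x X b) x)"
    by (simp add: hat_sum[OF x] hat_scaleR[OF x vb \<Phi>_smooth] smooth_on_scaleR vb \<Phi>_smooth fvb
        sum.distrib \<Phi>_chris[OF x])
  also have "(\<Sum>b\<in>Basis. (fd v x X \<bullet> b) *\<^sub>R \<Phi> b x) = \<Phi> (fd v x X) x"
    by (rule linear_basis_sum[OF linear_\<Phi>[OF x], symmetric])
  also have "(\<Sum>b\<in>Basis. (v x \<bullet> b) *\<^sub>R \<Phi> (chris x X b) x) = \<Phi> (chris x X (v x)) x"
    by (rule linear_basis_sum[of "\<lambda>v. \<Phi> (chris x X v) x", symmetric])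
      (use linear_compose[OF linear_chris[OF x] linear_\<Phi>[OF x]] in \<open>simp add: o_def\<close>)
  finally show ?thesis using x by (simp add: cov_def linear_add[OF linear_\<Phi>])
qed

lemma \<Phi>_riem:
  assumes x: "x \<in> V"
  shows "\<Phi> (riem x X Y Z) x = hat X (hat Y (\<Phi> Z)) x - hat Y (hat X (\<Phi> Z)) x"
proof -
  have c: "smooth_on V (\<lambda>x. Z)" by (rule smooth_on_const)
  have e: "\<Phi> (cov (cov (\<lambda>x. Z) Y) X x) x = hat X (hat Y (\<Phi> Z)) x" for X Y
    unfolding \<Phi>_cov[OF x smooth_on_cov[OF c]] by (rule hat_cong[OF x]) (rule \<Phi>_cov[OF _ c])
  have "riem x X Y Z = cov (cov (\<lambda>x. Z) Y) X x - cov (cov (\<lambda>x. Z) X) Y x"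
    by (simp add: cov_commutator[OF x c])
  then show ?thesis by (simp add: linear_diff[OF linear_\<Phi>[OF x]] e)
qed

text \<open>The injective map \<Phi> carries both sides to the Gauss equation. There \<kappa>
  converts h into \<open>G\<close>; with \<kappa> = 4 / k the prefactor becomes k / 4.\<close>

theorem riem_eq:
  assumes x: "x \<in> V"
  shows "riem x X Y Z = (1 / \<kappa>) *\<^sub>R (G x Z Y *\<^sub>R X - G x Z X *\<^sub>R Y + G x Z (J x Y) *\<^sub>R J x X
    - G x Z (J x X) *\<^sub>R J x Y + (2 * G x X (J x Y)) *\<^sub>R J x Z)"
proof (rule \<Phi>_inj[OF x])
  note lin = linear_add[OF linear_\<Phi>[OF x]] linear_diff[OF linear_\<Phi>[OF x]] linear_scale[OF linear_\<Phi>[OF x]]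
  show "\<Phi> (riem x X Y Z) x = \<Phi> ((1 / \<kappa>) *\<^sub>R (G x Z Y *\<^sub>R X - G x Z X *\<^sub>R Y + G x Z (J x Y) *\<^sub>R J x X
    - G x Z (J x X) *\<^sub>R J x Y + (2 * G x X (J x Y)) *\<^sub>R J x Z)) x"
    unfolding \<Phi>_riem[OF x] hat_curvature[OF x \<Phi>_smooth perp_\<Phi>] lin G_eq[OF x] J_eq[OF x]
    using \<kappa> by (simp add: scaleR_add_right scaleR_diff_right)
qed

text \<open>Under \<Phi> the structure \<open>J\<close> is multiplication by i, and the induced
  connection is complex linear.\<close>

theorem parallel_J:
  assumes x: "x \<in> V" and v: "smooth_on V v"
  shows "cov (\<lambda>x. J x (v x)) X x = J x (cov v X x)"
proof (rule \<Phi>_inj[OF x])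
  have J_linear: "linear (J x)" if "x \<in> V" for x
    by (rule linearI; rule \<Phi>_inj[OF that]) (simp_all add: J_eq[OF that] linear_add[OF linear_\<Phi>[OF that]]
        linear_scale[OF linear_\<Phi>[OF that]] linear_add[OF I_linear] linear_scale[OF I_linear])
  have Jv: "smooth_on V (\<lambda>x. J x (v x))" by (rule smooth_on_linear_family[OF J_linear J_smooth v])
  have \<Phi>v: "smooth_on V (\<lambda>x. \<Phi> (v x) x)"
    by (rule smooth_on_linear_family[of V "\<lambda>x X. \<Phi> X x", OF linear_\<Phi> \<Phi>_smooth v])
  have "\<Phi> (cov (\<lambda>x. J x (v x)) X x) x = hat X (\<lambda>x. I (\<Phi> (v x) x)) x"
    unfolding \<Phi>_cov[OF x Jv] by (rule hat_cong[OF x]) (rule J_eq)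
  also have "\<dots> = \<Phi> (J x (cov v X x)) x"
    by (simp add: hat_I[OF x \<Phi>v] J_eq[OF x] \<Phi>_cov[OF x v])
  finally show "\<Phi> (cov (\<lambda>x. J x (v x)) X x) x = \<Phi> (J x (cov v X x)) x" .
qed

end

section \<open>The flat Hermitian connection over a space of constant curvature\<close>

context pulled_back_metric
begin

text \<open>
  For a metric of constant curvature \<open>c\<close>, the sum of the trivial line bundle and the tangent
  bundle carries a flat metric connection; \<open>hform\<close> and \<open>flatD\<close> are its complexification.
\<close>

definition hform :: "real \<Rightarrow> 'a \<Rightarrow> (real \<times> 'b) \<times> (real \<times> 'b) \<Rightarrow> (real \<times> 'b) \<times> (real \<times> 'b) \<Rightarrow> real" where
  "hform c x s t = fst (fst s) * fst (fst t) + c * g (P x) (snd (fst s)) (snd (fst t))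
     + (fst (snd s) * fst (snd t) + c * g (P x) (snd (snd s)) (snd (snd t)))"

definition flatD0 :: "real \<Rightarrow> 'a \<Rightarrow> ('a \<Rightarrow> real \<times> 'b) \<Rightarrow> 'a \<Rightarrow> real \<times> 'b" where
  "flatD0 c X s x = (fd (\<lambda>x. fst (s x)) x X - c * g (P x) (fd P x X) (snd (s x)),
     cov (\<lambda>x. snd (s x)) X x + fst (s x) *\<^sub>R fd P x X)"

definition flatD :: "real \<Rightarrow> 'a \<Rightarrow> ('a \<Rightarrow> (real \<times> 'b) \<times> (real \<times> 'b)) \<Rightarrow> 'a \<Rightarrow> (real \<times> 'b) \<times> (real \<times> 'b)" where
  "flatD c X s x = (flatD0 c X (\<lambda>x. fst (s x)) x, flatD0 c X (\<lambda>x. snd (s x)) x)"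

text \<open>The first component of a pair is the real part and the second the imaginary
  part.\<close>

definition times_i :: "(real \<times> 'b) \<times> (real \<times> 'b) \<Rightarrow> (real \<times> 'b) \<times> (real \<times> 'b)" where
  "times_i s = (- snd s, fst s)"

lemma fd_P_smooth: "smooth_on V (\<lambda>x. fd P x X)"
  by (rule smooth_on_fd[OF P_smooth open_V])

lemma gP_smooth: "smooth_on V v \<Longrightarrow> smooth_on V w \<Longrightarrow> smooth_on V (\<lambda>x. g (P x) (v x) (w x))"
  by (rule smooth_on_g[OF P_into P_smooth])

lemma flatD0_smooth: "smooth_on V s \<Longrightarrow> smooth_on V (flatD0 c X s)"
  unfolding flatD0_def
  by (intro smooth_intros smooth_on_fd open_V gP_smooth smooth_on_cov fd_P_smooth)

lemmas gP_simps = linear_add[OF g_linear[OF P_mem]] linear_diff[OF g_linear[OF P_mem]]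
  linear_scale[OF g_linear[OF P_mem]] linear_neg[OF g_linear[OF P_mem]]
  linear_add[OF g_linear_left[OF P_mem]] linear_diff[OF g_linear_left[OF P_mem]]
  linear_scale[OF g_linear_left[OF P_mem]] linear_neg[OF g_linear_left[OF P_mem]]

lemma flatD0_metric:
  assumes x: "x \<in> V" and s: "smooth_on V s" and t: "smooth_on V t"
  shows "fd (\<lambda>x. fst (s x) * fst (t x) + c * g (P x) (snd (s x)) (snd (t x))) x X =
    fst (flatD0 c X s x) * fst (t x) + c * g (P x) (snd (flatD0 c X s x)) (snd (t x))
    + (fst (s x) * fst (flatD0 c X t x) + c * g (P x) (snd (s x)) (snd (flatD0 c X t x)))"
proof -
  have s': "smooth_on V (\<lambda>x. fst (s x))" "smooth_on V (\<lambda>x. snd (s x))"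
    "smooth_on V (\<lambda>x. fst (t x))" "smooth_on V (\<lambda>x. snd (t x))"
    by (intro smooth_intros s t)+
  note s'' = smooth_on_mult[OF s'(1,3)] gP_smooth[OF s'(2,4)]
  have "fd (\<lambda>x. fst (s x) * fst (t x) + c * g (P x) (snd (s x)) (snd (t x))) x X =
      fst (s x) * fd (\<lambda>x. fst (t x)) x X + fd (\<lambda>x. fst (s x)) x X * fst (t x)
      + c * (g (P x) (cov (\<lambda>x. snd (s x)) X x) (snd (t x)) + g (P x) (snd (s x)) (cov (\<lambda>x. snd (t x)) X x))"
    using fd_add[OF open_V x s''(1) smooth_on_mult[OF smooth_on_const s''(2)], of c X]
    by (simp add: fd_mult[OF open_V x s'(1,3)] fd_mult[OF open_V x smooth_on_const s''(2)] cov_metric[OF x s'(2,4)])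
  then show ?thesis
    using g_sym[OF P_mem[OF x], of "fd P x X"] by (simp add: flatD0_def gP_simps x algebra_simps)
qed

text \<open>In the second component the curvature of the base is cancelled by the composition of the
  two off-diagonal parts of the connection. In the first, every term is symmetric in
  \<open>X\<close> and \<open>Y\<close>, once \<open>tor\<close> says that the pulled-back
  connection has no torsion along \<open>P\<close>.\<close>

lemma flatD0_flat:
  assumes x: "x \<in> V" and s: "smooth_on V s"
    and curv: "\<And>u v w. riem (P x) u v w = c *\<^sub>R (g (P x) v w *\<^sub>R u - g (P x) u w *\<^sub>R v)"
  shows "flatD0 c X (flatD0 c Y s) x = flatD0 c Y (flatD0 c X s) x"
proof -
  have a: "smooth_on V (\<lambda>x. fst (s x))" and v: "smooth_on V (\<lambda>x. snd (s x))"
    by (intro smooth_intros s)+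
  have tor: "cov (\<lambda>x. fd P x Y) X x = cov (\<lambda>x. fd P x X) Y x"
    unfolding cov_def using second_derivative_symmetric[OF P_smooth open_V x, of Y X]
      chris_sym[OF P_mem[OF x]] by simp
  have fa: "smooth_on V (\<lambda>x. fd (\<lambda>x. fst (s x)) x Y)" for Y by (rule smooth_on_fd[OF a open_V])
  have gu: "smooth_on V (\<lambda>x. g (P x) (fd P x Y) (snd (s x)))" for Y by (intro gP_smooth fd_P_smooth v)
  have F: "fst (flatD0 c X (flatD0 c Y s) x) = fd (\<lambda>x. fd (\<lambda>x. fst (s x)) x Y) x X
      - c * (g (P x) (cov (\<lambda>x. fd P x Y) X x) (snd (s x)) + g (P x) (fd P x Y) (cov (\<lambda>x. snd (s x)) X x))
      - c * (g (P x) (fd P x X) (cov (\<lambda>x. snd (s x)) Y x) + fst (s x) * g (P x) (fd P x X) (fd P x Y))" for X Y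
    unfolding flatD0_def
    by (simp add: fd_diff[OF open_V x fa smooth_on_mult[OF smooth_on_const gu]]
        fd_mult[OF open_V x smooth_on_const gu] cov_metric[OF x fd_P_smooth v] gP_simps x)
  have S: "snd (flatD0 c X (flatD0 c Y s) x) = cov (cov (\<lambda>x. snd (s x)) Y) X x
      + fd (\<lambda>x. fst (s x)) x X *\<^sub>R fd P x Y + fst (s x) *\<^sub>R cov (\<lambda>x. fd P x Y) X x
      + fd (\<lambda>x. fst (s x)) x Y *\<^sub>R fd P x X - (c * g (P x) (fd P x Y) (snd (s x))) *\<^sub>R fd P x X" for X Y
    unfolding flatD0_def
    by (simp add: cov_add[OF x smooth_on_cov[OF v] smooth_on_scaleR[OF a fd_P_smooth]]
        cov_scaleR[OF x a fd_P_smooth] algebra_simps)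
  have "cov (cov (\<lambda>x. snd (s x)) Y) X x = cov (cov (\<lambda>x. snd (s x)) X) Y x
      + c *\<^sub>R (g (P x) (fd P x Y) (snd (s x)) *\<^sub>R fd P x X - g (P x) (fd P x X) (snd (s x)) *\<^sub>R fd P x Y)"
    using cov_commutator[OF x v, of Y X] unfolding curv by (simp add: algebra_simps)
  then have "snd (flatD0 c X (flatD0 c Y s) x) = snd (flatD0 c Y (flatD0 c X s) x)"
    unfolding S tor by (simp add: algebra_simps)
  moreover have "fst (flatD0 c X (flatD0 c Y s) x) = fst (flatD0 c Y (flatD0 c X s) x)"
    unfolding F tor using second_derivative_symmetric[OF a open_V x, of Y X]
      g_sym[OF P_mem[OF x], of "fd P x X" "fd P x Y"] by (simp add: algebra_simps)
  ultimately show ?thesis by (rule prod_eqI[rotated])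
qed

lemma flatD0_linear: "x \<in> V \<Longrightarrow> smooth_on V s \<Longrightarrow> linear (\<lambda>X. flatD0 c X s x)"
proof -
  assume x: "x \<in> V" and s: "smooth_on V s"
  have "linear (fd (\<lambda>x. fst (s x)) x)" "linear (fd P x)" "linear (\<lambda>X. cov (\<lambda>x. snd (s x)) X x)"
    by (rule linear_fd[OF _ open_V x] linear_cov[OF x]; intro smooth_intros s P_smooth)+
  then show ?thesis
    by (intro linearI) (simp_all add: flatD0_def linear_add linear_scale gP_simps x
        linear_add[OF linear_cov[OF x smooth_on_snd[OF s]]]
        linear_scale[OF linear_cov[OF x smooth_on_snd[OF s]]] algebra_simps)
qed

lemma flatD0_add:
  "x \<in> V \<Longrightarrow> smooth_on V s \<Longrightarrow> smooth_on V t \<Longrightarrow>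
    flatD0 c X (\<lambda>x. s x + t x) x = flatD0 c X s x + flatD0 c X t x"
  by (simp add: flatD0_def fd_add[OF open_V] cov_add smooth_on_fst smooth_on_snd gP_simps algebra_simps)

lemma flatD0_scaleR:
  "x \<in> V \<Longrightarrow> smooth_on V f \<Longrightarrow> smooth_on V s \<Longrightarrow>
    flatD0 c X (\<lambda>x. f x *\<^sub>R s x) x = fd f x X *\<^sub>R s x + f x *\<^sub>R flatD0 c X s x"
  by (cases "s x") (simp add: flatD0_def fd_mult[OF open_V] cov_scaleR smooth_on_fst smooth_on_snd gP_simps algebra_simps)

lemma flatD0_cong: "x \<in> V \<Longrightarrow> (\<And>x. x \<in> V \<Longrightarrow> s x = t x) \<Longrightarrow> flatD0 c X s x = flatD0 c X t x"
  unfolding flatD0_def cov_def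
  using fd_cong[OF open_V, of x "\<lambda>x. fst (s x)" "\<lambda>x. fst (t x)"]
    fd_cong[OF open_V, of x "\<lambda>x. snd (s x)" "\<lambda>x. snd (t x)"] by simp

lemma flat_hermitian_flatD:
  assumes curv: "\<And>x u v w. x \<in> V \<Longrightarrow> riem (P x) u v w = c *\<^sub>R (g (P x) v w *\<^sub>R u - g (P x) u w *\<^sub>R v)"
    and \<sigma>: "smooth_on V \<sigma>" "\<And>x. x \<in> V \<Longrightarrow> hform c x (\<sigma> x) (\<sigma> x) = 1"
  shows "flat_hermitian V (hform c) times_i (flatD c) \<sigma>"
proof (rule flat_hermitian.intro)
  fix x v w assume x: "x \<in> V"
  show "hform c x v w = hform c x w v"
    using g_sym[OF P_mem[OF x]] by (simp add: hform_def mult.commute)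
  show "linear (hform c x v)"
    by (rule linearI) (simp_all add: hform_def gP_simps x algebra_simps)
  show "hform c x (times_i v) (times_i w) = hform c x v w"
    by (simp add: hform_def times_i_def gP_simps x)
next
  fix s t :: "'a \<Rightarrow> (real \<times> 'b) \<times> (real \<times> 'b)"
  assume s: "smooth_on V s" and t: "smooth_on V t"
  show "smooth_on V (\<lambda>x. hform c x (s x) (t x))"
    unfolding hform_def by (intro smooth_intros gP_smooth s t)
next
  show "linear times_i" by (rule linearI) (simp_all add: times_i_def)
  show "times_i (times_i v) = - v" for v by (cases v) (simp add: times_i_def)
next
  fix X and s :: "'a \<Rightarrow> (real \<times> 'b) \<times> (real \<times> 'b)"
  assume s: "smooth_on V s"
  show "smooth_on V (flatD c X s)"
    unfolding flatD_def by (intro smooth_on_Pair flatD0_smooth smooth_intros s)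
next
  fix x and s :: "'a \<Rightarrow> (real \<times> 'b) \<times> (real \<times> 'b)"
  assume x: "x \<in> V" and s: "smooth_on V s"
  have s': "smooth_on V (\<lambda>x. fst (s x))" "smooth_on V (\<lambda>x. snd (s x))" by (intro smooth_intros s)+
  show "linear (\<lambda>X. flatD c X s x)"
    by (intro linearI) (simp_all add: flatD_def
        linear_add[OF flatD0_linear[OF x s'(1)]] linear_add[OF flatD0_linear[OF x s'(2)]]
        linear_scale[OF flatD0_linear[OF x s'(1)]] linear_scale[OF flatD0_linear[OF x s'(2)]])
  show "flatD c X (\<lambda>x. times_i (s x)) x = times_i (flatD c X s x)" for X
    using flatD0_scaleR[OF x smooth_on_const s'(2), of c X "-1"] by (simp add: flatD_def times_i_def)
  show "flatD c X (flatD c Y s) x = flatD c Y (flatD c X s) x" for X Y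
    using flatD0_flat[OF x s'(1) curv[OF x]] flatD0_flat[OF x s'(2) curv[OF x]]
    by (simp add: flatD_def)
  show "flatD c X (\<lambda>x. s x + t x) x = flatD c X s x + flatD c X t x" if "smooth_on V t" for t :: "'a \<Rightarrow> (real \<times> 'b) \<times> (real \<times> 'b)" and X
    using flatD0_add[OF x s'(1) smooth_on_fst[OF that]] flatD0_add[OF x s'(2) smooth_on_snd[OF that]]
    by (simp add: flatD_def)
  show "flatD c X (\<lambda>x. f x *\<^sub>R s x) x = fd f x X *\<^sub>R s x + f x *\<^sub>R flatD c X s x" if "smooth_on V f" for f X
    using flatD0_scaleR[OF x that s'(1)] flatD0_scaleR[OF x that s'(2)]
    by (cases "s x") (simp add: flatD_def)
  show "fd (\<lambda>x. hform c x (s x) (t x)) x X = hform c x (flatD c X s x) (t x) + hform c x (s x) (flatD c X t x)"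
    if t: "smooth_on V t" for t :: "'a \<Rightarrow> (real \<times> 'b) \<times> (real \<times> 'b)" and X
  proof -
    have t': "smooth_on V (\<lambda>x. fst (t x))" "smooth_on V (\<lambda>x. snd (t x))" by (intro smooth_intros t)+
    show ?thesis
      unfolding hform_def
      by (subst fd_add[OF open_V x])
        (simp_all add: flatD0_metric[OF x s'(1) t'(1)] flatD0_metric[OF x s'(2) t'(2)] flatD_def
          smooth_on_add smooth_on_mult smooth_on_const smooth_on_fst smooth_on_snd gP_smooth s t)
  qed
next
  fix x X and s t :: "'a \<Rightarrow> (real \<times> 'b) \<times> (real \<times> 'b)"
  assume x: "x \<in> V" and st: "\<And>x. x \<in> V \<Longrightarrow> s x = t x"
  show "flatD c X s x = flatD c X t x"
    unfolding flatD_def using flatD0_cong[OF x, of "\<lambda>x. fst (s x)" "\<lambda>x. fst (t x)"]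
      flatD0_cong[OF x, of "\<lambda>x. snd (s x)" "\<lambda>x. snd (t x)"] st by simp
qed (use open_V \<sigma> in auto)

end


section \<open>The cotangent bundle as a manifold\<close>

lemma linear_vec:
  fixes l :: "real^'n::finite \<Rightarrow> real"
  assumes "linear l"
  shows "l v = (\<chi> i. l (axis i 1)) \<bullet> v"
proof -
  have "l v = l (\<Sum>i\<in>UNIV. (v $ i) *\<^sub>R axis i 1)"
    using basis_expansion[of v] by (simp add: scalar_mult_eq_scaleR)
  also have "\<dots> = (\<Sum>i\<in>UNIV. (v $ i) * l (axis i 1))"
    by (simp add: linear_sum[OF assms] linear_scale[OF assms])
  finally show ?thesis by (simp add: inner_vec_def mult.commute)
qed

lemma smooth_on_vec:
  fixes f :: "'a::real_normed_vector \<Rightarrow> real^'n::finite"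
  assumes "\<And>j. smooth_on S (\<lambda>x. f x $ j)"
  shows "smooth_on S f"
proof -
  have "smooth_on S (\<lambda>x. \<Sum>j\<in>UNIV. (f x $ j) *\<^sub>R axis j (1::real))"
    by (intro smooth_intros assms)
  then show ?thesis
    by (rule smooth_on_cong) (metis (no_types, lifting) basis_expansion scalar_mult_eq_scaleR sum.cong)
qed

context charted
begin

lemma openin_chart_preimage:
  assumes "\<phi> \<in> A" "open B"
  shows "openin (atlas_topology A) {p \<in> fst \<phi>. snd \<phi> p \<in> B}"
proof (rule openin_subset_chart[OF assms(1)])
  have "snd \<phi> ` {p \<in> fst \<phi>. snd \<phi> p \<in> B} = snd \<phi> ` fst \<phi> \<inter> B" by blast
  then show "open (snd \<phi> ` {p \<in> fst \<phi>. snd \<phi> p \<in> B})"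
    using chart_image_open[OF assms(1)] assms(2) by auto
qed blast

text \<open>A countable family of charts lifts directly to the cotangent bundle, which makes this
  the convenient form of second countability. From a base, one chart is chosen for each base set
  lying in some chart; conversely, countably many charts pull a countable base of the model space
  back to a base.\<close>

lemma second_countable_iff_countable_cover:
  "second_countable (atlas_topology A) \<longleftrightarrow> (\<exists>C\<subseteq>A. countable C \<and> carrier_of A \<subseteq> \<Union> (fst ` C))"
proof
  assume "second_countable (atlas_topology A)"
  then obtain \<B> where "countable \<B> \<and> (\<forall>V\<in>\<B>. openin (atlas_topology A) V) \<and>
      (\<forall>U x. openin (atlas_topology A) U \<and> x \<in> U \<longrightarrow> (\<exists>V\<in>\<B>. x \<in> V \<and> V \<subseteq> U))"
    unfolding second_countable_def ..
  then have \<B>: "countable \<B>"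
    "\<And>U x. openin (atlas_topology A) U \<Longrightarrow> x \<in> U \<Longrightarrow> \<exists>V\<in>\<B>. x \<in> V \<and> V \<subseteq> U"
    by simp_all
  define \<B>' where "\<B>' = {B \<in> \<B>. \<exists>\<phi>\<in>A. B \<subseteq> fst \<phi>}"
  define f where "f B = (SOME \<phi>. \<phi> \<in> A \<and> B \<subseteq> fst \<phi>)" for B
  have f: "f B \<in> A \<and> B \<subseteq> fst (f B)" if "B \<in> \<B>'" for B
  proof -
    have "\<exists>\<phi>. \<phi> \<in> A \<and> B \<subseteq> fst \<phi>" using that unfolding \<B>'_def by blast
    then show ?thesis unfolding f_def by (rule someI_ex)
  qed
  have "carrier_of A \<subseteq> \<Union> (fst ` f ` \<B>')"
  proof
    fix p assume "p \<in> carrier_of A"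
    then obtain \<phi> where \<phi>: "\<phi> \<in> A" "p \<in> fst \<phi>" by (auto simp: carrier_of_def)
    then obtain B where "B \<in> \<B>" "p \<in> B" "B \<subseteq> fst \<phi>"
      using \<B>(2)[OF openin_chart_domain] by blast
    then have "B \<in> \<B>'" "p \<in> B" using \<phi> by (auto simp: \<B>'_def)
    then show "p \<in> \<Union> (fst ` f ` \<B>')" using f by blast
  qed
  moreover have "f ` \<B>' \<subseteq> A" using f by blast
  moreover have "countable (f ` \<B>')"
    by (intro countable_image countable_subset[OF _ \<B>(1)]) (auto simp: \<B>'_def)
  ultimately show "\<exists>C\<subseteq>A. countable C \<and> carrier_of A \<subseteq> \<Union> (fst ` C)" by blast
next
  assume "\<exists>C\<subseteq>A. countable C \<and> carrier_of A \<subseteq> \<Union> (fst ` C)"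
  then obtain C where C: "C \<subseteq> A" "countable C" "carrier_of A \<subseteq> \<Union> (fst ` C)" by blast
  obtain \<E> :: "'e set set" where \<E>: "countable \<E>" "topological_basis \<E>"
    using ex_countable_basis by blast
  define b where "b = (\<lambda>(\<phi> :: ('p, 'e) chart, B). {p \<in> fst \<phi>. snd \<phi> p \<in> B})"
  show "second_countable (atlas_topology A)"
    unfolding second_countable_def
  proof (intro exI[of _ "b ` (C \<times> \<E>)"] conjI ballI allI impI)
    show "countable (b ` (C \<times> \<E>))" using C(2) \<E>(1) by blast
    show "openin (atlas_topology A) U" if "U \<in> b ` (C \<times> \<E>)" for U
      using that C(1) openin_chart_preimage topological_basis_open[OF \<E>(2)] by (auto simp: b_def)
    fix U p assume U: "openin (atlas_topology A) U \<and> p \<in> U"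
    then have "p \<in> carrier_of A" using openin_iff by blast
    then obtain \<phi> where \<phi>: "\<phi> \<in> C" "p \<in> fst \<phi>" using C(3) by blast
    then have \<phi>A: "\<phi> \<in> A" using C(1) by blast
    have "open (snd \<phi> ` (U \<inter> fst \<phi>))" using U \<phi>A open_subchart by blast
    then obtain B where B: "B \<in> \<E>" "snd \<phi> p \<in> B" "B \<subseteq> snd \<phi> ` (U \<inter> fst \<phi>)"
      using topological_basisE[OF \<E>(2)] U \<phi>(2) by (metis IntI imageI)
    have "b (\<phi>, B) \<subseteq> U"
      using B(3) chart_inj[OF \<phi>A] by (auto simp: b_def inj_on_def)
    moreover have "p \<in> b (\<phi>, B)" using \<phi>(2) B(2) by (simp add: b_def)
    ultimately show "\<exists>V\<in>b ` (C \<times> \<E>). p \<in> V \<and> V \<subseteq> U" using \<phi>(1) B(1) by blast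
  qed
qed

end

section \<open>Charts and topology of the cotangent bundle\<close>

locale cotangent = charted A for A :: "('m, real^'n::finite) atlas"
begin

abbreviation cc where "cc \<equiv> cotangent_chart A"

text \<open>The covector with components \<open>p\<close> in the chart \<phi>. The restriction
  produces the extensionality required by \<open>cotangent_space\<close>, so that equal components
  mean equal covectors.\<close>

definition covec :: "('m, real^'n) chart \<Rightarrow> 'm \<Rightarrow> real^'n \<Rightarrow> ('m, real^'n) tvec \<Rightarrow> real" where
  "covec \<phi> m p = restrict (\<lambda>u. p \<bullet> u \<phi>) (tangent_space A m)"

lemma fst_cc: "fst (cc \<phi>) = (SIGMA m : fst \<phi>. cotangent_space A m)"
  by (simp add: cotangent_chart_def)

lemma snd_cc: "snd (cc \<phi>) (m, w) = (snd \<phi> m, \<chi> i. w (coord_vec A \<phi> m (axis i 1)))"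
  by (simp add: cotangent_chart_def)

lemma covec_cotangent: "covec \<phi> m p \<in> cotangent_space A m"
  unfolding cotangent_space_def
  by (auto simp: covec_def lincomb_tangent) (simp add: lincomb_def inner_add_right)

lemma cotangent_apply:
  assumes w: "w \<in> cotangent_space A m" and \<phi>: "\<phi> \<in> A" "m \<in> fst \<phi>"
  shows "w = covec \<phi> m (\<chi> i. w (coord_vec A \<phi> m (axis i 1)))"
proof
  fix u
  show "w u = covec \<phi> m (\<chi> i. w (coord_vec A \<phi> m (axis i 1))) u"
  proof (cases "u \<in> tangent_space A m")
    case True
    have lin: "w (lincomb a u b v) = a * w u + b * w v"
      if "u \<in> tangent_space A m" "v \<in> tangent_space A m" for a b u v
      using w that unfolding cotangent_space_def by blast
    note lc = lin[OF coord_vec_tangent[OF \<phi>] coord_vec_tangent[OF \<phi>], unfolded coord_vec_lincomb[OF \<phi>]]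
    have "linear (\<lambda>v. w (coord_vec A \<phi> m v))"
    proof (rule linearI)
      show "w (coord_vec A \<phi> m (v + v')) = w (coord_vec A \<phi> m v) + w (coord_vec A \<phi> m v')" for v v'
        using lc[of 1 v 1 v'] by simp
      show "w (coord_vec A \<phi> m (r *\<^sub>R v)) = r *\<^sub>R w (coord_vec A \<phi> m v)" for r v
        using lc[of r v 0 v] by simp
    qed
    from linear_vec[OF this, of "u \<phi>"] show ?thesis
      using True by (simp add: covec_def coord_vec_of_tangent[OF _ \<phi>])
  next
    case False
    with w show ?thesis by (simp add: covec_def cotangent_space_def extensional_def)
  qed
qed

lemma snd_cc_covec:
  assumes "\<phi> \<in> A" "m \<in> fst \<phi>" "\<psi> \<in> A" "m \<in> fst \<psi>"
  shows "snd (cc \<psi>) (m, covec \<phi> m p) = (snd \<psi> m, \<chi> j. p \<bullet> fd (transition \<psi> \<phi>) (snd \<psi> m) (axis j 1))"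
  using assms by (simp add: snd_cc covec_def coord_vec_tangent coord_vec_apply)

lemma snd_cc_covec_self:
  assumes "\<phi> \<in> A" "m \<in> fst \<phi>"
  shows "snd (cc \<phi>) (m, covec \<phi> m p) = (snd \<phi> m, p)"
  using assms by (simp add: snd_cc_covec fd_transition_self inner_axis vec_eq_iff)

lemma cc_inj: "\<phi> \<in> A \<Longrightarrow> inj_on (snd (cc \<phi>)) (fst (cc \<phi>))"
proof (rule inj_onI, clarify)
  fix m w m' w'
  assume \<phi>: "\<phi> \<in> A" and mem: "(m, w) \<in> fst (cc \<phi>)" "(m', w') \<in> fst (cc \<phi>)"
    and e: "snd (cc \<phi>) (m, w) = snd (cc \<phi>) (m', w')"
  have m: "m \<in> fst \<phi>" "w \<in> cotangent_space A m" "m' \<in> fst \<phi>" "w' \<in> cotangent_space A m'"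
    using mem by (simp_all add: fst_cc)
  have "m = m'" using e chart_inj[OF \<phi>] m by (auto simp: snd_cc inj_on_def)
  moreover have "w = w'"
    using e cotangent_apply[OF m(2) \<phi> m(1)] cotangent_apply[OF m(4) \<phi> m(3)] \<open>m = m'\<close>
    by (simp add: snd_cc)
  ultimately show "m = m' \<and> w = w'" by blast
qed

lemma cc_image: "\<phi> \<in> A \<Longrightarrow> D \<subseteq> fst \<phi> \<Longrightarrow> snd (cc \<phi>) ` (SIGMA m : D. cotangent_space A m) = snd \<phi> ` D \<times> UNIV"
proof (rule antisym)
  assume \<phi>: "\<phi> \<in> A" and D: "D \<subseteq> fst \<phi>"
  show "snd (cc \<phi>) ` (SIGMA m : D. cotangent_space A m) \<subseteq> snd \<phi> ` D \<times> UNIV"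
    by (auto simp: snd_cc)
  show "snd \<phi> ` D \<times> UNIV \<subseteq> snd (cc \<phi>) ` (SIGMA m : D. cotangent_space A m)"
  proof clarify
    fix m p assume m: "m \<in> D"
    then have "(snd \<phi> m, p) = snd (cc \<phi>) (m, covec \<phi> m p)"
      using snd_cc_covec_self[OF \<phi> subsetD[OF D m]] by simp
    moreover have "(m, covec \<phi> m p) \<in> (SIGMA m : D. cotangent_space A m)"
      using m by (simp add: covec_cotangent)
    ultimately show "(snd \<phi> m, p) \<in> snd (cc \<phi>) ` (SIGMA m : D. cotangent_space A m)" by (rule image_eqI)
  qed
qed

lemma cc_image_domain: "\<phi> \<in> A \<Longrightarrow> snd (cc \<phi>) ` fst (cc \<phi>) = snd \<phi> ` fst \<phi> \<times> UNIV"
  unfolding fst_cc by (rule cc_image) auto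

lemma cc_overlap: "fst (cc \<phi>) \<inter> fst (cc \<psi>) = (SIGMA m : fst \<phi> \<inter> fst \<psi>. cotangent_space A m)"
  by (auto simp: fst_cc)

lemma chart_inv_cc:
  assumes "\<phi> \<in> A" "x \<in> snd \<phi> ` fst \<phi>"
  shows "chart_inv (cc \<phi>) (x, p) = (chart_inv \<phi> x, covec \<phi> (chart_inv \<phi> x) p)"
proof -
  obtain m where m: "m \<in> fst \<phi>" "x = snd \<phi> m" using assms(2) by blast
  have "chart_inv (cc \<phi>) (snd (cc \<phi>) (m, covec \<phi> m p)) = (m, covec \<phi> m p)"
    unfolding chart_inv_def
    by (rule inv_into_f_f[OF cc_inj[OF assms(1)]]) (simp add: fst_cc m covec_cotangent)
  then show ?thesis using assms(1) m by (simp add: snd_cc_covec_self)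
qed

text \<open>Covector components change by the transpose of the Jacobian of the inverse
  transition.\<close>

lemma transition_cc:
  assumes "\<phi> \<in> A" "\<psi> \<in> A" "x \<in> ov \<phi> \<psi>"
  shows "transition (cc \<phi>) (cc \<psi>) (x, p) = (transition \<phi> \<psi> x,
    \<chi> j. p \<bullet> fd (transition \<psi> \<phi>) (transition \<phi> \<psi> x) (axis j 1))"
proof -
  obtain m where m: "m \<in> fst \<phi>" "m \<in> fst \<psi>" "x = snd \<phi> m" using assms(3) by (auto simp: ov_def)
  have "transition (cc \<phi>) (cc \<psi>) (x, p) = snd (cc \<psi>) (chart_inv (cc \<phi>) (x, p))"
    by (simp add: transition_def)
  also have "chart_inv (cc \<phi>) (x, p) = (m, covec \<phi> m p)"
    using chart_inv_cc[OF assms(1), of x p] m assms(1) by simp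
  finally show ?thesis
    using assms m by (simp add: snd_cc_covec transition_snd)
qed

lemma cotangent_smooth_atlas: "smooth_atlas (cotangent_atlas A)"
  unfolding smooth_atlas_def cotangent_atlas_def
proof (intro conjI ballI; (elim imageE)?; hypsubst_thin)
  fix \<phi> assume \<phi>: "\<phi> \<in> A"
  show "inj_on (snd (cc \<phi>)) (fst (cc \<phi>))" by (rule cc_inj[OF \<phi>])
  show "open (snd (cc \<phi>) ` fst (cc \<phi>))"
    unfolding cc_image_domain[OF \<phi>] using chart_image_open[OF \<phi>] by (intro open_Times) auto
next
  fix \<phi> \<psi> assume \<phi>: "\<phi> \<in> A" and \<psi>: "\<psi> \<in> A"
  have im: "snd (cc \<phi>) ` (fst (cc \<phi>) \<inter> fst (cc \<psi>)) = ov \<phi> \<psi> \<times> UNIV"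
    unfolding cc_overlap ov_def by (rule cc_image[OF \<phi>]) auto
  show "open (snd (cc \<phi>) ` (fst (cc \<phi>) \<inter> fst (cc \<psi>)))"
    unfolding im using ov_open[OF \<phi> \<psi>] by (intro open_Times) auto
  show "smooth_on (snd (cc \<phi>) ` (fst (cc \<phi>) \<inter> fst (cc \<psi>))) (transition (cc \<phi>) (cc \<psi>))"
    unfolding im
  proof (rule smooth_on_cong)
    have T: "smooth_on (ov \<phi> \<psi> \<times> (UNIV :: (real^'n) set)) (\<lambda>z. transition \<phi> \<psi> (fst z))"
      by (rule smooth_on_compose[OF transition_smooth[OF \<phi> \<psi>]]) (auto intro: smooth_intros)
    have "smooth_on (ov \<phi> \<psi> \<times> (UNIV :: (real^'n) set))
        (\<lambda>z. fd (transition \<psi> \<phi>) (transition \<phi> \<psi> (fst z)) v)" for v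
      by (rule smooth_on_compose[OF smooth_on_fd[OF transition_smooth[OF \<psi> \<phi>] ov_open[OF \<psi> \<phi>]] T])
        (use transition_ov[OF \<phi>, of _ \<psi>] in auto)
    then have "smooth_on (ov \<phi> \<psi> \<times> (UNIV :: (real^'n) set))
        (\<lambda>z. \<chi> j. snd z \<bullet> fd (transition \<psi> \<phi>) (transition \<phi> \<psi> (fst z)) (axis j 1))"
      by (intro smooth_on_vec) (simp, intro smooth_intros)
    with T show "smooth_on (ov \<phi> \<psi> \<times> UNIV) (\<lambda>z. (transition \<phi> \<psi> (fst z),
        \<chi> j. snd z \<bullet> fd (transition \<psi> \<phi>) (transition \<phi> \<psi> (fst z)) (axis j 1)))"
      by (rule smooth_on_Pair)
  qed (auto simp: transition_cc[OF \<phi> \<psi>])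
qed

sublocale T: charted "cotangent_atlas A"
  by unfold_locales (rule cotangent_smooth_atlas)

lemma carrier_cotangent: "carrier_of (cotangent_atlas A) = (SIGMA m : carrier_of A. cotangent_space A m)"
  by (auto simp: carrier_of_def cotangent_atlas_def fst_cc)

lemma openin_over:
  assumes "openin (atlas_topology A) U"
  shows "openin (atlas_topology (cotangent_atlas A)) (SIGMA m : U. cotangent_space A m)"
  unfolding T.openin_iff
proof (intro conjI ballI)
  show "(SIGMA m : U. cotangent_space A m) \<subseteq> carrier_of (cotangent_atlas A)"
    using assms openin_iff unfolding carrier_cotangent by blast
  fix \<psi>' assume "\<psi>' \<in> cotangent_atlas A"
  then obtain \<psi> where \<psi>: "\<psi> \<in> A" "\<psi>' = cc \<psi>" by (auto simp: cotangent_atlas_def)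
  have "(SIGMA m : U. cotangent_space A m) \<inter> fst \<psi>' = (SIGMA m : U \<inter> fst \<psi>. cotangent_space A m)"
    unfolding \<psi>(2) fst_cc by blast
  then have "snd \<psi>' ` ((SIGMA m : U. cotangent_space A m) \<inter> fst \<psi>') = snd \<psi> ` (U \<inter> fst \<psi>) \<times> UNIV"
    unfolding \<psi>(2) using cc_image[OF \<psi>(1)] by simp
  then show "open (snd \<psi>' ` ((SIGMA m : U. cotangent_space A m) \<inter> fst \<psi>'))"
    using open_subchart[OF assms \<psi>(1)] by (simp add: open_Times)
qed

text \<open>Covectors at different base points are separated by preimages of open sets of the base;
  two covectors at the same point lie in a common chart and are separated there.\<close>

lemma cotangent_Hausdorff:
  assumes H: "Hausdorff_space (atlas_topology A)"
  shows "Hausdorff_space (atlas_topology (cotangent_atlas A))"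
  unfolding Hausdorff_space_def T.topspace_atlas
proof (intro allI impI)
  fix z z' assume a: "z \<in> carrier_of (cotangent_atlas A) \<and> z' \<in> carrier_of (cotangent_atlas A) \<and> z \<noteq> z'"
  obtain m w m' w' where z: "z = (m, w)" "z' = (m', w')" by (cases z, cases z') auto
  have mem: "m \<in> carrier_of A" "m' \<in> carrier_of A" "w \<in> cotangent_space A m" "w' \<in> cotangent_space A m'"
    using a by (auto simp: z carrier_cotangent)
  let ?T = "atlas_topology (cotangent_atlas A)"
  show "\<exists>U V. openin ?T U \<and> openin ?T V \<and> z \<in> U \<and> z' \<in> V \<and> disjnt U V"
  proof (cases "m = m'")
    case False
    then obtain U V where UV: "openin (atlas_topology A) U" "openin (atlas_topology A) V"
      "m \<in> U" "m' \<in> V" "disjnt U V"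
      using H mem unfolding Hausdorff_space_def topspace_atlas by blast
    have "disjnt (SIGMA m : U. cotangent_space A m) (SIGMA m : V. cotangent_space A m)"
      using UV(5) by (auto simp: disjnt_def)
    then show ?thesis
      using openin_over[OF UV(1)] openin_over[OF UV(2)] UV(3,4) mem(3,4) unfolding z by blast
  next
    case True
    obtain \<phi> where \<phi>: "\<phi> \<in> A" "m \<in> fst \<phi>" using mem(1) by (auto simp: carrier_of_def)
    have zz: "z \<in> fst (cc \<phi>)" "z' \<in> fst (cc \<phi>)" using \<phi> mem True by (auto simp: z fst_cc)
    then have "snd (cc \<phi>) z \<noteq> snd (cc \<phi>) z'" using cc_inj[OF \<phi>(1)] a by (auto dest: inj_onD)
    then obtain B B' where B: "open B" "open B'" "snd (cc \<phi>) z \<in> B" "snd (cc \<phi>) z' \<in> B'" "B \<inter> B' = {}"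
      using hausdorff by metis
    have \<phi>': "cc \<phi> \<in> cotangent_atlas A" using \<phi> by (auto simp: cotangent_atlas_def)
    have "disjnt {p \<in> fst (cc \<phi>). snd (cc \<phi>) p \<in> B} {p \<in> fst (cc \<phi>). snd (cc \<phi>) p \<in> B'}"
      using B(5) by (auto simp: disjnt_def)
    then show ?thesis
      using T.openin_chart_preimage[OF \<phi>' B(1)] T.openin_chart_preimage[OF \<phi>' B(2)] zz B(3,4) by blast
  qed
qed

lemma cotangent_second_countable:
  assumes "second_countable (atlas_topology A)"
  shows "second_countable (atlas_topology (cotangent_atlas A))"
proof -
  obtain C where C: "C \<subseteq> A" "countable C" "carrier_of A \<subseteq> \<Union> (fst ` C)"
    using assms second_countable_iff_countable_cover by auto
  have "carrier_of (cotangent_atlas A) \<subseteq> \<Union> (fst ` cc ` C)"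
    using C(3) by (auto simp: carrier_cotangent fst_cc)
  moreover have "cc ` C \<subseteq> cotangent_atlas A" using C(1) by (auto simp: cotangent_atlas_def)
  ultimately show ?thesis
    unfolding T.second_countable_iff_countable_cover using C(2) by blast
qed

lemma cotangent_manifold: "smooth_manifold A \<Longrightarrow> smooth_manifold (cotangent_atlas A)"
  unfolding smooth_manifold_def
  using cotangent_smooth_atlas cotangent_Hausdorff cotangent_second_countable by blast

end


section \<open>Kaehler and Einstein conditions in charts\<close>

lemma trace_commute:
  fixes l m :: "'a::euclidean_space \<Rightarrow> 'a"
  assumes l: "linear l" and m: "linear m"
  shows "(\<Sum>b\<in>Basis. l (m b) \<bullet> b) = (\<Sum>b\<in>Basis. m (l b) \<bullet> b)"
proof -
  have e: "(\<Sum>b\<in>Basis. l (m b) \<bullet> b) = (\<Sum>b\<in>Basis. \<Sum>b'\<in>Basis. (m b \<bullet> b') * (l b' \<bullet> b))"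
    if "linear l" for l m :: "'a \<Rightarrow> 'a"
    using linear_basis_sum[OF that, of "m _"] by (simp add: inner_sum_left)
  show ?thesis
    unfolding e[OF l] e[OF m] by (subst sum.swap) (simp add: mult.commute)
qed

context local_metric
begin

text \<open>An isometry with square -1 is skew for \<open>g\<close>. Conjugating \<open>j\<close>
  with \<open>lower\<close> therefore gives minus its Euclidean adjoint, so the trace equals its own
  negative.\<close>

lemma trace_complex_structure:
  assumes x: "x \<in> U" and j: "linear j" "\<And>v. j (j v) = - v" "\<And>u v. g x (j u) (j v) = g x u v"
  shows "(\<Sum>b\<in>Basis. j b \<bullet> b) = 0"
proof -
  let ?S = "lower x"
  define K where "K = inv ?S"
  have S: "linear ?S" "inj ?S" by (simp_all add: linear_lower inj_lower x)
  then have K: "linear K" "\<And>v. K (?S v) = v" "\<And>v. ?S (K v) = v"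
    unfolding K_def
    by (simp_all add: inj_linear_imp_inv_linear linear_injective_imp_surjective surj_f_inv_f)
  have adj: "linear (adjoint j)" "\<And>u v. adjoint j u \<bullet> v = u \<bullet> j v"
    using adjoint_linear[OF j(1)] adjoint_works[OF j(1)] by (simp_all add: inner_commute)
  have "?S (j u) = - adjoint j (?S u)" for u
  proof (rule euclidean_eqI)
    fix b :: 'b
    have "g x (j u) b = - g x u (j b)"
      using j(3)[of "j u" b] j(2)[of u] linear_neg[OF g_linear_left[OF x], of u "j b"] by simp
    then show "?S (j u) \<bullet> b = - adjoint j (?S u) \<bullet> b" by (simp add: lower_inner x adj(2))
  qed
  then have "j b = - K (adjoint j (?S b))" for b
    using K(2)[of "j b"] linear_neg[OF K(1)] by metis
  then have "(\<Sum>b\<in>Basis. j b \<bullet> b) = - (\<Sum>b\<in>Basis. K (adjoint j (?S b)) \<bullet> b)"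
    by (simp add: sum_negf[symmetric])
  also have "(\<Sum>b\<in>Basis. K (adjoint j (?S b)) \<bullet> b) = (\<Sum>b\<in>Basis. adjoint j b \<bullet> b)"
    using trace_commute[OF K(1) linear_compose[OF S(1) adj(1)]] by (simp add: K(3) o_def)
  also have "\<dots> = (\<Sum>b\<in>Basis. j b \<bullet> b)" unfolding adj(2) by (simp add: inner_commute)
  finally show ?thesis by simp
qed

end

locale almost_hermitian = riemannian_atlas A g
  for A :: "('p, 'e::euclidean_space) atlas" and g +
  fixes J :: "('p, 'e) endo"
  assumes acs: "almost_complex_structure A J"
    and compat: "\<lbrakk>p \<in> carrier_of A; u \<in> tangent_space A p; v \<in> tangent_space A p\<rbrakk> \<Longrightarrow>
      g p (J p u) (J p v) = g p u v"
begin

definition Jl :: "('p, 'e) chart \<Rightarrow> 'e \<Rightarrow> 'e \<Rightarrow> 'e" where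
  "Jl \<phi> x v = J (chart_inv \<phi> x) (coord_vec A \<phi> (chart_inv \<phi> x) v) \<phi>"

lemma J_tangent: "p \<in> carrier_of A \<Longrightarrow> u \<in> tangent_space A p \<Longrightarrow> J p u \<in> tangent_space A p"
  using acs unfolding almost_complex_structure_def linear_endo_on_def by blast

lemma J_lincomb:
  "\<lbrakk>p \<in> carrier_of A; u \<in> tangent_space A p; v \<in> tangent_space A p\<rbrakk> \<Longrightarrow>
    J p (lincomb a u b v) = lincomb a (J p u) b (J p v)"
  using acs unfolding almost_complex_structure_def linear_endo_on_def by blast

lemma J_J: "p \<in> carrier_of A \<Longrightarrow> u \<in> tangent_space A p \<Longrightarrow> J p (J p u) = (\<lambda>\<phi>. - u \<phi>)"
  using acs unfolding almost_complex_structure_def by blast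

lemma J_apply: "\<lbrakk>\<phi> \<in> A; p \<in> fst \<phi>; u \<in> tangent_space A p\<rbrakk> \<Longrightarrow> J p u \<phi> = Jl \<phi> (snd \<phi> p) (u \<phi>)"
  by (simp add: Jl_def coord_vec_of_tangent)

lemma Jl_smooth: "\<phi> \<in> A \<Longrightarrow> smooth_on (snd \<phi> ` fst \<phi>) (\<lambda>x. Jl \<phi> x v)"
proof -
  assume \<phi>: "\<phi> \<in> A"
  then have "(\<lambda>p. J p (coord_vec A \<phi> p v)) \<in> smooth_fields A (fst \<phi>)"
    using acs unfolding almost_complex_structure_def by blast
  from smooth_fields_smooth[OF this \<phi>] show ?thesis by (simp add: Jl_def)
qed

lemma Jl_at: "\<phi> \<in> A \<Longrightarrow> p \<in> fst \<phi> \<Longrightarrow> Jl \<phi> (snd \<phi> p) v = J p (coord_vec A \<phi> p v) \<phi>"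
  by (simp add: Jl_def)

lemma carrierI: "\<phi> \<in> A \<Longrightarrow> p \<in> fst \<phi> \<Longrightarrow> p \<in> carrier_of A"
  by (auto simp: carrier_of_def)

lemma Jl_linear: "\<phi> \<in> A \<Longrightarrow> x \<in> snd \<phi> ` fst \<phi> \<Longrightarrow> linear (Jl \<phi> x)"
proof -
  assume \<phi>: "\<phi> \<in> A" and "x \<in> snd \<phi> ` fst \<phi>"
  then obtain p where p: "p \<in> fst \<phi>" "x = snd \<phi> p" by blast
  note t = coord_vec_tangent[OF \<phi> p(1)]
  have *: "Jl \<phi> x (a *\<^sub>R v + b *\<^sub>R w) = a *\<^sub>R Jl \<phi> x v + b *\<^sub>R Jl \<phi> x w" for a b v w
    unfolding p(2) Jl_at[OF \<phi> p(1)] coord_vec_lincomb[OF \<phi> p(1), symmetric]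
      J_lincomb[OF carrierI[OF \<phi> p(1)] t t] by (simp only: lincomb_def)
  show ?thesis
  proof (rule linearI)
    show "Jl \<phi> x (v + w) = Jl \<phi> x v + Jl \<phi> x w" for v w using *[of 1 v 1 w] by simp
    show "Jl \<phi> x (r *\<^sub>R v) = r *\<^sub>R Jl \<phi> x v" for r v using *[of r v 0 v] by simp
  qed
qed

lemma Jl_Jl: "\<phi> \<in> A \<Longrightarrow> x \<in> snd \<phi> ` fst \<phi> \<Longrightarrow> Jl \<phi> x (Jl \<phi> x v) = - v"
proof -
  assume \<phi>: "\<phi> \<in> A" and "x \<in> snd \<phi> ` fst \<phi>"
  then obtain p where p: "p \<in> fst \<phi>" "x = snd \<phi> p" by blast
  note t = coord_vec_tangent[OF \<phi> p(1)] and pc = carrierI[OF \<phi> p(1)]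
  have "Jl \<phi> x (Jl \<phi> x v) = J p (J p (coord_vec A \<phi> p v)) \<phi>"
    by (simp add: J_apply[OF \<phi> p(1)] J_tangent[OF pc] t p(2) coord_vec_same[OF \<phi> p(1)])
  then show ?thesis by (simp add: J_J[OF pc t] coord_vec_same[OF \<phi> p(1)])
qed

lemma Jl_gl: "\<phi> \<in> A \<Longrightarrow> x \<in> snd \<phi> ` fst \<phi> \<Longrightarrow> gl \<phi> x (Jl \<phi> x u) (Jl \<phi> x v) = gl \<phi> x u v"
proof -
  assume \<phi>: "\<phi> \<in> A" and "x \<in> snd \<phi> ` fst \<phi>"
  then obtain p where p: "p \<in> fst \<phi>" "x = snd \<phi> p" by blast
  note t = coord_vec_tangent[OF \<phi> p(1)] and pc = carrierI[OF \<phi> p(1)]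
  show ?thesis
    using compat[OF pc t t, of u v] g_tangent[OF \<phi> p(1) t t, of u v]
      g_tangent[OF \<phi> p(1) J_tangent[OF pc t] J_tangent[OF pc t], of u v]
    by (simp add: p(2) Jl_at[OF \<phi> p(1)] coord_vec_same[OF \<phi> p(1)])
qed

lemma J_field:
  assumes W: "openin (atlas_topology A) W" and Y: "Y \<in> smooth_fields A W"
  shows "(\<lambda>q. J q (Y q)) \<in> smooth_fields A W"
proof -
  have WA: "W \<subseteq> carrier_of A" using W openin_iff by blast
  have "smooth_on (snd \<phi> ` (W \<inter> fst \<phi>)) (\<lambda>x. J (chart_inv \<phi> x) (Y (chart_inv \<phi> x)) \<phi>)" if \<phi>: "\<phi> \<in> A" for \<phi>
  proof (rule smooth_on_cong)
    show "smooth_on (snd \<phi> ` (W \<inter> fst \<phi>)) (\<lambda>x. Jl \<phi> x (loc \<phi> Y x))"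
      by (rule smooth_on_linear_family[OF Jl_linear[OF \<phi>] smooth_on_subset[OF Jl_smooth[OF \<phi>]]
            smooth_fields_smooth[OF Y \<phi>]]) auto
  qed (use \<phi> in \<open>auto simp: J_apply smooth_fields_tangent[OF Y]\<close>)
  then show ?thesis
    using J_tangent WA smooth_fields_tangent[OF Y] by (auto simp: smooth_fields_def)
qed

end

text \<open>The assumption says that the covariant derivative of \<open>J\<close> vanishes,
  evaluated on constant fields of a chart.\<close>

locale parallel_complex = almost_hermitian A g J
  for A :: "('p, 'e::euclidean_space) atlas" and g J +
  assumes parallel: "\<lbrakk>\<phi> \<in> A; x \<in> snd \<phi> ` fst \<phi>\<rbrakk> \<Longrightarrow>
    fd (\<lambda>x. Jl \<phi> x v) x u + chr \<phi> x u (Jl \<phi> x v) = Jl \<phi> x (chr \<phi> x u v)"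
begin

lemma nabla_J:
  assumes W: "openin (atlas_topology A) W" and p: "p \<in> W"
    and X: "X \<in> smooth_fields A W" and Y: "Y \<in> smooth_fields A W"
  shows "nabla X (\<lambda>q. J q (Y q)) p = J p (nabla X Y p)"
proof -
  have pc: "p \<in> carrier_of A" using W p openin_iff by blast
  obtain \<phi> where \<phi>: "\<phi> \<in> A" "p \<in> fst \<phi>" using pc by (auto simp: carrier_of_def)
  have t: "nabla X (\<lambda>q. J q (Y q)) p \<in> tangent_space A p" "nabla X Y p \<in> tangent_space A p"
    by (rule nabla_tangent[OF W p X]; intro J_field[OF W] Y)+
  let ?V = "snd \<phi> ` (W \<inter> fst \<phi>)" and ?x = "snd \<phi> p"
  have V: "open ?V" "?x \<in> ?V" "?V \<subseteq> snd \<phi> ` fst \<phi>" using open_subchart[OF W \<phi>(1)] p \<phi> by blast+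
  have x: "?x \<in> snd \<phi> ` fst \<phi>" using \<phi> by blast
  have l: "linear (Jl \<phi> ?x)" by (rule Jl_linear[OF \<phi>(1) x])
  have "fd (\<lambda>x. J (chart_inv \<phi> x) (Y (chart_inv \<phi> x)) \<phi>) ?x u = fd (\<lambda>x. Jl \<phi> x (loc \<phi> Y x)) ?x u" for u
    by (rule fd_cong[OF V(1,2), THEN fun_cong])
      (use \<phi> in \<open>auto simp: J_apply smooth_fields_tangent[OF Y]\<close>)
  also have "\<And>u. fd (\<lambda>x. Jl \<phi> x (loc \<phi> Y x)) ?x u =
      fd (\<lambda>x. Jl \<phi> x (loc \<phi> Y ?x)) ?x u + Jl \<phi> ?x (fd (loc \<phi> Y) ?x u)"
    by (rule fd_linear_family[OF V(1,2) Jl_linear[OF \<phi>(1)] smooth_on_subset[OF Jl_smooth[OF \<phi>(1)] V(3)]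
          smooth_fields_smooth[OF Y \<phi>(1)]]) (use V(3) in blast)
  finally have "nabla X (\<lambda>q. J q (Y q)) p \<phi> = fd (\<lambda>x. Jl \<phi> x (Y p \<phi>)) ?x (X p \<phi>)
      + Jl \<phi> ?x (fd (loc \<phi> Y) ?x (X p \<phi>)) + chr \<phi> ?x (X p \<phi>) (Jl \<phi> ?x (Y p \<phi>))"
    using \<phi> by (simp add: nabla_apply J_apply smooth_fields_tangent[OF Y p])
  also have "\<dots> = Jl \<phi> ?x (fd (loc \<phi> Y) ?x (X p \<phi>)) + Jl \<phi> ?x (chr \<phi> ?x (X p \<phi>) (Y p \<phi>))"
    using parallel[OF \<phi>(1) x, of "Y p \<phi>" "X p \<phi>"] by simp
  also have "\<dots> = J p (nabla X Y p) \<phi>"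
    using \<phi> by (simp add: J_apply t(2) nabla_apply linear_add[OF l])
  finally show ?thesis by (rule tangent_eqI[OF t(1) J_tangent[OF pc t(2)] \<phi>])
qed

lemma g_J: "\<lbrakk>p \<in> carrier_of A; u \<in> tangent_space A p; v \<in> tangent_space A p\<rbrakk> \<Longrightarrow>
    g p u (J p v) = - g p v (J p u)"
proof -
  assume a: "p \<in> carrier_of A" "u \<in> tangent_space A p" "v \<in> tangent_space A p"
  note t = J_tangent[OF a(1)]
  have "J p (J p v) = lincomb (-1) v 0 v" by (simp add: J_J a lincomb_def)
  then have "g p (J p u) (lincomb (-1) v 0 v) = g p u (J p v)"
    using compat[OF a(1) a(2) t[OF a(3)]] by simp
  then show ?thesis
    using g_commute[OF a(1) t[OF a(2)] lincomb_tangent[OF a(3) a(3)], of "-1" 0]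
      g_lincomb[OF a(1) a(3) a(3) t[OF a(2)], of "-1" 0] by simp
qed

text \<open>Torsion-freeness expresses all four brackets by covariant derivatives, and a parallel
  \<open>J\<close> can be moved out of each of them. The terms then cancel in pairs.\<close>

lemma integrable: "integrable_structure A J"
  unfolding integrable_structure_def Let_def
proof (intro allI impI ballI)
  fix W X Y p \<phi>
  assume W: "openin (atlas_topology A) W" and X: "X \<in> smooth_fields A W"
    and Y: "Y \<in> smooth_fields A W" and p: "p \<in> W"
  have pc: "p \<in> carrier_of A" using W p openin_iff by blast
  let ?JX = "\<lambda>q. J q (X q)" and ?JY = "\<lambda>q. J q (Y q)"
  have JX: "?JX \<in> smooth_fields A W" and JY: "?JY \<in> smooth_fields A W"
    by (rule J_field[OF W]; fact)+
  note t = nabla_tangent[OF W p] and n = nabla_J[OF W p]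
  note tor = nabla_torsion[OF p, symmetric]
  have 1: "lie_bracket A ?JX ?JY p = lincomb 1 (J p (nabla ?JX Y p)) (-1) (J p (nabla ?JY X p))"
    unfolding tor[OF JX JY] n[OF JX Y] n[OF JY X] ..
  have 2: "J p (lie_bracket A ?JX Y p) = lincomb 1 (J p (nabla ?JX Y p)) (-1) (J p (J p (nabla Y X p)))"
    unfolding tor[OF JX Y] n[OF Y X] by (rule J_lincomb[OF pc t[OF JX Y] J_tangent[OF pc t[OF Y X]]])
  have 3: "J p (lie_bracket A X ?JY p) = lincomb 1 (J p (J p (nabla X Y p))) (-1) (J p (nabla ?JY X p))"
    unfolding tor[OF X JY] n[OF X Y] by (rule J_lincomb[OF pc J_tangent[OF pc t[OF X Y]] t[OF JY X]])
  show "lie_bracket A ?JX ?JY p \<phi> - J p (lie_bracket A ?JX Y p) \<phi> - J p (lie_bracket A X ?JY p) \<phi>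
      - lie_bracket A X Y p \<phi> = 0"
    unfolding 1 2 3 tor[OF X Y] J_J[OF pc t[OF X Y]] J_J[OF pc t[OF Y X]]
    by (simp add: lincomb_def)
qed

text \<open>The exterior derivative of a form is the alternation of its covariant derivative, which
  is zero as both \<open>g\<close> and \<open>J\<close> are parallel. The identities
  \<open>d\<close> and \<open>b\<close> carry this out for the fundamental form.\<close>

lemma closed: "closed_2form A (\<lambda>p u v. g p u (J p v))"
  unfolding closed_2form_def
proof (intro allI impI ballI)
  fix W X Y Z p
  assume W: "openin (atlas_topology A) W" and X: "X \<in> smooth_fields A W"
    and Y: "Y \<in> smooth_fields A W" and Z: "Z \<in> smooth_fields A W" and p: "p \<in> W"
  have pc: "p \<in> carrier_of A" using W p openin_iff by blast
  note t = nabla_tangent[OF W p] and tf = smooth_fields_tangent[OF _ p] and tJ = J_tangent[OF pc]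
  have d: "dir_deriv A p (X p) (\<lambda>q. g q (Y q) (J q (Z q))) =
      g p (nabla X Y p) (J p (Z p)) - g p (nabla X Z p) (J p (Y p))"
    if X: "X \<in> smooth_fields A W" and Y: "Y \<in> smooth_fields A W" and Z: "Z \<in> smooth_fields A W" for X Y Z
    using nabla_metric[OF W p X Y J_field[OF W Z]] nabla_J[OF W p X Z] g_J[OF pc tf[OF Y] t[OF X Z]] by simp
  have b: "g p (lie_bracket A X Y p) (J p (Z p)) = g p (nabla X Y p) (J p (Z p)) - g p (nabla Y X p) (J p (Z p))"
    if X: "X \<in> smooth_fields A W" and Y: "Y \<in> smooth_fields A W" and Z: "Z \<in> smooth_fields A W" for X Y Z
    using g_lincomb[OF pc t[OF X Y] t[OF Y X] tJ[OF tf[OF Z]], of 1 "-1"]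
    by (simp add: nabla_torsion[OF p X Y])
  show "dir_deriv A p (X p) (\<lambda>q. g q (Y q) (J q (Z q))) - dir_deriv A p (Y p) (\<lambda>q. g q (X q) (J q (Z q)))
      + dir_deriv A p (Z p) (\<lambda>q. g q (X q) (J q (Y q))) - g p (lie_bracket A X Y p) (J p (Z p))
      + g p (lie_bracket A X Z p) (J p (Y p)) - g p (lie_bracket A Y Z p) (J p (X p)) = 0"
    unfolding d[OF X Y Z] d[OF Y X Z] d[OF Z X Y] b[OF X Y Z] b[OF X Z Y] b[OF Y Z X] by simp
qed

lemma kaehler: "smooth_manifold A \<Longrightarrow> kaehler_manifold A g J"
  unfolding kaehler_manifold_def riemannian_manifold_def
  using riemannian acs integrable closed compat by blast

end

section \<open>Constant holomorphic sectional curvature and the Einstein condition\<close>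

locale constant_holomorphic = almost_hermitian A g J
  for A :: "('p, 'e::euclidean_space) atlas" and g J +
  fixes k :: real
  assumes riem_k: "\<lbrakk>\<phi> \<in> A; x \<in> snd \<phi> ` fst \<phi>\<rbrakk> \<Longrightarrow> local_metric.riem (gl \<phi>) x u v w =
    (k / 4) *\<^sub>R (gl \<phi> x w v *\<^sub>R u - gl \<phi> x w u *\<^sub>R v + gl \<phi> x w (Jl \<phi> x v) *\<^sub>R Jl \<phi> x u
      - gl \<phi> x w (Jl \<phi> x u) *\<^sub>R Jl \<phi> x v + (2 * gl \<phi> x u (Jl \<phi> x v)) *\<^sub>R Jl \<phi> x w)"
begin

lemma constant_holomorphic: "constant_holomorphic_sectional_curvature A g J k"
  unfolding constant_holomorphic_sectional_curvature_def Let_def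
proof (intro allI impI ballI ext)
  fix W X Y Z p \<phi>
  assume W: "openin (atlas_topology A) W" and X: "X \<in> smooth_fields A W"
    and Y: "Y \<in> smooth_fields A W" and Z: "Z \<in> smooth_fields A W" and p: "p \<in> W"
  have pc: "p \<in> carrier_of A" using W p openin_iff by blast
  note tf = smooth_fields_tangent[OF _ p] and tJ = J_tangent[OF pc]
  show "curvature A g X Y Z p \<phi> = (k / 4) *\<^sub>R
      (g p (Z p) (Y p) *\<^sub>R X p \<phi> - g p (Z p) (X p) *\<^sub>R Y p \<phi>
       + g p (Z p) (J p (Y p)) *\<^sub>R J p (X p) \<phi> - g p (Z p) (J p (X p)) *\<^sub>R J p (Y p) \<phi>
       + (2 * g p (X p) (J p (Y p))) *\<^sub>R J p (Z p) \<phi>)"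
  proof (cases "\<phi> \<in> charts_at A p")
    case True
    then have \<phi>: "\<phi> \<in> A" "p \<in> fst \<phi>" by (simp_all add: charts_at_iff)
    show ?thesis
      using \<phi>(2) unfolding curvature_apply[OF W p \<phi> X Y Z]
      by (simp add: riem_k[OF \<phi>(1)] g_tangent[OF \<phi>] tf[OF X] tf[OF Y] tf[OF Z] tJ J_apply[OF \<phi>])
  next
    case False
    then show ?thesis
      using tangent_off_chart[OF curvature_tangent[OF W p X Y Z]] tangent_off_chart[OF tf[OF X]]
        tangent_off_chart[OF tf[OF Y]] tangent_off_chart[OF tJ[OF tf[OF X]]]
        tangent_off_chart[OF tJ[OF tf[OF Y]]] tangent_off_chart[OF tJ[OF tf[OF Z]]] by simp
  qed
qed

text \<open>The terms of the curvature formula contribute DIM - 1 + 0 + 1 + 2 times g(v, w), where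
  the 0 is the trace of \<open>J\<close>. With real dimension 2n the Einstein constant is k (n + 1)
  / 2.\<close>

lemma trace_riem:
  assumes \<phi>: "\<phi> \<in> A" and x: "x \<in> snd \<phi> ` fst \<phi>"
  shows "(\<Sum>b\<in>Basis. local_metric.riem (gl \<phi>) x b v w \<bullet> b) = k / 4 * (DIM('e) + 2) * gl \<phi> x v w"
proof -
  interpret local_metric "snd \<phi> ` fst \<phi>" "gl \<phi>" by (rule local_metric_gl[OF \<phi>])
  define j where "j = Jl \<phi> x"
  define G where "G = gl \<phi> x"
  have j: "linear j" "\<And>v. j (j v) = - v" "\<And>u v. G (j u) (j v) = G u v"
    using Jl_linear[OF \<phi> x] Jl_Jl[OF \<phi> x] Jl_gl[OF \<phi> x] by (simp_all add: j_def G_def)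
  have G: "linear (G u)" "linear (\<lambda>u. G u v)" "G u v = G v u" for u v
    unfolding G_def by (rule g_linear[OF x] g_linear_left[OF x] g_sym[OF x])+
  have ex: "l u = (\<Sum>b\<in>Basis. l b * (u \<bullet> b))" if "linear l" for l :: "'e \<Rightarrow> real" and u
    using linear_basis_sum[OF that, of u] by (simp add: mult.commute)
  have lj: "linear (\<lambda>b. G w (j b))" using linear_compose[OF j(1) G(1)[of w]] by (simp add: o_def)
  have tr: "(\<Sum>b\<in>Basis. j b \<bullet> b) = 0"
    by (rule trace_complex_structure[OF x j(1,2)]) (use j(3) in \<open>simp add: G_def\<close>)
  have "(\<Sum>b\<in>Basis. local_metric.riem (gl \<phi>) x b v w \<bullet> b) =
      (\<Sum>b\<in>Basis. k / 4 * (G w v - G w b * (v \<bullet> b) + G w (j v) * (j b \<bullet> b)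
        - G w (j b) * (j v \<bullet> b) + 2 * (G b (j v) * (j w \<bullet> b))))"
    by (intro sum.cong refl, subst riem_k[OF \<phi> x])
      (simp add: j_def G_def inner_add_left inner_diff_left algebra_simps)
  also have "\<dots> = k / 4 * (DIM('e) * G w v - G w v + G w (j v) * (\<Sum>b\<in>Basis. j b \<bullet> b)
      - G w (j (j v)) + 2 * G (j w) (j v))"
    by (simp only: sum_distrib_left[symmetric] sum.distrib sum_subtractf sum_constant
        ex[OF G(1), symmetric] ex[OF lj, symmetric] ex[OF G(2), symmetric])
  also have "\<dots> = k / 4 * (DIM('e) + 2) * G v w"
    using G(3)[of w v] linear_neg[OF G(1), of w v] by (simp add: tr j algebra_simps)
  finally show ?thesis by (simp add: G_def)
qed

lemma einstein: "einstein A g"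
  unfolding einstein_def
proof (intro exI[of _ "k / 4 * (DIM('e) + 2)"] allI impI ballI)
  fix W Y Z p
  assume W: "openin (atlas_topology A) W" and Y: "Y \<in> smooth_fields A W"
    and Z: "Z \<in> smooth_fields A W" and p: "p \<in> W"
  have pc: "p \<in> carrier_of A" using W p openin_iff by blast
  define \<phi> where "\<phi> = chart_at A p"
  have \<phi>: "\<phi> \<in> A" "p \<in> fst \<phi>" unfolding \<phi>_def by (rule chart_at_charts[OF pc])+
  \<comment> \<open>\<open>ricci\<close> traces over the coordinate fields of the chosen chart,
    which are smooth only on its domain.\<close>
  have W': "openin (atlas_topology A) (W \<inter> fst \<phi>)" "p \<in> W \<inter> fst \<phi>"
    using W openin_chart_domain[OF \<phi>(1)] p \<phi> by auto
  have s: "coord_field A \<phi> b \<in> smooth_fields A (W \<inter> fst \<phi>)" "Y \<in> smooth_fields A (W \<inter> fst \<phi>)"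
    "Z \<in> smooth_fields A (W \<inter> fst \<phi>)" for b
    using smooth_fields_subset coord_field_smooth[OF \<phi>(1)] Y Z by blast+
  have x: "snd \<phi> p \<in> snd \<phi> ` fst \<phi>" using \<phi> by blast
  have "ricci A g Y Z p = (\<Sum>b\<in>Basis. local_metric.riem (gl \<phi>) (snd \<phi> p) b (Y p \<phi>) (Z p \<phi>) \<bullet> b)"
    unfolding ricci_def Let_def \<phi>_def[symmetric] curvature_apply[OF W' \<phi> s(1,2,3)]
    by (simp add: coord_field_def coord_vec_same[OF \<phi>])
  also have "\<dots> = k / 4 * (DIM('e) + 2) * g p (Y p) (Z p)"
    unfolding trace_riem[OF \<phi>(1) x]
    using g_tangent[OF \<phi> smooth_fields_tangent[OF Y p] smooth_fields_tangent[OF Z p]] by simp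
  finally show "ricci A g Y Z p = k / 4 * (DIM('e) + 2) * g p (Y p) (Z p)" .
qed

end


section \<open>The natural structure in a chart\<close>

lemma linear_eq_axis:
  fixes l l' :: "real^'n::finite \<Rightarrow> 'b::real_vector"
  assumes "linear l" "linear l'" "\<And>i. l (axis i 1) = l' (axis i 1)"
  shows "l v = l' v"
proof -
  have "l v = (\<Sum>i\<in>UNIV. (v $ i) *\<^sub>R l (axis i 1))" if "linear l" for l :: "real^'n \<Rightarrow> 'b"
  proof -
    have "l v = l (\<Sum>i\<in>UNIV. (v $ i) *\<^sub>R axis i 1)"
      using basis_expansion[of v] by (simp add: scalar_mult_eq_scaleR)
    then show ?thesis by (simp add: linear_sum[OF that] linear_scale[OF that])
  qed
  from this[OF assms(1)] this[OF assms(2)] show ?thesis by (simp add: assms(3))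
qed

context local_metric
begin

lemma Cauchy_Schwarz_g: "x \<in> U \<Longrightarrow> (g x u v)\<^sup>2 \<le> g x u u * g x v v"
proof (cases "v = 0")
  case True
  then show "x \<in> U \<Longrightarrow> ?thesis" by (simp add: linear_0[OF g_linear])
next
  case False
  assume x: "x \<in> U"
  note lin = linear_diff[OF g_linear[OF x]] linear_scale[OF g_linear[OF x]]
    linear_diff[OF g_linear_left[OF x]] linear_scale[OF g_linear_left[OF x]]
  define q where "q = g x v v *\<^sub>R u - g x u v *\<^sub>R v"
  have "g x q q \<ge> 0" using g_pos[OF x, of q] linear_0[OF g_linear[OF x]] by (cases "q = 0") auto
  also have "g x q q = g x v v * (g x u u * g x v v - (g x u v)\<^sup>2)"
    unfolding q_def lin using g_sym[OF x, of v u] by (simp add: algebra_simps power2_eq_square)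
  finally show ?thesis using g_pos[OF x False] by (simp add: zero_le_mult_iff)
qed

end

text \<open>For fixed \<open>U\<close> the expression is monotone in \<eta>^2, which ranges between
  0 and 2tU; the extreme values are C U and (C + 2td) U. In the application \<eta> is the product
  with \<open>y\<close>, and \<open>U\<close> is a squared length.\<close>

lemma definite_perturbation:
  fixes C d U \<eta> t :: real
  assumes "C > 0" "C + 2 * t * d > 0" "\<eta>\<^sup>2 \<le> 2 * t * U" "t \<ge> 0" "U \<ge> 0"
  shows "C * U + d * \<eta>\<^sup>2 \<ge> 0" and "U > 0 \<Longrightarrow> C * U + d * \<eta>\<^sup>2 > 0"
proof -
  have "min C (C + 2 * t * d) * U \<le> C * U + d * \<eta>\<^sup>2"
  proof (cases "d \<ge> 0")
    case True
    then have "min C (C + 2 * t * d) = C" using assms(4) by simp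
    then show ?thesis using True by simp
  next
    case False
    then have "min C (C + 2 * t * d) = C + 2 * t * d"
      using assms(4) by (simp add: min_def mult_nonneg_nonpos zero_le_mult_iff)
    moreover have "d * (2 * t * U) \<le> d * \<eta>\<^sup>2" using False assms(3) by (intro mult_left_mono_neg) auto
    ultimately show ?thesis by (simp add: algebra_simps)
  qed
  moreover have "min C (C + 2 * t * d) > 0" using assms(1,2) by simp
  ultimately show "C * U + d * \<eta>\<^sup>2 \<ge> 0" "U > 0 \<Longrightarrow> C * U + d * \<eta>\<^sup>2 > 0"
    using assms(5) by (smt (verit) mult_nonneg_nonneg mult_pos_pos)+
qed

section \<open>The unit section over a chart and its derivative\<close>

locale natural_chart = local_metric U g
  for U :: "(real^'n::finite) set" and g +
  fixes c :: real and a a' :: "real \<Rightarrow> real"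
  assumes curv: "x \<in> U \<Longrightarrow> riem x u v w = c *\<^sub>R (g x v w *\<^sub>R u - g x u w *\<^sub>R v)"
    and a_smooth: "smooth_on {0..} a"
    and a_deriv: "t \<ge> 0 \<Longrightarrow> (a has_real_derivative a' t) (at t within {0..})"
    and a_pos: "t \<ge> 0 \<Longrightarrow> a t > 0" and c0: "c \<noteq> 0"
    and N_pos: "t \<ge> 0 \<Longrightarrow> (a t)\<^sup>2 + 2 * c * t > 0"
    and m0: "t \<ge> 0 \<Longrightarrow> (a t)\<^sup>2 - 2 * c * t \<noteq> 0"
    and e0: "t \<ge> 0 \<Longrightarrow> a t - 2 * t * a' t \<noteq> 0"
begin

abbreviation V :: "((real^'n) \<times> (real^'n)) set" where "V \<equiv> U \<times> UNIV"

sublocale pulled_back_metric U g V fst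
  by unfold_locales (auto intro!: open_Times open_U smooth_on_fst smooth_on_id)

lemma fd_fst: "fd fst z X = fst X"
  by (subst fd_eq[of _ fst]) (auto intro!: derivative_eq_intros)

lemma fd_snd: "fd snd z X = snd X"
  by (subst fd_eq[of _ snd]) (auto intro!: derivative_eq_intros)

definition y :: "(real^'n) \<times> (real^'n) \<Rightarrow> real^'n" where
  "y z = raise (fst z) (\<lambda>v. snd z \<bullet> v)"

definition tt :: "(real^'n) \<times> (real^'n) \<Rightarrow> real" where
  "tt z = g (fst z) (y z) (y z) / 2"

text \<open>The horizontal lift: for \<open>u = axis i 1\<close> it is \<delta>_i, its second
  component being p_k \<Gamma>^k_ih.\<close>

definition hor :: "(real^'n) \<times> (real^'n) \<Rightarrow> real^'n \<Rightarrow> (real^'n) \<times> (real^'n)" where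
  "hor z u = (u, \<chi> h. snd z \<bullet> chris (fst z) u (axis h 1))"

abbreviation ver :: "real^'n \<Rightarrow> (real^'n) \<times> (real^'n)" where "ver w \<equiv> (0, w)"

abbreviation az :: "(real^'n) \<times> (real^'n) \<Rightarrow> real" where "az z \<equiv> a (tt z)"
abbreviation dz :: "(real^'n) \<times> (real^'n) \<Rightarrow> real" where "dz z \<equiv> a' (tt z)"
abbreviation ez :: "(real^'n) \<times> (real^'n) \<Rightarrow> real" where "ez z \<equiv> az z - 2 * tt z * dz z"
abbreviation mz :: "(real^'n) \<times> (real^'n) \<Rightarrow> real" where "mz z \<equiv> (az z)\<^sup>2 - 2 * c * tt z"

lemma linear_inner_right: "linear (\<lambda>v. w \<bullet> v)"
  by (rule linearI) (simp_all add: inner_add_right)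

lemma g_y: "z \<in> V \<Longrightarrow> g (fst z) (y z) v = snd z \<bullet> v"
  unfolding y_def by (rule g_raise[OF P_mem linear_inner_right])

lemma y_smooth: "smooth_on V y"
  unfolding y_def by (intro smooth_on_raise P_into P_smooth smooth_intros)

text \<open>Metric compatibility applied to g(y, v) = p(v) shows that \<open>cov y X\<close> is the
  vertical part of \<open>X\<close> with raised index. From here on, a tangent vector is described
  by the pair \<open>fst X\<close>, \<open>cov y X z\<close>.\<close>

lemma g_cov_y:
  assumes z: "z \<in> V"
  shows "g (fst z) (cov y X z) v = snd X \<bullet> v - snd z \<bullet> chris (fst z) (fst X) v"
proof -
  have "fd (\<lambda>z. g (fst z) (y z) v) z X = fd (\<lambda>z. snd z \<bullet> v) z X"
    by (rule fd_cong[OF open_V z, THEN fun_cong]) (rule g_y)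
  also have "\<dots> = snd X \<bullet> v"
    using fd_inner[OF open_V z smooth_on_snd[OF smooth_on_id] smooth_on_const, of v X] by (simp add: fd_snd)
  finally show ?thesis
    using cov_metric[OF z y_smooth smooth_on_const, of v X] g_y[OF z]
    by (simp add: cov_def[of "\<lambda>_. v"] fd_fst)
qed

lemma cov_y_hor: "z \<in> V \<Longrightarrow> cov y (hor z u) z = 0"
proof (rule g_eqI[OF P_mem])
  fix v
  assume z: "z \<in> V"
  have "linear (\<lambda>v. snd z \<bullet> chris (fst z) u v)"
    using linear_compose[OF linear_chris[OF P_mem[OF z]] linear_inner_right] by (simp add: o_def)
  from linear_vec[OF this, of v]
  show "g (fst z) (cov y (hor z u) z) v = g (fst z) 0 v"
    by (simp only: g_cov_y[OF z] hor_def fst_conv snd_conv linear_0[OF g_linear_left[OF P_mem[OF z]]] diff_self)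
qed

lemma cov_y_ver: "z \<in> V \<Longrightarrow> cov y (ver w) z = raise (fst z) (\<lambda>v. w \<bullet> v)"
  by (rule raise_eqI[OF P_mem, symmetric])
    (simp_all add: g_cov_y linear_0[OF linear_chris_left[OF P_mem]])

lemma tt_smooth: "smooth_on V tt"
  unfolding tt_def divide_inverse by (intro smooth_intros gP_smooth y_smooth)

lemma g_nonneg: "x \<in> U \<Longrightarrow> g x v v \<ge> 0"
  using g_pos[of x v] linear_0[OF g_linear[of x v]] by (cases "v = 0") auto

lemma tt_nonneg: "z \<in> V \<Longrightarrow> tt z \<ge> 0"
  using g_nonneg[OF P_mem] by (simp add: tt_def)

lemma g_y_y: "g (fst z) (y z) (y z) = 2 * tt z"
  by (simp add: tt_def)

lemma fd_tt: "z \<in> V \<Longrightarrow> fd tt z X = g (fst z) (y z) (cov y X z)"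
proof -
  assume z: "z \<in> V"
  have "fd tt z X = fd (\<lambda>z. (1 / 2) * g (fst z) (y z) (y z)) z X" by (simp add: tt_def[abs_def])
  also have "\<dots> = (1 / 2) * fd (\<lambda>z. g (fst z) (y z) (y z)) z X"
    using fd_mult[OF open_V z smooth_on_const gP_smooth[OF y_smooth y_smooth], of "1 / 2" X] by simp
  finally show ?thesis
    using g_sym[OF P_mem[OF z], of "y z"] by (simp add: cov_metric[OF z y_smooth y_smooth])
qed

lemma a_tt_smooth: "smooth_on V (\<lambda>z. az z)"
  by (rule smooth_on_compose[OF a_smooth tt_smooth]) (use tt_nonneg in auto)

lemma fd_a_tt: "z \<in> V \<Longrightarrow> fd (\<lambda>z. az z) z X = dz z * fd tt z X"
proof -
  assume z: "z \<in> V"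
  \<comment> \<open>\<open>tt\<close> is 0 on the zero section, where \<open>a\<close> has only a
    one-sided derivative. The chain rule is thus applied within the image of \<open>tt\<close>, and
    openness of \<open>V\<close> restores a full derivative at \<open>z\<close>.\<close>
  have "tt ` V \<subseteq> {0..}" using tt_nonneg by auto
  then have "(a has_derivative (*) (dz z)) (at (tt z) within tt ` V)"
    by (rule has_derivative_subset[OF a_deriv[OF tt_nonneg[OF z], unfolded has_field_derivative_def]])
  moreover have "(tt has_derivative fd tt z) (at z within V)"
    using smooth_on_has_fd[OF tt_smooth open_V z] by (rule has_derivative_at_withinI)
  ultimately have "((\<lambda>z. az z) has_derivative (\<lambda>X. dz z * fd tt z X)) (at z within V)"
    by (rule has_derivative_in_compose[rotated])
  then have "((\<lambda>z. az z) has_derivative (\<lambda>X. dz z * fd tt z X)) (at z)"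
    using at_within_open[OF z open_V] by simp
  then show ?thesis by (simp add: fd_eq)
qed

definition N :: "(real^'n) \<times> (real^'n) \<Rightarrow> real" where "N z = (az z)\<^sup>2 + 2 * c * tt z"
definition \<psi> :: "(real^'n) \<times> (real^'n) \<Rightarrow> real" where "\<psi> z = inverse (sqrt (N z))"
definition \<rho> :: "(real^'n) \<times> (real^'n) \<Rightarrow> real" where "\<rho> z = az z * \<psi> z"
definition \<sigma> :: "(real^'n) \<times> (real^'n) \<Rightarrow> (real \<times> (real^'n)) \<times> (real \<times> (real^'n))" where
  "\<sigma> z = ((\<rho> z, 0), (0, \<psi> z *\<^sub>R y z))"

lemma Nz_pos: "z \<in> V \<Longrightarrow> N z > 0"
  unfolding N_def using N_pos tt_nonneg by blast

lemma N_smooth: "smooth_on V N"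
  unfolding N_def by (intro smooth_intros a_tt_smooth tt_smooth)

lemma \<psi>_smooth: "smooth_on V \<psi>"
proof -
  have "sqrt (N z) \<noteq> 0" if "z \<in> V" for z using Nz_pos[OF that] by simp
  then show ?thesis
    unfolding \<psi>_def by (intro smooth_on_inverse smooth_on_sqrt N_smooth Nz_pos)
qed

lemma \<psi>_N: "z \<in> V \<Longrightarrow> (\<psi> z)\<^sup>2 * N z = 1"
  using Nz_pos[of z] by (simp add: \<psi>_def power_inverse)

lemma \<psi>_pos: "z \<in> V \<Longrightarrow> \<psi> z > 0"
  using Nz_pos[of z] by (simp add: \<psi>_def)

lemma \<psi>_cube: "z \<in> V \<Longrightarrow> \<psi> z ^ 3 * N z = \<psi> z"
  using \<psi>_N[of z] by (simp add: power3_eq_cube power2_eq_square mult.assoc)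

lemma fd_N: "z \<in> V \<Longrightarrow> fd N z X = 2 * (az z * dz z + c) * fd tt z X"
proof -
  assume z: "z \<in> V"
  have s: "smooth_on V (\<lambda>z. az z * az z)" "smooth_on V (\<lambda>z. (2 * c) * tt z)"
    by (intro smooth_intros a_tt_smooth tt_smooth)+
  have "fd N z X = fd (\<lambda>z. az z * az z + (2 * c) * tt z) z X"
    by (simp add: N_def[abs_def] power2_eq_square)
  also have "\<dots> = fd (\<lambda>z. az z * az z) z X + fd (\<lambda>z. (2 * c) * tt z) z X"
    by (rule fd_add[OF open_V z s])
  also have "\<dots> = 2 * (az z * dz z + c) * fd tt z X"
    using fd_mult[OF open_V z a_tt_smooth a_tt_smooth, of X] fd_mult[OF open_V z smooth_on_const tt_smooth, of "2 * c" X]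
    by (simp add: fd_a_tt[OF z] algebra_simps)
  finally show ?thesis .
qed

lemma fd_\<psi>: "z \<in> V \<Longrightarrow> fd \<psi> z X = - (az z * dz z + c) * \<psi> z ^ 3 * fd tt z X"
proof -
  assume z: "z \<in> V"
  have s: "smooth_on V (\<lambda>z. \<psi> z * \<psi> z)" by (intro smooth_intros \<psi>_smooth)
  have "fd (\<lambda>z. (\<psi> z * \<psi> z) * N z) z X = fd (\<lambda>z. 1) z X"
    by (rule fd_cong[OF open_V z, THEN fun_cong]) (use \<psi>_N in \<open>simp add: power2_eq_square\<close>)
  from this[unfolded fd_mult[OF open_V z s N_smooth] fd_mult[OF open_V z \<psi>_smooth \<psi>_smooth]]
  have "\<psi> z * \<psi> z * fd N z X + 2 * \<psi> z * fd \<psi> z X * N z = 0"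
    by (simp add: algebra_simps)
  \<comment> \<open>The multiplier makes \<psi>^2 N appear in the second summand, where it is
    replaced by 1.\<close>
  then have "2 * (\<psi> z)\<^sup>2 * (\<psi> z * \<psi> z * fd N z X + 2 * \<psi> z * fd \<psi> z X * N z) = 0" by simp
  then have "2 * \<psi> z ^ 3 * \<psi> z * fd N z X + 4 * \<psi> z * fd \<psi> z X * ((\<psi> z)\<^sup>2 * N z) = 0"
    by (simp add: power2_eq_square power3_eq_cube algebra_simps)
  then have "\<psi> z * (2 * \<psi> z ^ 3 * fd N z X + 4 * fd \<psi> z X) = 0"
    unfolding \<psi>_N[OF z] by (simp add: algebra_simps)
  then have "2 * \<psi> z ^ 3 * fd N z X + 4 * fd \<psi> z X = 0" using \<psi>_pos[OF z] by simp
  then show ?thesis unfolding fd_N[OF z] by (simp add: algebra_simps)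
qed

lemma \<rho>_smooth: "smooth_on V \<rho>"
  unfolding \<rho>_def by (intro smooth_intros a_tt_smooth \<psi>_smooth)

lemma fd_\<rho>:
  assumes z: "z \<in> V"
  shows "fd \<rho> z X = - (c * ez z) * \<psi> z ^ 3 * fd tt z X"
proof -
  have "fd \<rho> z X = az z * fd \<psi> z X + dz z * fd tt z X * \<psi> z"
    unfolding \<rho>_def[abs_def] fd_mult[OF open_V z a_tt_smooth \<psi>_smooth] fd_a_tt[OF z] ..
  \<comment> \<open>Writing the last \<psi> as \<psi>^3 N lets \<psi>^3 be factored from the whole
    sum. The a^2 a' terms then cancel, leaving a - 2t a' as the coefficient.\<close>
  also have "\<dots> = az z * (- (az z * dz z + c) * \<psi> z ^ 3 * fd tt z X)
      + dz z * fd tt z X * (\<psi> z ^ 3 * N z)"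
    unfolding fd_\<psi>[OF z] \<psi>_cube[OF z] ..
  also have "\<dots> = - (c * ez z) * \<psi> z ^ 3 * fd tt z X"
    unfolding N_def by (simp add: algebra_simps power2_eq_square)
  finally show ?thesis .
qed

lemma \<sigma>_smooth: "smooth_on V \<sigma>"
  unfolding \<sigma>_def by (intro smooth_intros \<rho>_smooth \<psi>_smooth y_smooth)

lemma \<sigma>_unit: "z \<in> V \<Longrightarrow> hform c z (\<sigma> z) (\<sigma> z) = 1"
  using \<psi>_N[of z]
  by (simp add: hform_def \<sigma>_def \<rho>_def N_def gP_simps g_y_y linear_0[OF g_linear[OF P_mem]]
      power2_eq_square algebra_simps)

sublocale F: flat_hermitian V "hform c" times_i "flatD c" \<sigma>
  by (rule flat_hermitian_flatD[OF curv[OF P_mem] \<sigma>_smooth \<sigma>_unit])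

lemma flatD_\<sigma>:
  assumes z: "z \<in> V"
  shows "flatD c X \<sigma> z = ((fd \<rho> z X, \<rho> z *\<^sub>R fst X),
    (- (c * \<psi> z * g (fst z) (y z) (fst X)), fd \<psi> z X *\<^sub>R y z + \<psi> z *\<^sub>R cov y X z))"
  using g_sym[OF P_mem[OF z], of "fst X" "y z"] cov_scaleR[OF z \<psi>_smooth y_smooth]
  by (simp add: flatD_def flatD0_def \<sigma>_def fd_fst gP_simps z cov_def[of "\<lambda>_. 0"]
      linear_0[OF g_linear[OF P_mem]] linear_0[OF linear_chris[OF P_mem]] mult.assoc)

text \<open>The derivative of N^(-1/2) brings in \<psi>^3; the other terms acquire the same factor
  from \<psi> = \<psi>^3 N. The numbers \<eta> and \<tau> are the products of \<open>y\<close> with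
  the horizontal and the vertical part of \<open>X\<close>.\<close>

lemma \<Phi>_eq:
  assumes z: "z \<in> V"
  defines "\<eta> \<equiv> \<lambda>X. g (fst z) (y z) (fst X)" and "\<tau> \<equiv> \<lambda>X. g (fst z) (y z) (cov y X z)"
  shows "F.\<Phi> X z = \<psi> z ^ 3 *\<^sub>R
    ((- (c * ez z * \<tau> X),
      (az z * N z) *\<^sub>R fst X - (2 * c * az z * \<eta> X) *\<^sub>R y z),
     (c * mz z * \<eta> X,
      N z *\<^sub>R cov y X z - ((az z * dz z + c) * \<tau> X) *\<^sub>R y z))"
proof -
  \<comment> \<open>Only the horizontal part contributes, through two equal terms: one from the real
    tangent component and one from the imaginary scalar component.\<close>
  have \<beta>: "F.\<beta> X z = - (2 * c * \<rho> z * \<psi> z * \<eta> X)"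
    using g_sym[OF P_mem[OF z], of "fst X" "y z"]
    by (simp add: F.\<beta>_def flatD_\<sigma>[OF z] hform_def times_i_def \<sigma>_def gP_simps z \<eta>_def
        linear_0[OF g_linear[OF P_mem]] algebra_simps)
  have "F.\<Phi> X z = ((fd \<rho> z X, \<rho> z *\<^sub>R fst X - (2 * c * \<rho> z * \<psi> z * \<eta> X * \<psi> z) *\<^sub>R y z),
     (- (c * \<psi> z * \<eta> X) + 2 * c * \<rho> z * \<psi> z * \<eta> X * \<rho> z, fd \<psi> z X *\<^sub>R y z + \<psi> z *\<^sub>R cov y X z))"
    unfolding F.\<Phi>_def \<beta> flatD_\<sigma>[OF z] by (simp add: times_i_def \<sigma>_def \<eta>_def)
  moreover have "fd \<rho> z X = \<psi> z ^ 3 * - (c * ez z * \<tau> X)"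
    unfolding fd_\<rho>[OF z] fd_tt[OF z] \<tau>_def by (simp add: algebra_simps)
  moreover have "\<rho> z *\<^sub>R fst X - (2 * c * \<rho> z * \<psi> z * \<eta> X * \<psi> z) *\<^sub>R y z =
      \<psi> z ^ 3 *\<^sub>R ((az z * N z) *\<^sub>R fst X - (2 * c * az z * \<eta> X) *\<^sub>R y z)"
  proof -
    have "\<rho> z = \<psi> z ^ 3 * (az z * N z)" using \<psi>_cube[OF z] by (simp add: \<rho>_def algebra_simps)
    moreover have "2 * c * \<rho> z * \<psi> z * \<eta> X * \<psi> z = \<psi> z ^ 3 * (2 * c * az z * \<eta> X)"
      by (simp add: \<rho>_def power3_eq_cube)
    ultimately show ?thesis by (simp only: scaleR_diff_right scaleR_scaleR)
  qed
  moreover have "- (c * \<psi> z * \<eta> X) + 2 * c * \<rho> z * \<psi> z * \<eta> X * \<rho> z =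
      \<psi> z ^ 3 * (c * mz z * \<eta> X)"
  proof -
    have "- (c * \<psi> z * \<eta> X) + 2 * c * \<rho> z * \<psi> z * \<eta> X * \<rho> z =
        - (c * (\<psi> z ^ 3 * N z) * \<eta> X) + 2 * c * \<rho> z * \<psi> z * \<eta> X * \<rho> z" unfolding \<psi>_cube[OF z] ..
    also have "\<dots> = \<psi> z ^ 3 * (c * mz z * \<eta> X)"
      by (simp add: \<rho>_def N_def power3_eq_cube power2_eq_square algebra_simps)
    finally show ?thesis .
  qed
  moreover have "fd \<psi> z X *\<^sub>R y z + \<psi> z *\<^sub>R cov y X z =
      \<psi> z ^ 3 *\<^sub>R (N z *\<^sub>R cov y X z - ((az z * dz z + c) * \<tau> X) *\<^sub>R y z)"
    unfolding scaleR_diff_right scaleR_scaleR \<psi>_cube[OF z] fd_\<psi>[OF z] fd_tt[OF z] \<tau>_def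
    by (simp add: algebra_simps)
  ultimately show ?thesis by simp
qed

lemma \<Phi>_hor:
  assumes z: "z \<in> V"
  shows "F.\<Phi> (hor z u) z = \<psi> z ^ 3 *\<^sub>R
    ((0, (az z * N z) *\<^sub>R u - (2 * c * az z * g (fst z) (y z) u) *\<^sub>R y z),
     (c * mz z * g (fst z) (y z) u, 0))"
  by (simp add: \<Phi>_eq[OF z] cov_y_hor[OF z] linear_0[OF g_linear[OF P_mem[OF z]]]) (simp add: hor_def)

lemma \<Phi>_ver:
  assumes z: "z \<in> V"
  shows "F.\<Phi> (ver w) z = \<psi> z ^ 3 *\<^sub>R
    ((- (c * ez z * g (fst z) (y z) (cov y (ver w) z)), 0),
     (0, N z *\<^sub>R cov y (ver w) z - ((az z * dz z + c) * g (fst z) (y z) (cov y (ver w) z)) *\<^sub>R y z))"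
  by (simp add: \<Phi>_eq[OF z] linear_0[OF g_linear[OF P_mem[OF z]]])

text \<open>The equations split into two systems: horizontal vectors and
  \<open>times_i (\<sigma> z)\<close> involve \<alpha>' and \<open>B\<close>, vertical vectors and
  \<sigma> involve \<alpha> and \<open>B'\<close>. Each is solved by pairing its vector equation
  with \<open>y\<close>. The factors that decide are (a^2 - 2ct) N in the first system, and a - 2t
  a' followed by N in the second.\<close>

lemma nondegenerate:
  assumes z: "z \<in> V" and d\<Phi>: "\<And>X. hform c z d (F.\<Phi> X z) = 0"
    and d\<sigma>: "hform c z d (\<sigma> z) = 0" "hform c z d (times_i (\<sigma> z)) = 0"
  shows "d = 0"
proof -
  obtain \<alpha> B \<alpha>' B' where d: "d = ((\<alpha>, B), (\<alpha>', B'))" by (metis surj_pair)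
  define t where "t = tt z"
  define A where "A = a t"
  define A' where "A' = a' t"
  define s where "s = g (fst z) B (y z)"
  define s' where "s' = g (fst z) B' (y z)"
  have t0: "t \<ge> 0" using tt_nonneg[OF z] by (simp add: t_def)
  have A: "A > 0" "A\<^sup>2 - 2 * c * t \<noteq> 0" "A - 2 * t * A' \<noteq> 0" "A\<^sup>2 + 2 * c * t \<noteq> 0"
    using a_pos[OF t0] m0[OF t0] e0[OF t0] N_pos[OF t0] by (auto simp: A_def A'_def t_def)
  have NA: "N z = A\<^sup>2 + 2 * c * t" by (simp add: N_def A_def t_def)
  note xz = P_mem[OF z]
  note gl = gP_simps z linear_0[OF g_linear[OF xz]] linear_0[OF g_linear_left[OF xz]]
  have \<psi>: "\<psi> z \<noteq> 0" using \<psi>_pos[OF z] by simp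
  have e1: "A * \<alpha> + c * s' = 0"
  proof -
    have "\<psi> z * (A * \<alpha> + c * s') = 0"
      using d\<sigma>(1) by (simp add: d hform_def \<sigma>_def \<rho>_def gl A_def t_def s'_def algebra_simps)
    then show ?thesis using \<psi> by simp
  qed
  have e2: "A * \<alpha>' = c * s"
  proof -
    have "\<psi> z * (A * \<alpha>' - c * s) = 0"
      using d\<sigma>(2) by (simp add: d hform_def \<sigma>_def times_i_def \<rho>_def gl A_def t_def s_def algebra_simps)
    then show ?thesis using \<psi> by simp
  qed
  have "g (fst z) ((A * N z) *\<^sub>R B + ((A\<^sup>2 - 2 * c * t) * \<alpha>' - 2 * c * A * s) *\<^sub>R y z) u = g (fst z) 0 u" for u
  proof -
    have "\<psi> z ^ 3 * (c * g (fst z) ((A * N z) *\<^sub>R B + ((A\<^sup>2 - 2 * c * t) * \<alpha>' - 2 * c * A * s) *\<^sub>R y z) u) = 0"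
      using d\<Phi>[of "hor z u"] unfolding \<Phi>_hor[OF z]
      by (simp add: d hform_def gl A_def[symmetric] t_def[symmetric] s_def algebra_simps)
    then show ?thesis using \<psi> c0 by (simp add: gl)
  qed
  then have B: "(A * N z) *\<^sub>R B + ((A\<^sup>2 - 2 * c * t) * \<alpha>' - 2 * c * A * s) *\<^sub>R y z = 0"
    by (rule g_eqI[OF xz])
  then have "g (fst z) ((A * N z) *\<^sub>R B + ((A\<^sup>2 - 2 * c * t) * \<alpha>' - 2 * c * A * s) *\<^sub>R y z) (y z) = 0"
    by (simp add: gl)
  then have "A * N z * s + ((A\<^sup>2 - 2 * c * t) * \<alpha>' - 2 * c * A * s) * (2 * t) = 0"
    by (simp add: gl s_def g_y_y t_def)
  then have "c * (A * N z * s + ((A\<^sup>2 - 2 * c * t) * \<alpha>' - 2 * c * A * s) * (2 * t)) = 0" by simp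
  then have "A * N z * (c * s) + ((A\<^sup>2 - 2 * c * t) * (c * \<alpha>') - 2 * c * A * (c * s)) * (2 * t) = 0"
    by (simp add: algebra_simps)
  then have "\<alpha>' * (A\<^sup>2 - 2 * c * t) * (A\<^sup>2 + 2 * c * t) = 0"
    unfolding e2[symmetric] NA by (simp add: algebra_simps power2_eq_square)
  then have \<alpha>': "\<alpha>' = 0" using A by simp
  then have "s = 0" using e2 c0 by simp
  with B \<alpha>' have B0: "B = 0" using A NA by simp
  have "g (fst z) (N z *\<^sub>R B' - ((A - 2 * t * A') * \<alpha> + (A * A' + c) * s') *\<^sub>R y z) (cov y (ver w) z) = 0" for w
  proof -
    have "\<psi> z ^ 3 * (c * g (fst z) (N z *\<^sub>R B' - ((A - 2 * t * A') * \<alpha> + (A * A' + c) * s') *\<^sub>R y z) (cov y (ver w) z)) = 0"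
      using d\<Phi>[of "ver w"] unfolding \<Phi>_ver[OF z]
      by (simp add: d hform_def gl A_def[symmetric] A'_def[symmetric] t_def[symmetric] s'_def algebra_simps)
    then show ?thesis using \<psi> c0 by simp
  qed
  moreover have "g (fst z) v (cov y (ver w) z) = w \<bullet> v" for v w
    using g_cov_y[OF z, of "ver w" v] g_sym[OF xz, of v] by (simp add: linear_0[OF linear_chris_left[OF xz]])
  ultimately have "w \<bullet> (N z *\<^sub>R B' - ((A - 2 * t * A') * \<alpha> + (A * A' + c) * s') *\<^sub>R y z) = 0" for w by simp
  then have B': "N z *\<^sub>R B' = ((A - 2 * t * A') * \<alpha> + (A * A' + c) * s') *\<^sub>R y z"
    by (metis eq_iff_diff_eq_0 inner_eq_zero_iff)
  then have "g (fst z) (N z *\<^sub>R B') (y z) = g (fst z) (((A - 2 * t * A') * \<alpha> + (A * A' + c) * s') *\<^sub>R y z) (y z)"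
    by simp
  then have "N z * s' = ((A - 2 * t * A') * \<alpha> + (A * A' + c) * s') * (2 * t)"
    by (simp add: gl s'_def g_y_y t_def)
  then have "(A - 2 * t * A') * (A * s' - 2 * t * \<alpha>) = 0"
    unfolding NA by (simp add: algebra_simps power2_eq_square)
  then have "A * s' = 2 * t * \<alpha>" using A by simp
  then have "A * (A * \<alpha> + c * s') = (A\<^sup>2 + 2 * c * t) * \<alpha>"
    by (simp add: algebra_simps power2_eq_square)
  then have \<alpha>: "\<alpha> = 0" using e1 A by simp
  then have "s' = 0" using e1 c0 by simp
  with B' \<alpha> have "B' = 0" using A NA by simp
  with \<alpha> \<alpha>' B0 show ?thesis by (simp add: d zero_prod_def)
qed

end


text \<open>The scalar content of the geometric identities. The first two parts give the factors of
  \<open>J\<close> along the radial direction, which are mutually inverse; the next four are the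
  coefficients of \<open>G\<close>, to be matched with \<kappa> h(\<Phi>, \<Phi>); the last two are
  the coefficients of \<open>y\<close> in \<Phi> J = i \<Phi>.\<close>

lemma natural_scalars:
  fixes a a' c t \<kappa> :: real
  assumes "a \<noteq> 0" "e \<noteq> 0" "m \<noteq> 0" "N \<noteq> 0"
    and e: "e = a - 2 * t * a'" and m: "m = a\<^sup>2 - 2 * c * t" and N: "N = a\<^sup>2 + 2 * c * t"
    and b1: "b1 = (a * a' - c) / e" and b2: "b2 = - b1 / (a * (a + 2 * t * b1))"
    and lam: "lam = \<kappa> * c * a / N" and mu: "mu = \<kappa> * c * (- (a' * m) - 2 * c * a) / N\<^sup>2"
  shows "a + 2 * t * b1 = m / e" and "1 / a + 2 * t * b2 = e / m"
    and "lam * a = \<kappa> * c * a\<^sup>2 / N"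
    and "lam * b1 + mu * (a + 2 * t * b1) = \<kappa> * (c\<^sup>2 * (m\<^sup>2 - 4 * a\<^sup>2 * N + 8 * t * c * a\<^sup>2)) / N ^ 3"
    and "lam * (1 / a) = \<kappa> * c / N"
    and "lam * b2 + mu * (1 / a + 2 * t * b2) =
      \<kappa> * (c * (c * e\<^sup>2 + 2 * t * (a * a' + c)\<^sup>2 - 2 * N * (a * a' + c))) / N ^ 3"
    and "N * b1 - (a * a' + c) * (m / e) = - (2 * c * a)"
    and "2 * c * a * (e / m) - a * N * b2 = a * a' + c"
proof -
  have k1: "e * a + 2 * t * (a * a' - c) = m" unfolding e m by (simp add: algebra_simps power2_eq_square)
  show 1: "a + 2 * t * b1 = m / e"
    using k1 assms(2) unfolding b1 by (simp add: field_simps)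
  have b2': "b2 = - (a * a' - c) / (a * m)"
  proof -
    have "b2 = - b1 / (a * (m / e))" unfolding b2 1 ..
    then show ?thesis unfolding b1 using assms(1-3) by simp
  qed
  have k2: "m - 2 * t * (a * a' - c) = a * e" unfolding e m by (simp add: algebra_simps power2_eq_square)
  have "1 / a + 2 * t * b2 = (m - 2 * t * (a * a' - c)) / (a * m)"
    unfolding b2' using assms(1,3) by (simp add: field_simps)
  then show 2: "1 / a + 2 * t * b2 = e / m" unfolding k2 using assms(1) by simp
  show "lam * a = \<kappa> * c * a\<^sup>2 / N" unfolding lam by (simp add: power2_eq_square)
  show "lam * (1 / a) = \<kappa> * c / N" unfolding lam using assms(1) by simp
  \<comment> \<open>Putting the scalars over the denominator N^3 e leaves a polynomial identity in
    a, a', c and t. The same is done in \<open>k4\<close> with N^3 m, and in \<open>k5\<close> and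
    \<open>k6\<close> with e and m.\<close>
  have k3: "a * (a * a' - c) * N\<^sup>2 + (- (a' * m) - 2 * c * a) * m * N = c * (m\<^sup>2 - 4 * a\<^sup>2 * N + 8 * t * c * a\<^sup>2) * e"
    unfolding N m e by algebra
  have "lam * b1 + mu * (a + 2 * t * b1) =
      \<kappa> * c * (a * (a * a' - c) * N\<^sup>2 + (- (a' * m) - 2 * c * a) * m * N) / (N ^ 3 * e)"
    unfolding 1 unfolding lam mu b1 using assms(2,4) by (simp add: field_simps power2_eq_square power3_eq_cube)
  then show "lam * b1 + mu * (a + 2 * t * b1) = \<kappa> * (c\<^sup>2 * (m\<^sup>2 - 4 * a\<^sup>2 * N + 8 * t * c * a\<^sup>2)) / N ^ 3"
    unfolding k3 using assms(2) by (simp add: power2_eq_square)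
  have k4: "- (a * a' - c) * N\<^sup>2 + (- (a' * m) - 2 * c * a) * e * N
      = (c * e\<^sup>2 + 2 * t * (a * a' + c)\<^sup>2 - 2 * N * (a * a' + c)) * m"
    unfolding N m e by algebra
  have "lam * b2 + mu * (1 / a + 2 * t * b2) =
      \<kappa> * c * (- (a * a' - c) * N\<^sup>2 + (- (a' * m) - 2 * c * a) * e * N) / (N ^ 3 * m)"
    unfolding 2 unfolding lam mu b2' using assms(1,3,4) by (simp add: field_simps power2_eq_square power3_eq_cube)
  then show "lam * b2 + mu * (1 / a + 2 * t * b2) =
      \<kappa> * (c * (c * e\<^sup>2 + 2 * t * (a * a' + c)\<^sup>2 - 2 * N * (a * a' + c))) / N ^ 3"
    unfolding k4 using assms(3) by simp
  have k5: "N * (a * a' - c) - (a * a' + c) * m = - (2 * c * a) * e" unfolding N m e by algebra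
  have "N * b1 - (a * a' + c) * (m / e) = (N * (a * a' - c) - (a * a' + c) * m) / e"
    unfolding b1 by (simp add: diff_divide_distrib right_diff_distrib)
  then show "N * b1 - (a * a' + c) * (m / e) = - (2 * c * a)" unfolding k5 using assms(2) by simp
  have k6: "2 * c * a * e + N * (a * a' - c) = (a * a' + c) * m" unfolding N m e by algebra
  have "2 * c * a * (e / m) - a * N * b2 = (2 * c * a * e + N * (a * a' - c)) / m"
    unfolding b2' using assms(1,3) by (simp add: field_simps)
  then show "2 * c * a * (e / m) - a * N * b2 = a * a' + c" unfolding k6 using assms(3) by simp
qed

section \<open>Index expressions in invariant form\<close>

context natural_chart
begin

text \<open>The i-th coordinate differential with raised index, so that the products of these
  vectors are the g^ij.\<close>

abbreviation E :: "(real^'n) \<times> (real^'n) \<Rightarrow> 'n \<Rightarrow> real^'n" where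
  "E z i \<equiv> raise (fst z) (\<lambda>v. v $ i)"

lemma linear_nth: "linear (\<lambda>v::real^'n. v $ i)"
  by (rule linearI) simp_all

lemma g_E: "z \<in> V \<Longrightarrow> g (fst z) (E z i) v = v $ i"
  by (rule g_raise[OF P_mem linear_nth])

lemma cov_y_axis: "z \<in> V \<Longrightarrow> cov y (ver (axis i 1)) z = E z i"
  by (simp add: cov_y_ver inner_axis')

lemma g_y_axis: "z \<in> V \<Longrightarrow> g (fst z) (y z) (axis i 1) = snd z $ i"
  by (simp add: g_y inner_axis)

lemma g_y_E: "z \<in> V \<Longrightarrow> g (fst z) (y z) (E z i) = y z $ i"
  using g_sym[OF P_mem, of z "y z"] by (simp add: g_E)

lemma y_nth:
  assumes z: "z \<in> V"
  shows "(\<Sum>h\<in>UNIV. snd z $ h * g (fst z) (E z h) (E z i)) = y z $ i"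
  using g_y[OF z, of "E z i"] by (simp add: g_E[OF z] g_y_E[OF z] inner_vec_def)

lemma tt_sum:
  assumes z: "z \<in> V"
  shows "1 / 2 * (\<Sum>i\<in>UNIV. \<Sum>k\<in>UNIV. g (fst z) (E z i) (E z k) * snd z $ i * snd z $ k) = tt z"
proof -
  have "(\<Sum>k\<in>UNIV. g (fst z) (E z i) (E z k) * snd z $ i * snd z $ k) = snd z $ i * y z $ i" for i
    unfolding y_nth[OF z, symmetric] sum_distrib_left g_sym[OF P_mem[OF z], of "E z i"]
    by (simp add: mult_ac)
  then have "(\<Sum>i\<in>UNIV. \<Sum>k\<in>UNIV. g (fst z) (E z i) (E z k) * snd z $ i * snd z $ k) = snd z \<bullet> y z"
    by (simp add: inner_vec_def)
  then show ?thesis by (simp add: tt_def g_y[OF z])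
qed

text \<open>The Gram matrix of the vectors \<open>E z i\<close> inverts that of the coordinate
  vectors. \<open>matrix_inv\<close> is itself a choice, so uniqueness of the two-sided inverse is
  part of the argument.\<close>

lemma matrix_inv_metric:
  assumes z: "z \<in> V"
  shows "matrix_inv (\<chi> i j. g (fst z) (axis i 1) (axis j 1)) $ i $ j = g (fst z) (E z i) (E z j)"
proof -
  define M :: "real^'n^'n" where "M = (\<chi> i j. g (fst z) (axis i 1) (axis j 1))"
  define Q :: "real^'n^'n" where "Q = (\<chi> i j. g (fst z) (E z i) (E z j))"
  have MQ: "M ** Q = mat 1"
  proof -
    have "(\<Sum>k\<in>UNIV. g (fst z) (axis i 1) (axis k 1) * E z j $ k) = axis i 1 $ j" for i j
      using linear_vec[OF g_linear[OF P_mem[OF z]], of "axis i 1" "E z j"]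
        g_sym[OF P_mem[OF z], of "axis i 1" "E z j"] by (simp add: inner_vec_def g_E[OF z])
    then show ?thesis
      by (simp add: M_def Q_def matrix_matrix_mult_def g_E[OF z] mat_def vec_eq_iff axis_def)
  qed
  then have "Q ** M = mat 1" by (simp add: matrix_left_right_inverse)
  with MQ have "M ** matrix_inv M = mat 1 \<and> matrix_inv M ** M = mat 1"
    unfolding matrix_inv_def by (rule someI[of _ Q, OF conjI])
  then have "matrix_inv M = matrix_inv M ** (M ** Q)" "matrix_inv M ** M = mat 1"
    using MQ by simp_all
  then have "matrix_inv M = Q" by (metis matrix_mul_assoc matrix_mul_lid)
  then show ?thesis by (simp add: M_def Q_def)
qed

end

section \<open>The natural structure of a chart as a Fubini-Study pullback\<close>

locale natural_structure_chart = natural_chart U g c a a'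
  for U :: "(real^'n::finite) set" and g c a a' +
  fixes \<kappa> :: real and b1 b2 lam mu :: "real \<Rightarrow> real"
    and G :: "(real^'n) \<times> (real^'n) \<Rightarrow> (real^'n) \<times> (real^'n) \<Rightarrow> (real^'n) \<times> (real^'n) \<Rightarrow> real"
    and J :: "(real^'n) \<times> (real^'n) \<Rightarrow> (real^'n) \<times> (real^'n) \<Rightarrow> (real^'n) \<times> (real^'n)"
  assumes \<kappa>0: "\<kappa> \<noteq> 0"
    and b1_eq: "t \<ge> 0 \<Longrightarrow> b1 t = (a t * a' t - c) / (a t - 2 * t * a' t)"
    and b2_eq: "t \<ge> 0 \<Longrightarrow> b2 t = - b1 t / (a t * (a t + 2 * t * b1 t))"
    and lam_eq: "t \<ge> 0 \<Longrightarrow> lam t = \<kappa> * c * a t / ((a t)\<^sup>2 + 2 * c * t)"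
    and mu_eq: "t \<ge> 0 \<Longrightarrow> mu t =
      \<kappa> * c * (- (a' t * ((a t)\<^sup>2 - 2 * c * t)) - 2 * c * a t) / ((a t)\<^sup>2 + 2 * c * t)\<^sup>2"
    and ab_pos: "t \<ge> 0 \<Longrightarrow> a t + 2 * t * b1 t > 0"
    and lam_pos: "t \<ge> 0 \<Longrightarrow> lam t > 0" and lam_mu_pos: "t \<ge> 0 \<Longrightarrow> lam t + 2 * t * mu t > 0"
    and G_sym: "z \<in> V \<Longrightarrow> G z X Y = G z Y X" and G_linear: "z \<in> V \<Longrightarrow> linear (G z X)"
    and J_linear: "z \<in> V \<Longrightarrow> linear (J z)"
    and G_hor: "z \<in> V \<Longrightarrow> G z (hor z (axis i 1)) (hor z (axis j 1)) =
      lam (tt z) * az z * g (fst z) (axis i 1) (axis j 1)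
      + (lam (tt z) * b1 (tt z) + mu (tt z) * (az z + 2 * tt z * b1 (tt z))) * snd z $ i * snd z $ j"
    and G_ver: "z \<in> V \<Longrightarrow> G z (ver (axis i 1)) (ver (axis j 1)) =
      lam (tt z) * (1 / az z) * g (fst z) (raise (fst z) (\<lambda>v. v $ i)) (raise (fst z) (\<lambda>v. v $ j))
      + (lam (tt z) * b2 (tt z) + mu (tt z) * (1 / az z + 2 * tt z * b2 (tt z))) * y z $ i * y z $ j"
    and G_ver_hor: "z \<in> V \<Longrightarrow> G z (ver (axis i 1)) (hor z (axis j 1)) = 0"
    and J_hor: "z \<in> V \<Longrightarrow> J z (hor z (axis i 1)) =
      ver (\<chi> l. az z * g (fst z) (axis i 1) (axis l 1) + b1 (tt z) * snd z $ i * snd z $ l)"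
    and J_ver: "z \<in> V \<Longrightarrow> J z (ver (axis i 1)) =
      hor z (- (1 / az z) *\<^sub>R raise (fst z) (\<lambda>v. v $ i) - (b2 (tt z) * y z $ i) *\<^sub>R y z)"
begin

lemma linear_hor: "z \<in> V \<Longrightarrow> linear (hor z)"
  by (rule linearI) (simp_all add: hor_def vec_eq_iff linear_add[OF linear_chris_left[OF P_mem]]
      linear_scale[OF linear_chris_left[OF P_mem]] inner_add_right)

lemma linear_frame_eq:
  fixes l l' :: "(real^'n) \<times> (real^'n) \<Rightarrow> 'c::real_vector"
  assumes z: "z \<in> V" and l: "linear l" "linear l'"
    and hor: "\<And>i. l (hor z (axis i 1)) = l' (hor z (axis i 1))"
    and ver: "\<And>i. l (ver (axis i 1)) = l' (ver (axis i 1))"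
  shows "l X = l' X"
proof -
  have v: "linear (ver :: real^'n \<Rightarrow> _)" by (rule linearI) auto
  have h: "l (hor z u) = l' (hor z u)" for u
    by (rule linear_eq_axis[of "\<lambda>u. l (hor z u)" "\<lambda>u. l' (hor z u)"])
      (use linear_compose[OF linear_hor[OF z] l(1)] linear_compose[OF linear_hor[OF z] l(2)] hor
        in \<open>simp_all add: o_def\<close>)
  have w: "l (ver w) = l' (ver w)" for w
    by (rule linear_eq_axis[of "\<lambda>w. l (ver w)" "\<lambda>w. l' (ver w)"])
      (use linear_compose[OF v l(1)] linear_compose[OF v l(2)] ver in \<open>simp_all add: o_def\<close>)
  have "X = hor z (fst X) + ver (snd X - snd (hor z (fst X)))" by (simp add: hor_def prod_eq_iff)
  then show ?thesis by (metis h w linear_add[OF l(1)] linear_add[OF l(2)])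
qed

lemma linear_cov_y: "z \<in> V \<Longrightarrow> linear (\<lambda>X. cov y X z)"
  by (rule linear_cov[OF _ y_smooth])

lemma scalars_at:
  assumes z: "z \<in> V"
  shows "az z \<noteq> 0" "ez z \<noteq> 0"
    "mz z \<noteq> 0" "N z \<noteq> 0"
  using a_pos[OF tt_nonneg[OF z]] e0[OF tt_nonneg[OF z]] m0[OF tt_nonneg[OF z]] Nz_pos[OF z] by auto

context
  fixes z assumes z: "z \<in> V"
begin

lemmas scalars = natural_scalars[OF scalars_at[OF z] refl refl N_def b1_eq[OF tt_nonneg[OF z]]
  b2_eq[OF tt_nonneg[OF z]] lam_eq[OF tt_nonneg[OF z], folded N_def] mu_eq[OF tt_nonneg[OF z], folded N_def]]

end

text \<open>Both sides are bilinear, so agreement on the adapted frame suffices. The frame-free form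
  replaces p_i by the product of \<open>y\<close> with the horizontal part and g^0i by its product
  with the vertical part, ready for comparison with h(\<Phi>, \<Phi>).\<close>

lemma G_full:
  assumes z: "z \<in> V"
  shows "G z X Y = lam (tt z) * az z * g (fst z) (fst X) (fst Y)
    + (lam (tt z) * b1 (tt z) + mu (tt z) * (az z + 2 * tt z * b1 (tt z)))
      * g (fst z) (y z) (fst X) * g (fst z) (y z) (fst Y)
    + lam (tt z) * (1 / az z) * g (fst z) (cov y X z) (cov y Y z)
    + (lam (tt z) * b2 (tt z) + mu (tt z) * (1 / az z + 2 * tt z * b2 (tt z)))
      * g (fst z) (y z) (cov y X z) * g (fst z) (y z) (cov y Y z)"
proof -
  define C1 where "C1 = lam (tt z) * az z"
  define D1 where "D1 = lam (tt z) * b1 (tt z) + mu (tt z) * (az z + 2 * tt z * b1 (tt z))"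
  define C2 where "C2 = lam (tt z) * (1 / az z)"
  define D2 where "D2 = lam (tt z) * b2 (tt z) + mu (tt z) * (1 / az z + 2 * tt z * b2 (tt z))"
  define R where "R X Y = C1 * g (fst z) (fst X) (fst Y) + D1 * g (fst z) (y z) (fst X) * g (fst z) (y z) (fst Y)
    + C2 * g (fst z) (cov y X z) (cov y Y z) + D2 * g (fst z) (y z) (cov y X z) * g (fst z) (y z) (cov y Y z)" for X Y
  note lc = linear_add[OF linear_cov_y[OF z]] linear_scale[OF linear_cov_y[OF z]]
  have R_sym: "R X Y = R Y X" for X Y
    using g_sym[OF P_mem[OF z], of "fst X" "fst Y"] g_sym[OF P_mem[OF z], of "cov y X z" "cov y Y z"]
    by (simp add: R_def)
  have R_linear: "linear (R X)" for X
    by (rule linearI) (simp_all add: R_def lc gP_simps z algebra_simps)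
  have hor0: "g (fst z) v (cov y (hor z u) z) = 0" "g (fst z) (cov y (hor z u) z) v = 0" for u v
    by (simp_all add: cov_y_hor[OF z] linear_0[OF g_linear[OF P_mem[OF z]]] linear_0[OF g_linear_left[OF P_mem[OF z]]])
  have fh: "fst (hor z u) = u" for u by (simp add: hor_def)
  note frame = R_def hor0 fh cov_y_axis[OF z] linear_0[OF g_linear[OF P_mem[OF z]]]
    linear_0[OF g_linear_left[OF P_mem[OF z]]] g_y_axis[OF z] g_y_E[OF z]
  \<comment> \<open>Linearity is used one slot at a time: the first argument stays a frame vector
    until the second is general.\<close>
  have H: "G z (hor z (axis i 1)) Y = R (hor z (axis i 1)) Y" for i Y
    by (rule linear_frame_eq[OF z G_linear[OF z] R_linear])
      (simp_all add: G_hor[OF z] G_sym[OF z, of "hor z _" "ver _"] G_ver_hor[OF z] frame C1_def D1_def)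
  have W: "G z (ver (axis i 1)) Y = R (ver (axis i 1)) Y" for i Y
    by (rule linear_frame_eq[OF z G_linear[OF z] R_linear])
      (simp_all add: G_ver[OF z] G_ver_hor[OF z] frame C2_def D2_def)
  have "G z Y X = R Y X"
    by (rule linear_frame_eq[OF z G_linear[OF z] R_linear])
      (simp_all add: G_sym[OF z, of Y] R_sym[of Y] H W)
  then show ?thesis
    unfolding G_sym[OF z, of X Y] R_sym[of Y X] by (simp only: R_def C1_def D1_def C2_def D2_def)
qed

lemma G_pos:
  assumes z: "z \<in> V" and X: "X \<noteq> 0"
  shows "G z X X > 0"
proof -
  define t where "t = tt z"
  have t: "t \<ge> 0" using tt_nonneg[OF z] by (simp add: t_def)
  have at: "a t > 0" "a t + 2 * t * b1 t > 0" "lam t > 0" "lam t + 2 * t * mu t > 0"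
    using a_pos ab_pos lam_pos lam_mu_pos t by blast+
  have inv: "1 / a t + 2 * t * b2 t > 0"
    using at(2) unfolding t_def scalars(1,2)[OF z] by (auto simp: zero_less_divide_iff)
  have CS: "(g (fst z) (y z) v)\<^sup>2 \<le> 2 * t * g (fst z) v v" for v
    using Cauchy_Schwarz_g[OF P_mem[OF z], of "y z" v] by (simp add: g_y_y t_def)
  have c1: "lam t * a t > 0" "lam t * (1 / a t) > 0" using at by simp_all
  \<comment> \<open>In the direction of \<open>y\<close> the coefficients factor as (lam + 2t mu)(a
    + 2t b1) here, and as (lam + 2t mu)(1 / a + 2t b2) in \<open>c3\<close>.\<close>
  have c2: "lam t * a t + 2 * t * (lam t * b1 t + mu t * (a t + 2 * t * b1 t)) > 0"
    using mult_pos_pos[OF at(4,2)] by (simp add: algebra_simps)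
  have c3: "lam t * (1 / a t) + 2 * t * (lam t * b2 t + mu t * (1 / a t + 2 * t * b2 t)) > 0"
    using mult_pos_pos[OF at(4) inv] by (simp add: algebra_simps)
  note p1 = definite_perturbation[OF c1(1) c2 CS t g_nonneg[OF P_mem[OF z]], of "fst X"]
  note p2 = definite_perturbation[OF c1(2) c3 CS t g_nonneg[OF P_mem[OF z]], of "cov y X z"]
  have "fst X \<noteq> 0 \<or> cov y X z \<noteq> 0"
  proof (rule ccontr)
    assume "\<not> (fst X \<noteq> 0 \<or> cov y X z \<noteq> 0)"
    then have "fst X = 0" "snd X \<bullet> v = 0" for v
      using g_cov_y[OF z, of X v] by (simp_all add: linear_0[OF g_linear_left[OF P_mem[OF z]]]
          linear_0[OF linear_chris_left[OF P_mem[OF z]]])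
    from this(1) this(2)[of "snd X"] X show False by (simp add: prod_eq_iff)
  qed
  then have "g (fst z) (fst X) (fst X) > 0 \<or> g (fst z) (cov y X z) (cov y X z) > 0"
    using g_pos[OF P_mem[OF z]] by blast
  then show ?thesis
    unfolding G_full[OF z] t_def[symmetric] using p1 p2 by (auto simp: power2_eq_square mult.assoc add.assoc)
qed

lemma G_eq:
  assumes z: "z \<in> V"
  shows "G z X Y = \<kappa> * hform c z (F.\<Phi> X z) (F.\<Phi> Y z)"
proof -
  \<comment> \<open>\<Phi> carries the factor \<psi>^3, so h(\<Phi>, \<Phi>) carries \<psi>^6 = 1 /
    N^3. The coefficients of \<open>G\<close> are brought to this common factor.\<close>
  define q where "q = \<psi> z ^ 3"
  have q: "q * q = 1 / N z ^ 3"
  proof -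
    have "q * q * N z ^ 3 = ((\<psi> z)\<^sup>2 * N z) ^ 3" unfolding q_def by algebra
    then have "q * q * N z ^ 3 = 1" unfolding \<psi>_N[OF z] by simp
    then show ?thesis using scalars_at(4)[OF z] by (simp add: nonzero_eq_divide_eq)
  qed
  have red: "\<kappa> * c * s / N z = \<kappa> * (c * s * (N z)\<^sup>2) * (q * q)" for s
    unfolding q using scalars_at(4)[OF z] by (simp add: power2_eq_square power3_eq_cube)
  have red': "\<kappa> * s / N z ^ 3 = \<kappa> * s * (q * q)" for s unfolding q by simp
  have C1: "lam (tt z) * az z = \<kappa> * (c * (az z)\<^sup>2 * (N z)\<^sup>2) * (q * q)"
    unfolding scalars(3)[OF z] by (rule red)
  have C2: "lam (tt z) * (1 / az z) = \<kappa> * (c * 1 * (N z)\<^sup>2) * (q * q)"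
    unfolding scalars(5)[OF z] using red[of 1] by simp
  show ?thesis
    unfolding G_full[OF z] C1 C2 scalars(4,6)[OF z] red' \<Phi>_eq[OF z] q_def[symmetric]
    using g_sym[OF P_mem[OF z], of "fst X" "y z"] g_sym[OF P_mem[OF z], of "cov y X z" "y z"]
    by (simp add: hform_def gP_simps z g_y_y) (simp add: algebra_simps power2_eq_square)
qed

text \<open>On the frame, the vectors orthogonal to \<open>y\<close> match at once. In the radial
  direction the coefficient is m / e for horizontal and -e / m for vertical vectors, and the
  remaining multiples of \<open>y\<close> agree by the last two identities of
  \<open>natural_scalars\<close>.\<close>

lemma J_eq:
  assumes z: "z \<in> V"
  shows "F.\<Phi> (J z X) z = times_i (F.\<Phi> X z)"
proof (rule linear_frame_eq[OF z, of "\<lambda>X. F.\<Phi> (J z X) z" "\<lambda>X. times_i (F.\<Phi> X z)"])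
  show "linear (\<lambda>X. F.\<Phi> (J z X) z)" "linear (\<lambda>X. times_i (F.\<Phi> X z))"
    using linear_compose[OF J_linear[OF z] F.linear_\<Phi>[OF z]] linear_compose[OF F.linear_\<Phi>[OF z] F.I_linear]
    by (simp_all add: o_def)
  fix i
  note gz = gP_simps z
  have "cov y (ver (\<chi> l. az z * g (fst z) (axis i 1) (axis l 1) + b1 (tt z) * snd z $ i * snd z $ l)) z =
      az z *\<^sub>R axis i 1 + (b1 (tt z) * snd z $ i) *\<^sub>R y z" (is "cov y (ver ?w) z = ?v")
    unfolding cov_y_ver[OF z]
  proof (rule raise_eqI[OF P_mem[OF z]])
    fix v
    have "linear (\<lambda>v. g (fst z) ?v v)" by (rule g_linear[OF P_mem[OF z]])
    from linear_vec[OF this, of v] show "g (fst z) ?v v = ?w \<bullet> v"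
      by (simp add: gz g_y_axis[OF z])
  qed
  moreover have "g (fst z) (y z) ?v = mz z / ez z * snd z $ i"
    unfolding scalars(1)[OF z, symmetric] by (simp add: gz g_y_axis[OF z] g_y_y algebra_simps)
  moreover have "N z *\<^sub>R ?v - ((az z * dz z + c) * (mz z
      / ez z * snd z $ i)) *\<^sub>R y z =
      (az z * N z) *\<^sub>R axis i 1 - (2 * c * az z * snd z $ i) *\<^sub>R y z"
  proof -
    have "N z *\<^sub>R ?v - ((az z * dz z + c) * (mz z
        / ez z * snd z $ i)) *\<^sub>R y z =
        (az z * N z) *\<^sub>R axis i 1 + ((N z * b1 (tt z) - (az z * dz z + c) *
        (mz z / ez z)) * snd z $ i) *\<^sub>R y z"
      by (simp add: scaleR_add_right scaleR_left_diff_distrib left_diff_distrib right_diff_distrib mult_ac)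
    then show ?thesis unfolding scalars(7)[OF z] by simp
  qed
  ultimately show "F.\<Phi> (J z (hor z (axis i 1))) z = times_i (F.\<Phi> (hor z (axis i 1)) z)"
    unfolding J_hor[OF z] \<Phi>_hor[OF z] \<Phi>_ver[OF z] using scalars_at(2)[OF z]
    by (simp add: times_i_def g_y_axis[OF z])
  let ?u = "- (1 / az z) *\<^sub>R E z i - (b2 (tt z) * y z $ i) *\<^sub>R y z"
  have "g (fst z) (y z) ?u = - (ez z / mz z) * y z $ i"
    unfolding scalars(2)[OF z, symmetric] by (simp add: gz g_y_E[OF z] g_y_y algebra_simps)
  moreover have "(az z * N z) *\<^sub>R ?u - (2 * c * az z * (- (ez z /
      mz z) * y z $ i)) *\<^sub>R y z =
      - (N z *\<^sub>R E z i - ((az z * dz z + c) * y z $ i) *\<^sub>R y z)"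
  proof -
    have "(az z * N z) *\<^sub>R ?u - (2 * c * az z * (- (ez z /
        mz z) * y z $ i)) *\<^sub>R y z =
        ((2 * c * az z * (ez z / mz z)
         - az z * N z * b2 (tt z)) * y z $ i) *\<^sub>R y z - N z *\<^sub>R E z i"
      using scalars_at(1)[OF z]
      by (simp add: scaleR_diff_right scaleR_left_diff_distrib left_diff_distrib right_diff_distrib mult_ac)
    then show ?thesis unfolding scalars(8)[OF z] by simp
  qed
  ultimately show "F.\<Phi> (J z (ver (axis i 1))) z = times_i (F.\<Phi> (ver (axis i 1)) z)"
    unfolding J_ver[OF z] \<Phi>_hor[OF z] \<Phi>_ver[OF z] using scalars_at(3)[OF z]
    by (simp add: times_i_def cov_y_axis[OF z] g_y_E[OF z] scaleR_diff_right)
qed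

text \<open>\<open>G\<close> is given pointwise by its values on a frame; its smoothness is read off
  from its expression through \<Phi>.\<close>

lemma local_metric_G: "local_metric V G"
proof (rule local_metric.intro)
  show "smooth_on V (\<lambda>z. G z X Y)" for X Y
  proof (rule smooth_on_cong)
    show "smooth_on V (\<lambda>z. \<kappa> * hform c z (F.\<Phi> X z) (F.\<Phi> Y z))"
      by (intro smooth_on_mult smooth_on_const F.h_smooth F.\<Phi>_smooth)
  qed (rule G_eq[symmetric])
qed (use open_V G_sym G_linear G_pos in blast)+

text \<open>
  \<open>\<Phi>\<close> maps into a bundle of larger rank, so \<open>\<Phi> (J X) = i \<Phi> X\<close> cannot be solved for \<open>J X\<close> as a square linear
  system; but \<open>J X\<close> is dual under \<open>G\<close> to a smooth form.
\<close>

lemma J_smooth: "smooth_on V (\<lambda>z. J z X)"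
proof -
  interpret M: local_metric V G by (rule local_metric_G)
  have "smooth_on V (\<lambda>z. M.raise z (\<lambda>Y. \<kappa> * hform c z (times_i (F.\<Phi> X z)) (F.\<Phi> Y z)))"
    by (rule M.smooth_on_raise[of "\<lambda>z. z"])
      (auto intro!: smooth_on_id smooth_on_mult smooth_on_const F.h_smooth F.\<Phi>_smooth F.I_smooth)
  then show ?thesis
    by (rule smooth_on_cong) (rule M.raise_eqI, assumption, simp add: G_eq J_eq)
qed

lemma J_isometry: "z \<in> V \<Longrightarrow> G z (J z X) (J z Y) = G z X Y"
  by (simp add: G_eq J_eq F.h_I)

sublocale S: fubini_study V "hform c" times_i "flatD c" \<sigma> G J \<kappa>
  by (intro fubini_study.intro fubini_study_axioms.intro F.flat_hermitian_axioms local_metric_G)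
    (use \<kappa>0 G_eq J_eq J_smooth nondegenerate in blast)+

lemma J_J: "z \<in> V \<Longrightarrow> J z (J z X) = - X"
  using linear_neg[OF F.linear_\<Phi>, of z X]
  by (intro S.\<Phi>_inj[of z]) (simp_all add: J_eq F.I_I)

end


section \<open>The natural structure on the cotangent bundle\<close>

lemma at_within_half_line_not_bot: "t \<ge> 0 \<Longrightarrow> at t within {0::real..} \<noteq> bot"
proof -
  assume t: "t \<ge> 0"
  have "t islimpt {t..t + 1}" by (simp add: islimpt_Icc)
  moreover have "{t..t + 1} \<subseteq> {0..}" using t by auto
  ultimately show ?thesis using islimpt_subset trivial_limit_within by blast
qed

lemma deriv_half_line_eqI:
  "t \<ge> 0 \<Longrightarrow> (f has_real_derivative d) (at t within {0..}) \<Longrightarrow> deriv_half_line f t = d"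
  unfolding deriv_half_line_def
  by (intro vector_derivative_within at_within_half_line_not_bot)
    (simp_all add: has_real_derivative_iff_has_vector_derivative)

lemma smooth_half_line_derivative:
  assumes f: "smooth_on {0..} f" and t: "t \<ge> 0"
  shows "(f has_real_derivative deriv_half_line f t) (at t within {0..})"
proof -
  obtain f' where f': "(f has_derivative f') (at t within {0..})"
    using f t unfolding smooth_on_def by (metis Ck_on.simps(2) atLeast_iff)
  have "f' h = f' 1 * h" for h
    using linear_scale[OF has_derivative_linear[OF f'], of h 1] by simp
  then have "f' = (*) (f' 1)" by (rule ext)
  then have "(f has_real_derivative f' 1) (at t within {0..})"
    using f' unfolding has_field_derivative_def by simp
  with deriv_half_line_eqI[OF t this] show ?thesis by simp
qed

lemma vec_sum_axis: "(\<Sum>l\<in>UNIV. s l *\<^sub>R axis l (1::real)) = (\<chi> l. s l)"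
  using basis_expansion[of "\<chi> l. s l"] by (simp add: scalar_mult_eq_scaleR)

section \<open>From charts to the cotangent bundle\<close>

locale natural_structure = cotangent A + riemannian_atlas A g
  for A :: "('m, real^'n::finite) atlas" and g +
  fixes G :: "(('m, 'n) cot_point, (real^'n) \<times> (real^'n)) bilin"
    and J :: "(('m, 'n) cot_point, (real^'n) \<times> (real^'n)) endo"
    and c k :: real and a1 b1 lam mu :: "real \<Rightarrow> real"
  assumes manifold: "smooth_manifold A"
    and sectional: "constant_sectional_curvature A g c"
    and k0: "k \<noteq> 0"
    and a1_smooth: "smooth_on {0..} a1"
    and e0: "t \<ge> 0 \<Longrightarrow> a1 t - 2 * t * deriv_half_line a1 t \<noteq> 0"
    and N0: "t \<ge> 0 \<Longrightarrow> (a1 t)\<^sup>2 + 2 * c * t \<noteq> 0"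
    and b1_eq: "t \<ge> 0 \<Longrightarrow> b1 t = (a1 t * deriv_half_line a1 t - c) / (a1 t - 2 * t * deriv_half_line a1 t)"
    and lam_eq: "t \<ge> 0 \<Longrightarrow> lam t = 4 * c / k * (a1 t / ((a1 t)\<^sup>2 + 2 * c * t))"
    and mu_eq: "t \<ge> 0 \<Longrightarrow> mu t = deriv_half_line lam t"
    and a1_pos: "t \<ge> 0 \<Longrightarrow> a1 t > 0"
    and ab_pos: "t \<ge> 0 \<Longrightarrow> a1 t + 2 * t * b1 t > 0"
    and lam_pos: "t \<ge> 0 \<Longrightarrow> lam t > 0"
    and lam_mu_pos: "t \<ge> 0 \<Longrightarrow> lam t + 2 * t * deriv_half_line lam t > 0"
    and natural: "natural_diagonal_structure A g a1 b1 lam mu G J"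
begin

lemma a1_deriv: "t \<ge> 0 \<Longrightarrow> (a1 has_real_derivative deriv_half_line a1 t) (at t within {0..})"
  by (rule smooth_half_line_derivative[OF a1_smooth])

lemma c0: "c \<noteq> 0"
  using lam_pos[of 0] lam_eq[of 0] by auto

text \<open>The denominator starts at a1(0)^2 and is nowhere zero, so by the intermediate value
  theorem it stays positive. Only then can \<sigma> be normalised when c is negative.\<close>

lemma N_pos: "t \<ge> 0 \<Longrightarrow> (a1 t)\<^sup>2 + 2 * c * t > 0"
proof (rule ccontr)
  assume t: "t \<ge> 0" and n: "\<not> (a1 t)\<^sup>2 + 2 * c * t > 0"
  have "continuous_on {0..t} (\<lambda>t. (a1 t)\<^sup>2 + 2 * c * t)"
    by (intro continuous_intros continuous_on_subset[OF smooth_on_continuous_on[OF a1_smooth]]) auto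
  then obtain s where "s \<ge> 0" "(a1 s)\<^sup>2 + 2 * c * s = 0"
    using IVT2'[of "\<lambda>t. (a1 t)\<^sup>2 + 2 * c * t" t 0 0] t n by auto
  then show False using N0 by blast
qed

text \<open>The formula for \<open>b1\<close> gives (a1 + 2t b1)(a1 - 2t a1') = a1^2 - 2ct, and both
  factors are nonzero.\<close>

lemma m0: "t \<ge> 0 \<Longrightarrow> (a1 t)\<^sup>2 - 2 * c * t \<noteq> 0"
proof
  assume t: "t \<ge> 0" and m: "(a1 t)\<^sup>2 - 2 * c * t = 0"
  have "(a1 t + 2 * t * b1 t) * (a1 t - 2 * t * deriv_half_line a1 t) = (a1 t)\<^sup>2 - 2 * c * t"
    unfolding b1_eq[OF t] using e0[OF t] by (simp add: field_simps power2_eq_square)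
  then show False using m ab_pos[OF t] e0[OF t] by simp
qed

lemma lam_deriv:
  assumes t: "t \<ge> 0"
  shows "deriv_half_line lam t = 4 / k * c * (- (deriv_half_line a1 t * ((a1 t)\<^sup>2 - 2 * c * t)) - 2 * c * a1 t)
    / ((a1 t)\<^sup>2 + 2 * c * t)\<^sup>2"
proof (rule deriv_half_line_eqI[OF t])
  define N where "N = (a1 t)\<^sup>2 + 2 * c * t"
  have "((\<lambda>t. a1 t / ((a1 t)\<^sup>2 + 2 * c * t)) has_real_derivative
      (deriv_half_line a1 t * N - a1 t * (2 * a1 t * deriv_half_line a1 t + 2 * c)) / (N * N)) (at t within {0..})"
    unfolding N_def using N0[OF t]
    by (auto intro!: derivative_eq_intros a1_deriv[OF t] simp: power2_eq_square)
  then have "((\<lambda>t. 4 * c / k * (a1 t / ((a1 t)\<^sup>2 + 2 * c * t))) has_real_derivative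
      4 * c / k * ((deriv_half_line a1 t * N - a1 t * (2 * a1 t * deriv_half_line a1 t + 2 * c)) / (N * N)))
      (at t within {0..})"
    by (rule DERIV_cmult)
  also have "4 * c / k * ((deriv_half_line a1 t * N - a1 t * (2 * a1 t * deriv_half_line a1 t + 2 * c)) / (N * N)) =
      4 / k * c * (- (deriv_half_line a1 t * ((a1 t)\<^sup>2 - 2 * c * t)) - 2 * c * a1 t) / N\<^sup>2"
    unfolding N_def by (simp add: power2_eq_square algebra_simps)
  finally show "(lam has_real_derivative 4 / k * c * (- (deriv_half_line a1 t * ((a1 t)\<^sup>2 - 2 * c * t)) - 2 * c * a1 t)
      / ((a1 t)\<^sup>2 + 2 * c * t)\<^sup>2) (at t within {0..})"
    unfolding N_def
    by (rule has_field_derivative_transform_within[OF _ zero_less_one]) (use t lam_eq in auto)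
qed

lemma chart_natural: "\<phi> \<in> A \<Longrightarrow>
    natural_chart (snd \<phi> ` fst \<phi>) (gl \<phi>) c a1 (deriv_half_line a1)"
  by (intro natural_chart.intro natural_chart_axioms.intro local_metric_gl
      constant_sectional_curvature_riem[OF sectional] a1_smooth a1_deriv a1_pos c0 N_pos m0 e0)

definition Gh :: "('m, real^'n) chart \<Rightarrow> _" where
  "Gh \<phi> z X Y = G (chart_inv (cc \<phi>) z)
     (coord_vec (cotangent_atlas A) (cc \<phi>) (chart_inv (cc \<phi>) z) X)
     (coord_vec (cotangent_atlas A) (cc \<phi>) (chart_inv (cc \<phi>) z) Y)"

definition Jh :: "('m, real^'n) chart \<Rightarrow> _" where
  "Jh \<phi> z X = J (chart_inv (cc \<phi>) z)
     (coord_vec (cotangent_atlas A) (cc \<phi>) (chart_inv (cc \<phi>) z) X) (cc \<phi>)"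

lemma cc_mem: "\<phi> \<in> A \<Longrightarrow> cc \<phi> \<in> cotangent_atlas A"
  by (simp add: cotangent_atlas_def)

lemma chart_point:
  assumes "\<phi> \<in> A" "z \<in> snd \<phi> ` fst \<phi> \<times> UNIV"
  obtains m where "m \<in> fst \<phi>" "fst z = snd \<phi> m" "chart_inv (cc \<phi>) z = (m, covec \<phi> m (snd z))"
    "(m, covec \<phi> m (snd z)) \<in> fst (cc \<phi>)" "(m, covec \<phi> m (snd z)) \<in> carrier_of (cotangent_atlas A)"
proof -
  obtain m where m: "m \<in> fst \<phi>" "fst z = snd \<phi> m" using assms(2) by auto
  have "chart_inv (cc \<phi>) (fst z, snd z) = (m, covec \<phi> m (snd z))"
    using chart_inv_cc[OF assms(1), of "fst z" "snd z"] m assms(1) by simp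
  moreover have "(m, covec \<phi> m (snd z)) \<in> fst (cc \<phi>)" by (simp add: fst_cc m covec_cotangent)
  ultimately show thesis
    using that[OF m] cc_mem[OF assms(1)] by (auto simp: carrier_of_def)
qed

lemma christoffel_eq:
  assumes \<phi>: "\<phi> \<in> A" "m \<in> fst \<phi>"
  shows "christoffel A g \<phi> m l i j = chr \<phi> (snd \<phi> m) (axis i 1) (axis j 1) $ l"
proof -
  have "fd (loc \<phi> (coord_field A \<phi> v)) (snd \<phi> m) = fd (\<lambda>x. v) (snd \<phi> m)" for v
    by (rule fd_cong[OF chart_image_open[OF \<phi>(1)]]) (use \<phi> in \<open>auto simp: coord_field_def\<close>)
  then show ?thesis
    unfolding christoffel_def
      levi_civita_eq[OF openin_chart_domain[OF \<phi>(1)] \<phi>(2) coord_field_smooth[OF \<phi>(1)] coord_field_smooth[OF \<phi>(1)]]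
    by (simp add: nabla_apply[OF \<phi>] coord_field_def coord_vec_same[OF \<phi>])
qed

lemma chart_structure:
  assumes \<phi>: "\<phi> \<in> A"
  shows "natural_structure_chart (snd \<phi> ` fst \<phi>) (gl \<phi>) c a1 (deriv_half_line a1) (4 / k) b1
    (\<lambda>t. - b1 t / (a1 t * (a1 t + 2 * t * b1 t))) lam mu (Gh \<phi>) (Jh \<phi>)"
proof -
  interpret natural_chart "snd \<phi> ` fst \<phi>" "gl \<phi>" c a1 "deriv_half_line a1" by (rule chart_natural[OF \<phi>])
  let ?A = "cotangent_atlas A"
  \<comment> \<open>The chart isomorphism \<open>coord_vec\<close> is linear, so symmetry and
    linearity pass from the tangent space to components.\<close>
  have bil: "(\<forall>X Y. Gh \<phi> z X Y = Gh \<phi> z Y X) \<and> (\<forall>X. linear (Gh \<phi> z X)) \<and> linear (Jh \<phi> z)" if z: "z \<in> V" for z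
  proof -
    obtain m where m: "m \<in> fst \<phi>" "fst z = snd \<phi> m" and ci: "chart_inv (cc \<phi>) z = (m, covec \<phi> m (snd z))"
      and q: "(m, covec \<phi> m (snd z)) \<in> fst (cc \<phi>)" "(m, covec \<phi> m (snd z)) \<in> carrier_of ?A"
      using chart_point[OF \<phi> z] .
    define e where "e = coord_vec ?A (cc \<phi>) (m, covec \<phi> m (snd z))"
    note t = T.coord_vec_tangent[OF cc_mem[OF \<phi>] q(1), folded e_def]
    note lc = T.coord_vec_lincomb[OF cc_mem[OF \<phi>] q(1), folded e_def]
    have sb: "sym_bilinear_on (tangent_space ?A (m, covec \<phi> m (snd z))) (G (m, covec \<phi> m (snd z)))"
      "linear_endo_on (tangent_space ?A (m, covec \<phi> m (snd z))) (J (m, covec \<phi> m (snd z)))"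
      using natural q(2) unfolding natural_diagonal_structure_def by blast+
    have Ge: "Gh \<phi> z X Y = G (m, covec \<phi> m (snd z)) (e X) (e Y)" for X Y by (simp add: Gh_def ci e_def)
    have Je: "Jh \<phi> z X = J (m, covec \<phi> m (snd z)) (e X) (cc \<phi>)" for X by (simp add: Jh_def ci e_def)
    have sym: "Gh \<phi> z X Y = Gh \<phi> z Y X" for X Y
      unfolding Ge using sb(1) t unfolding sym_bilinear_on_def by blast
    have comb: "Gh \<phi> z (a *\<^sub>R X + b *\<^sub>R Y) Z = a * Gh \<phi> z X Z + b * Gh \<phi> z Y Z" for a b X Y Z
      unfolding Ge lc[symmetric] using sb(1) t unfolding sym_bilinear_on_def by blast
    have Jcomb: "Jh \<phi> z (a *\<^sub>R X + b *\<^sub>R Y) = a *\<^sub>R Jh \<phi> z X + b *\<^sub>R Jh \<phi> z Y" for a b X Y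
    proof -
      have "J (m, covec \<phi> m (snd z)) (lincomb a (e X) b (e Y)) =
          lincomb a (J (m, covec \<phi> m (snd z)) (e X)) b (J (m, covec \<phi> m (snd z)) (e Y))"
        using sb(2) t unfolding linear_endo_on_def by blast
      then show ?thesis unfolding Je lc[symmetric] by (simp add: lincomb_def)
    qed
    have "linear (Gh \<phi> z X)" for X
    proof (rule linearI)
      show "Gh \<phi> z X (Y + Z) = Gh \<phi> z X Y + Gh \<phi> z X Z" for Y Z
        unfolding sym[of X] using comb[of 1 Y 1 Z X] by simp
      show "Gh \<phi> z X (r *\<^sub>R Y) = r *\<^sub>R Gh \<phi> z X Y" for r Y
        unfolding sym[of X] using comb[of r Y 0 Y X] by simp
    qed
    moreover have "linear (Jh \<phi> z)"
    proof (rule linearI)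
      show "Jh \<phi> z (Y + Z) = Jh \<phi> z Y + Jh \<phi> z Z" for Y Z using Jcomb[of 1 Y 1 Z] by simp
      show "Jh \<phi> z (r *\<^sub>R Y) = r *\<^sub>R Jh \<phi> z Y" for r Y using Jcomb[of r Y 0 Y] by simp
    qed
    ultimately show ?thesis using sym by blast
  qed
  have frame: "Jh \<phi> z (hor z (axis i 1)) =
        ver (\<chi> l. a1 (tt z) * gl \<phi> (fst z) (axis i 1) (axis l 1) + b1 (tt z) * snd z $ i * snd z $ l) \<and>
      Jh \<phi> z (ver (axis i 1)) = hor z (- (1 / a1 (tt z)) *\<^sub>R E z i
        - (- b1 (tt z) / (a1 (tt z) * (a1 (tt z) + 2 * tt z * b1 (tt z))) * y z $ i) *\<^sub>R y z) \<and>
      Gh \<phi> z (hor z (axis i 1)) (hor z (axis j 1)) = lam (tt z) * a1 (tt z) * gl \<phi> (fst z) (axis i 1) (axis j 1)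
        + (lam (tt z) * b1 (tt z) + mu (tt z) * (a1 (tt z) + 2 * tt z * b1 (tt z))) * snd z $ i * snd z $ j \<and>
      Gh \<phi> z (ver (axis i 1)) (ver (axis j 1)) = lam (tt z) * (1 / a1 (tt z)) * gl \<phi> (fst z) (E z i) (E z j)
        + (lam (tt z) * (- b1 (tt z) / (a1 (tt z) * (a1 (tt z) + 2 * tt z * b1 (tt z))))
           + mu (tt z) * (1 / a1 (tt z) + 2 * tt z * (- b1 (tt z) / (a1 (tt z) * (a1 (tt z) + 2 * tt z * b1 (tt z))))))
          * y z $ i * y z $ j \<and>
      Gh \<phi> z (ver (axis i 1)) (hor z (axis j 1)) = 0" if z: "z \<in> V" for z i j
  proof -
    obtain m where m: "m \<in> fst \<phi>" "fst z = snd \<phi> m" and ci: "chart_inv (cc \<phi>) z = (m, covec \<phi> m (snd z))"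
      and q: "(m, covec \<phi> m (snd z)) \<in> fst (cc \<phi>)" "(m, covec \<phi> m (snd z)) \<in> carrier_of ?A"
      using chart_point[OF \<phi> z] .
    define w where "w = covec \<phi> m (snd z)"
    have wp: "w (coord_vec A \<phi> m (axis i 1)) = snd z $ i" for i
      by (simp add: w_def covec_def coord_vec_tangent \<phi> m inner_axis)
    have M: "metric_matrix A g \<phi> m = (\<chi> i j. gl \<phi> (fst z) (axis i 1) (axis j 1))"
      using \<phi> m by (simp add: metric_matrix_def gl_def)
    have \<Gamma>0: "(\<Sum>l\<in>UNIV. snd z $ l * christoffel A g \<phi> m l i h) = snd z \<bullet> chris (fst z) (axis i 1) (axis h 1)" for i h
      by (simp add: christoffel_eq[OF \<phi> m(1)] m(2) inner_vec_def)
    have hor_eq: "(axis i 1, \<chi> h. snd z \<bullet> chris (fst z) (axis i 1) (axis h 1)) = hor z (axis i 1)" for i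
      by (simp add: hor_def)
    have Mn: "(\<chi> i j. gl \<phi> (fst z) (axis i 1) (axis j 1)) $ i $ j = gl \<phi> (fst z) (axis i 1) (axis j 1)" for i j by simp
    have "w \<in> cotangent_space A m" by (simp add: w_def covec_cotangent)
    \<comment> \<open>The index expressions of the definition become invariant ones: g^ij is the
      product of \<open>E z i\<close> and \<open>E z j\<close>, g^0i is the i-th component of
      \<open>y z\<close>, p_k \<Gamma>^k_ih is the second part of \<open>hor\<close>, and the energy
      sum is \<open>tt z\<close>.\<close>
    note nat = natural[unfolded natural_diagonal_structure_def, THEN conjunct2, rule_format, OF \<phi> m(1) this,
        unfolded Let_def wp M matrix_inv_metric[OF z] Mn \<Gamma>0 hor_eq y_nth[OF z] tt_sum[OF z]]
    note same = T.coord_vec_same[OF cc_mem[OF \<phi>] q(1)[folded w_def]]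
    have s1: "(\<Sum>l\<in>UNIV. s l *\<^sub>R ver (axis l 1)) = ver (\<chi> l. s l)" for s :: "'n \<Rightarrow> real"
      by (simp add: prod_eq_iff fst_sum snd_sum vec_sum_axis)
    have hl: "linear (hor z)"
      by (rule linearI) (simp_all add: hor_def vec_eq_iff linear_add[OF linear_chris_left[OF P_mem[OF z]]]
          linear_scale[OF linear_chris_left[OF P_mem[OF z]]] inner_add_right)
    have s2: "(\<Sum>l\<in>UNIV. s l *\<^sub>R hor z (axis l 1)) = hor z (\<chi> l. s l)" for s :: "'n \<Rightarrow> real"
      by (simp add: linear_sum[OF hl] linear_scale[OF hl] flip: vec_sum_axis)
    have gE: "gl \<phi> (fst z) (E z i) (E z l) = E z i $ l" for i l
      using g_sym[OF P_mem[OF z], of "E z i" "E z l"] by (simp add: g_E[OF z])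
    have vec: "(\<chi> l. - (1 / a1 (tt z)) * gl \<phi> (fst z) (E z i) (E z l) - b * y z $ i * y z $ l) =
        - (1 / a1 (tt z)) *\<^sub>R E z i - (b * y z $ i) *\<^sub>R y z" for b
      by (simp add: vec_eq_iff gE)
    have Jh: "Jh \<phi> z X = J (m, w) (coord_vec ?A (cc \<phi>) (m, w) X) (cc \<phi>)" for X by (simp add: Jh_def ci w_def)
    have Gh: "Gh \<phi> z X Y = G (m, w) (coord_vec ?A (cc \<phi>) (m, w) X) (coord_vec ?A (cc \<phi>) (m, w) Y)" for X Y
      by (simp add: Gh_def ci w_def)
    show ?thesis
      unfolding Jh Gh using nat[rule_format, of i j, unfolded s1 s2 vec] by (simp only: same)
  qed
  have k4: "4 / k \<noteq> 0" using k0 by simp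
  have sc: "lam t = 4 / k * c * a1 t / ((a1 t)\<^sup>2 + 2 * c * t)" "lam t + 2 * t * mu t > 0"
    "mu t = 4 / k * c * (- (deriv_half_line a1 t * ((a1 t)\<^sup>2 - 2 * c * t)) - 2 * c * a1 t) / ((a1 t)\<^sup>2 + 2 * c * t)\<^sup>2"
    if "t \<ge> 0" for t
    using lam_eq[OF that] lam_mu_pos[OF that] lam_deriv[OF that] by (simp_all add: mu_eq[OF that])
  note b = bil[THEN conjunct1, THEN spec, THEN spec] bil[THEN conjunct2, THEN conjunct1, THEN spec]
    bil[THEN conjunct2, THEN conjunct2]
  note f = frame[THEN conjunct1] frame[THEN conjunct2, THEN conjunct1]
    frame[THEN conjunct2, THEN conjunct2, THEN conjunct1]
    frame[THEN conjunct2, THEN conjunct2, THEN conjunct2, THEN conjunct1]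
    frame[THEN conjunct2, THEN conjunct2, THEN conjunct2, THEN conjunct2]
  show ?thesis
    by (intro natural_structure_chart.intro natural_structure_chart_axioms.intro chart_natural \<phi>)
      (rule k4 b1_eq sc ab_pos lam_pos b f refl, assumption?)+
qed

context
  fixes \<phi> assumes \<phi>: "\<phi> \<in> A"
begin

interpretation natural_structure_chart "snd \<phi> ` fst \<phi>" "gl \<phi>" c a1 "deriv_half_line a1" "4 / k" b1
  "\<lambda>t. - b1 t / (a1 t * (a1 t + 2 * t * b1 t))" lam mu "Gh \<phi>" "Jh \<phi>"
  by (rule chart_structure[OF \<phi>])

text \<open>The interpretation belongs to a single chart and ends with this context; the facts used
  on the whole bundle are restated here without its vocabulary.\<close>

lemma Gh_pos: "z \<in> snd \<phi> ` fst \<phi> \<times> UNIV \<Longrightarrow> X \<noteq> 0 \<Longrightarrow> Gh \<phi> z X X > 0"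
  by (rule G_pos)

lemma Gh_smooth: "smooth_on (snd \<phi> ` fst \<phi> \<times> UNIV) (\<lambda>z. Gh \<phi> z X Y)"
  by (rule S.g_smooth)

lemma Jh_smooth: "smooth_on (snd \<phi> ` fst \<phi> \<times> UNIV) (\<lambda>z. Jh \<phi> z X)"
  by (rule J_smooth)

lemma Jh_Jh: "z \<in> snd \<phi> ` fst \<phi> \<times> UNIV \<Longrightarrow> Jh \<phi> z (Jh \<phi> z X) = - X"
  by (rule J_J)

lemma Gh_Jh: "z \<in> snd \<phi> ` fst \<phi> \<times> UNIV \<Longrightarrow> Gh \<phi> z (Jh \<phi> z X) (Jh \<phi> z Y) = Gh \<phi> z X Y"
  by (rule J_isometry)

lemma Jh_parallel:
  "z \<in> snd \<phi> ` fst \<phi> \<times> UNIV \<Longrightarrow>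
    fd (\<lambda>z. Jh \<phi> z X) z Y + local_metric.chris (Gh \<phi>) z Y (Jh \<phi> z X) = Jh \<phi> z (local_metric.chris (Gh \<phi>) z Y X)"
  using S.parallel_J[OF _ smooth_on_const, of z X Y] by (simp add: S.cov_def)

lemma riem_Gh:
  "z \<in> snd \<phi> ` fst \<phi> \<times> UNIV \<Longrightarrow> local_metric.riem (Gh \<phi>) z X Y Z =
    (k / 4) *\<^sub>R (Gh \<phi> z Z Y *\<^sub>R X - Gh \<phi> z Z X *\<^sub>R Y + Gh \<phi> z Z (Jh \<phi> z Y) *\<^sub>R Jh \<phi> z X
      - Gh \<phi> z Z (Jh \<phi> z X) *\<^sub>R Jh \<phi> z Y + (2 * Gh \<phi> z X (Jh \<phi> z Y)) *\<^sub>R Jh \<phi> z Z)"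
  using S.riem_eq[of z X Y Z] by simp

end

lemma carrier_chart:
  assumes "z \<in> carrier_of (cotangent_atlas A)"
  obtains \<phi> where "\<phi> \<in> A" "z \<in> fst (cc \<phi>)" "snd (cc \<phi>) z \<in> snd \<phi> ` fst \<phi> \<times> UNIV"
proof -
  obtain \<phi> where \<phi>: "\<phi> \<in> A" "z \<in> fst (cc \<phi>)" using assms by (auto simp: carrier_of_def cotangent_atlas_def)
  moreover have "snd (cc \<phi>) z \<in> snd \<phi> ` fst \<phi> \<times> UNIV" using \<phi> cc_image_domain[OF \<phi>(1)] by blast
  ultimately show thesis by (rule that)
qed

lemma natural_on:
  assumes "z \<in> carrier_of (cotangent_atlas A)"
  shows "sym_bilinear_on (tangent_space (cotangent_atlas A) z) (G z)"
    and "linear_endo_on (tangent_space (cotangent_atlas A) z) (J z)"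
  using natural assms unfolding natural_diagonal_structure_def by blast+

lemma J_in_tangent:
  "\<lbrakk>z \<in> carrier_of (cotangent_atlas A); u \<in> tangent_space (cotangent_atlas A) z\<rbrakk> \<Longrightarrow>
    J z u \<in> tangent_space (cotangent_atlas A) z"
  using natural_on(2) unfolding linear_endo_on_def by blast

context
  fixes \<phi> z assumes \<phi>: "\<phi> \<in> A" and z: "z \<in> fst (cc \<phi>)"
begin

lemma G_Gh:
  "\<lbrakk>u \<in> tangent_space (cotangent_atlas A) z; v \<in> tangent_space (cotangent_atlas A) z\<rbrakk> \<Longrightarrow>
    G z u v = Gh \<phi> (snd (cc \<phi>) z) (u (cc \<phi>)) (v (cc \<phi>))"
  by (simp add: Gh_def T.chart_inv_snd[OF cc_mem[OF \<phi>] z] T.coord_vec_of_tangent[OF _ cc_mem[OF \<phi>] z])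

lemma J_Jh: "u \<in> tangent_space (cotangent_atlas A) z \<Longrightarrow> J z u (cc \<phi>) = Jh \<phi> (snd (cc \<phi>) z) (u (cc \<phi>))"
  by (simp add: Jh_def T.chart_inv_snd[OF cc_mem[OF \<phi>] z] T.coord_vec_of_tangent[OF _ cc_mem[OF \<phi>] z])

end

lemma metric_G: "riemannian_metric (cotangent_atlas A) G"
  unfolding riemannian_metric_def
proof (intro conjI ballI allI impI)
  fix z assume z: "z \<in> carrier_of (cotangent_atlas A)"
  show "sym_bilinear_on (tangent_space (cotangent_atlas A) z) (G z)" by (rule natural_on(1)[OF z])
  fix u assume u: "u \<in> tangent_space (cotangent_atlas A) z" "u \<noteq> (\<lambda>_. 0)"
  obtain \<phi> where \<phi>: "\<phi> \<in> A" "z \<in> fst (cc \<phi>)" "snd (cc \<phi>) z \<in> snd \<phi> ` fst \<phi> \<times> UNIV"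
    using carrier_chart[OF z] .
  have "u (cc \<phi>) \<noteq> 0"
  proof
    assume "u (cc \<phi>) = 0"
    then have "u = lincomb 0 u 0 u"
      by (intro T.tangent_eqI[OF u(1) T.lincomb_tangent[OF u(1) u(1)] cc_mem[OF \<phi>(1)] \<phi>(2)])
        (simp add: lincomb_def)
    then show False using u(2) by (simp add: lincomb_def fun_eq_iff)
  qed
  then show "0 < G z u u" unfolding G_Gh[OF \<phi>(1,2) u(1) u(1)] by (rule Gh_pos[OF \<phi>(1,3)])
next
  fix \<phi>' v w assume "\<phi>' \<in> cotangent_atlas A"
  then obtain \<phi> where \<phi>: "\<phi> \<in> A" "\<phi>' = cc \<phi>" by (auto simp: cotangent_atlas_def)
  show "smooth_fun (cotangent_atlas A) (fst \<phi>')
      (\<lambda>p. G p (coord_vec (cotangent_atlas A) \<phi>' p v) (coord_vec (cotangent_atlas A) \<phi>' p w))"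
    unfolding \<phi>(2)
    by (rule T.smooth_funI[OF cc_mem[OF \<phi>(1)] order_refl])
      (use Gh_smooth[OF \<phi>(1), of v w] in \<open>simp add: cc_image_domain[OF \<phi>(1)] Gh_def\<close>)
qed

lemma complex_J: "almost_complex_structure (cotangent_atlas A) J"
  unfolding almost_complex_structure_def
proof (intro conjI ballI allI)
  fix z assume z: "z \<in> carrier_of (cotangent_atlas A)"
  show "linear_endo_on (tangent_space (cotangent_atlas A) z) (J z)" by (rule natural_on(2)[OF z])
  fix u assume u: "u \<in> tangent_space (cotangent_atlas A) z"
  obtain \<phi> where \<phi>: "\<phi> \<in> A" "z \<in> fst (cc \<phi>)" "snd (cc \<phi>) z \<in> snd \<phi> ` fst \<phi> \<times> UNIV"
    using carrier_chart[OF z] .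
  have "J z (J z u) (cc \<phi>) = - u (cc \<phi>)"
    by (simp add: J_Jh[OF \<phi>(1,2)] J_in_tangent[OF z] u Jh_Jh[OF \<phi>(1,3)])
  then have "J z (J z u) = lincomb (-1) u 0 u"
    by (intro T.tangent_eqI[OF J_in_tangent[OF z J_in_tangent[OF z u]] T.lincomb_tangent[OF u u] cc_mem[OF \<phi>(1)] \<phi>(2)])
      (simp add: lincomb_def)
  then show "J z (J z u) = (\<lambda>\<phi>. - u \<phi>)" by (simp add: lincomb_def)
next
  fix \<phi>' v assume "\<phi>' \<in> cotangent_atlas A"
  then obtain \<phi> where \<phi>: "\<phi> \<in> A" "\<phi>' = cc \<phi>" by (auto simp: cotangent_atlas_def)
  have s: "smooth_on (snd (cc \<phi>) ` fst (cc \<phi>))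
      (\<lambda>x. J (chart_inv (cc \<phi>) x) (coord_vec (cotangent_atlas A) (cc \<phi>) (chart_inv (cc \<phi>) x) v) (cc \<phi>))"
    using Jh_smooth[OF \<phi>(1), of v] by (simp add: cc_image_domain[OF \<phi>(1)] Jh_def)
  have t: "J z (coord_vec (cotangent_atlas A) (cc \<phi>) z v) \<in> tangent_space (cotangent_atlas A) z"
    if "z \<in> fst (cc \<phi>)" for z
    by (rule J_in_tangent[OF _ T.coord_vec_tangent[OF cc_mem[OF \<phi>(1)] that]])
      (use that cc_mem[OF \<phi>(1)] in \<open>auto simp: carrier_of_def\<close>)
  show "(\<lambda>p. J p (coord_vec (cotangent_atlas A) \<phi>' p v)) \<in> smooth_fields (cotangent_atlas A) (fst \<phi>')"
    unfolding \<phi>(2)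
    by (rule T.smooth_fieldsI[where X = "\<lambda>p. J p (coord_vec (cotangent_atlas A) (cc \<phi>) p v)",
          OF cc_mem[OF \<phi>(1)] order_refl t s])
qed

lemma J_isometric:
  assumes z: "z \<in> carrier_of (cotangent_atlas A)"
    and u: "u \<in> tangent_space (cotangent_atlas A) z" and v: "v \<in> tangent_space (cotangent_atlas A) z"
  shows "G z (J z u) (J z v) = G z u v"
proof -
  obtain \<phi> where \<phi>: "\<phi> \<in> A" "z \<in> fst (cc \<phi>)" "snd (cc \<phi>) z \<in> snd \<phi> ` fst \<phi> \<times> UNIV"
    using carrier_chart[OF z] .
  show ?thesis
    by (simp add: G_Gh[OF \<phi>(1,2)] J_Jh[OF \<phi>(1,2)] J_in_tangent[OF z] u v Gh_Jh[OF \<phi>(1,3)])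
qed

theorem kaehler_einstein:
  "kaehler_manifold (cotangent_atlas A) G J \<and> einstein (cotangent_atlas A) G \<and>
    constant_holomorphic_sectional_curvature (cotangent_atlas A) G J k"
proof -
  interpret H: almost_hermitian "cotangent_atlas A" G J
    by unfold_locales (rule metric_G complex_J J_isometric; assumption)+
  \<comment> \<open>The local expressions that the general theory forms in the chart
    \<open>cc \<phi>\<close> are literally \<open>Gh \<phi>\<close> and \<open>Jh \<phi>\<close>, so
    the results in charts transfer by rewriting.\<close>
  have gl: "H.gl (cc \<phi>) = Gh \<phi>" and Jl: "H.Jl (cc \<phi>) = Jh \<phi>" for \<phi>
    by (intro ext, simp add: H.gl_def H.Jl_def Gh_def Jh_def)+
  interpret P: parallel_complex "cotangent_atlas A" G J
  proof
    fix \<phi>' x u v assume "\<phi>' \<in> cotangent_atlas A" and x: "x \<in> snd \<phi>' ` fst \<phi>'"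
    then obtain \<phi> where \<phi>: "\<phi> \<in> A" "\<phi>' = cc \<phi>" by (auto simp: cotangent_atlas_def)
    have "x \<in> snd \<phi> ` fst \<phi> \<times> UNIV" using x by (simp add: \<phi>(2) cc_image_domain[OF \<phi>(1)])
    from Jh_parallel[OF \<phi>(1) this, of v u]
    show "fd (\<lambda>x. H.Jl \<phi>' x v) x u + local_metric.chris (H.gl \<phi>') x u (H.Jl \<phi>' x v) =
        H.Jl \<phi>' x (local_metric.chris (H.gl \<phi>') x u v)"
      by (simp add: \<phi>(2) gl Jl)
  qed
  interpret K: constant_holomorphic "cotangent_atlas A" G J k
  proof
    fix \<phi>' x u v w assume "\<phi>' \<in> cotangent_atlas A" and x: "x \<in> snd \<phi>' ` fst \<phi>'"
    then obtain \<phi> where \<phi>: "\<phi> \<in> A" "\<phi>' = cc \<phi>" by (auto simp: cotangent_atlas_def)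
    have "x \<in> snd \<phi> ` fst \<phi> \<times> UNIV" using x by (simp add: \<phi>(2) cc_image_domain[OF \<phi>(1)])
    from riem_Gh[OF \<phi>(1) this, of u v w]
    show "local_metric.riem (H.gl \<phi>') x u v w =
      (k / 4) *\<^sub>R (H.gl \<phi>' x w v *\<^sub>R u - H.gl \<phi>' x w u *\<^sub>R v + H.gl \<phi>' x w (H.Jl \<phi>' x v) *\<^sub>R H.Jl \<phi>' x u
      - H.gl \<phi>' x w (H.Jl \<phi>' x u) *\<^sub>R H.Jl \<phi>' x v + (2 * H.gl \<phi>' x u (H.Jl \<phi>' x v)) *\<^sub>R H.Jl \<phi>' x w)"
      by (simp add: \<phi>(2) gl Jl)
  qed
  show ?thesis
    using P.kaehler[OF cotangent_manifold[OF manifold]] K.einstein K.constant_holomorphic by blast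
qed

end

theorem theorem9:
  fixes A :: "('m, real^'n) atlas"
    and g :: "('m, real^'n) bilin"
    and G :: "(('m, 'n::finite) cot_point, (real^'n) \<times> (real^'n)) bilin"
    and J :: "(('m, 'n) cot_point, (real^'n) \<times> (real^'n)) endo"
    and c k :: real
    and a1 b1 lam mu :: "real \<Rightarrow> real"
  assumes "riemannian_manifold A g"
    and "CARD('n) > 1"
    and "constant_sectional_curvature A g c"
    and "k \<noteq> 0"
    and "smooth_on {0..} a1"
    and "\<And>t. t \<ge> 0 \<Longrightarrow> a1 t - 2 * t * deriv_half_line a1 t \<noteq> 0"
    and "\<And>t. t \<ge> 0 \<Longrightarrow> (a1 t)\<^sup>2 + 2 * c * t \<noteq> 0"
    and "\<And>t. t \<ge> 0 \<Longrightarrow>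
           b1 t = (a1 t * deriv_half_line a1 t - c) / (a1 t - 2 * t * deriv_half_line a1 t)"
    and "\<And>t. t \<ge> 0 \<Longrightarrow> lam t = 4 * c / k * (a1 t / ((a1 t)\<^sup>2 + 2 * c * t))"
    and "\<And>t. t \<ge> 0 \<Longrightarrow> mu t = deriv_half_line lam t"
    and "\<And>t. t \<ge> 0 \<Longrightarrow> a1 t > 0"
    and "\<And>t. t \<ge> 0 \<Longrightarrow> a1 t + 2 * t * b1 t > 0"
    and "\<And>t. t \<ge> 0 \<Longrightarrow> lam t > 0"
    and "\<And>t. t \<ge> 0 \<Longrightarrow> lam t + 2 * t * deriv_half_line lam t > 0"
    and "natural_diagonal_structure A g a1 b1 lam mu G J"
  shows "kaehler_manifold (cotangent_atlas A) G J \<and> einstein (cotangent_atlas A) G \<and>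
         constant_holomorphic_sectional_curvature (cotangent_atlas A) G J k"
proof -
  have "smooth_manifold A" "riemannian_metric A g"
    using assms(1) unfolding riemannian_manifold_def by blast+
  then interpret natural_structure A g G J c k a1 b1 lam mu
    by unfold_locales (use assms(3-15) in \<open>simp_all add: smooth_manifold_def\<close>)
  show ?thesis by (rule kaehler_einstein)
qed

end
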